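(* Assume that $q$ and $f$ do not depend on the major player's control $\alpha^0$ (write $q(t,i,j,\alpha,i^0,x)$, $f(t,i,\alpha,i^0,x)$). Assume moreover: (1) for all $i^0\in\{1,\dots,M^0\}$, $(t,x)\in[0,T]\times\mathcal{P}$ and $v^0\in\mathbb{R}^{M^0}$, the function $\alpha^0\mapsto f^0(t,i^0,\alpha^0,x)+\sum_{j^0\ne i^0}(v^0_{j^0}-v^0_{i^0})q^0(t,i^0,j^0,\alpha^0,x)$ has a unique minimizer in $A_0$, denoted $\hat\alpha^0(t,i^0,x,v^0)$, and $\hat\alpha^0$ is Lipschitz in $(t,x,v^0)$ for all $i^0$ with common Lipschitz constant $L_{\alpha^0}$; (2) for all $i\in\{1,\dots,M\}$, $i^0\in\{1,\dots,M^0\}$, $(t,x)\in[0,T]\times\mathcal{P}$ and $v\in\mathbb{R}^{M\times M^0}$, the function $\alpha\mapsto f(t,i,\alpha,i^0,x)+\sum_{j\ne i}(v_{j,i^0}-v_{i,i^0})q(t,i,j,\alpha,i^0,x)$ has a unique minimizer in $A$, denoted $\hat\alpha(t,i,i^0,x,v)$, and $\hat\alpha$ is Lipschitz in $(t,x,v)$ for all $i,i^0$ with common Lipschitz constant $L_\alpha$. Then: (i) For any Lipschitz feedback function $\phi$ of the minor players, the best response $\boldsymbol\phi^{0*}(\phi)$ of the major player exists and is given by $$\boldsymbol\phi^{0*}(\phi)(t,i^0,x)=\hat\alpha^0(t,i^0,x,V^0_\phi(t,\cdot,x)),$$ where $V^0_\phi$ is the value function of the major player's optimization problem. (ii) For any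 Lipschitz feedback functions $\phi^0$ of the major player and $\phi$ of the other minor players, the best response $\boldsymbol\phi^*(\phi^0,\phi)$ of the representative minor player exists and is given by $$\boldsymbol\phi^*(\phi^0,\phi)(t,i,i^0,x)=\hat\alpha(t,i,i^0,x,V_{\phi^0,\phi}(t,\cdot,\cdot,x)),$$ where $V_{\phi^0,\phi}$ is the value function of the representative minor player's optimization problem.
   Context: Model data. Fix $T>0$, integers $M^0\ge1$, $M\ge2$, convex sets $A_0$ (controls of the major player) and $A$ (controls of the minor players) in normed vector spaces, and $\mathcal{P}=\{x\in\mathbb{R}^{M-1}: x_i\ge0,\ \sum_i x_i\le1\}$. Given are rate functions $q(t,i,j,\alpha,i^0,x)$, $q^0(t,i^0,j^0,\alpha^0,x)$ and real-valued costs $f^0(t,i^0,\alpha^0,x)$, $g^0(i^0,x)$, $f(t,i,\alpha,i^0,x)$, $g(i,i^0,x)$ (where $q,f$ are assumed independent of $\alpha^0$, as stated in the claim), with $t\in[0,T]$, $i,j\in\{1,\dots,M\}$, $i^0,j^0\in\{1,\dots,M^0\}$, $\alpha\in A$, $\alpha^0\in A_0$, $x\in\mathcal{P}$. Standing assumptions. (a) For all values of the other arguments, $[q(t,i,j,\alpha,i^0,x)]_{i,j}$ and $[q^0(t,i^0,j^0,\alpha^0,x)]_{i^0,j^0}$ are Q-matrices (nonnegative off-diagonal entries, zero row sums). (b) There is $L>0$ such that $f,f^0,g,g^0,q,q^0$ are $L$-Lipschitz in $(t,x,\alpha^0,\alpha)$ (in those variables they depend on), uniformly in the discrete variables. (c)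 $|q|\le C$ for some constant $C$. (d) There is $\epsilon>0$ such that for all $t,\alpha,i^0$ and all $i\ne j$ in $\{1,\dots,M-1\}$: $x_i<\epsilon$ implies $q(t,i,j,\alpha,i^0,x)=0$, and $1-\sum_{k=1}^{M-1}x_k<\epsilon$ implies $q(t,M,i,\alpha,i^0,x)=0$. Feedback functions: $\phi^0:[0,T]\times\{1,\dots,M^0\}\times\mathcal{P}\to A_0$ and $\phi,\bar\phi:[0,T]\times\{1,\dots,M\}\times\{1,\dots,M^0\}\times\mathcal{P}\to A$; Lipschitz means Lipschitz in $(t,x)$ uniformly in the discrete variables. Put $q^0_{\phi^0}(t,i^0,j^0,x)=q^0(t,i^0,j^0,\phi^0(t,i^0,x),x)$, $q_\phi(t,i,j,i^0,x)=q(t,i,j,\phi(t,i,i^0,x),i^0,x)$, $f^0_{\phi^0}(t,i^0,x)=f^0(t,i^0,\phi^0(t,i^0,x),x)$, $f_\phi(t,i,i^0,x)=f(t,i,\phi(t,i,i^0,x),i^0,x)$. Major player's problem. For Lipschitz $\phi^0,\phi$ let $(X^0_t,\mu_t)$ be the time-inhomogeneous Markov process in $\{1,\dots,M^0\}\times\mathcal{P}$ with space-time generator $$[\mathcal{G}^0_{\phi^0,\phi}F](t,i^0,x)=\partial_tF+\sum_{j^0\ne i^0}[F(t,j^0,x)-F(t,i^0,x)]q^0_{\phi^0}(t,i^0,j^0,x)+\sum_{k,l=1}^{M-1}\partial_{x_l}F\,x_k\,q_\phi(t,k,l,i^0,x)+\Bigl(1-\sum_{k=1}^{M-1}x_k\Bigr)\sum_{l=1}^{M-1}\partial_{x_l}F\,q_\phi(t,M,l,i^0,x).$$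 Set $J^0_{\phi^0,\phi}(t,i^0,x)=\mathbb{E}[\int_t^Tf^0_{\phi^0}(s,X^0_s,\mu_s)ds+g^0(X^0_T,\mu_T)\mid X^0_t=i^0,\mu_t=x]$ and $V^0_\phi=\inf_{\phi^0}J^0_{\phi^0,\phi}$ (infimum over admissible, i.e. Lipschitz, $\phi^0$). A best response of the major player to $\phi$ is an admissible $\phi^0$ with $J^0_{\phi^0,\phi}=V^0_\phi$. Representative minor player's problem. For Lipschitz $\phi^0,\phi,\bar\phi$ let $(X_t,X^0_t,\mu_t)$ be the time-inhomogeneous Markov process in $\{1,\dots,M\}\times\{1,\dots,M^0\}\times\mathcal{P}$ with space-time generator $$\begin{aligned}[\mathcal{G}_{\phi^0,\phi,\bar\phi}F](t,i,i^0,x)=\;&\partial_tF+\sum_{j^0\ne i^0}[F(t,i,j^0,x)-F(t,i,i^0,x)]q^0_{\phi^0}(t,i^0,j^0,x)+\sum_{j\ne i}[F(t,j,i^0,x)-F(t,i,i^0,x)]q_{\bar\phi}(t,i,j,i^0,x)\\&+\sum_{k,l=1}^{M-1}\partial_{x_l}F\,x_k\,q_\phi(t,k,l,i^0,x)+\Bigl(1-\sum_{k=1}^{M-1}x_k\Bigr)\sum_{l=1}^{M-1}\partial_{x_l}F\,q_\phi(t,M,l,i^0,x).\end{aligned}$$ Set $J_{\phi^0,\phi,\bar\phi}(t,i,i^0,x)=\mathbb{E}[\int_t^Tf_{\bar\phi}(s,X_s,X^0_s,\mu_s)ds+g(X_T,X^0_T,\mu_T)\mid X_t=i,X^0_t=i^0,\mu_t=x]$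 and $V_{\phi^0,\phi}=\inf_{\bar\phi}J_{\phi^0,\phi,\bar\phi}$ (infimum over admissible, i.e. Lipschitz, $\bar\phi$). A best response of the representative minor player to $(\phi^0,\phi)$ is an admissible $\bar\phi$ with $J_{\phi^0,\phi,\bar\phi}=V_{\phi^0,\phi}$. *)

theory Defs
  imports "HOL-Probability.Probability"
begin

text \<open>
  The major player's states are the elements of a finite type \<open>'k\<close> (so \<open>M\<^sup>0 = CARD('k) \<ge> 1\<close>).
  The minor players' states are the elements of \<open>'m option\<close> with \<open>'m\<close> finite: \<open>Some i\<close> is one of the
  first \<open>M - 1\<close> states, \<open>None\<close> is the last state \<open>M\<close>, and \<open>M = CARD('m) + 1 \<ge> 2\<close>.  A distribution
  of the minor players is given by its first \<open>M - 1\<close> weights, i.e. by an element of \<open>real^'m\<close>.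
  The controls live in normed spaces \<open>'a0\<close> (major player) and \<open>'a\<close> (minor players).
\<close>

definition simplex_coords :: "(real^'m::finite) set" where
  "simplex_coords = {x. (\<forall>i. 0 \<le> x $ i) \<and> (\<Sum>i\<in>UNIV. x $ i) \<le> 1}"

definition Q_matrix :: "('i::finite \<Rightarrow> 'i \<Rightarrow> real) \<Rightarrow> bool" where
  "Q_matrix Q \<longleftrightarrow> (\<forall>i j. i \<noteq> j \<longrightarrow> 0 \<le> Q i j) \<and> (\<forall>i. (\<Sum>j\<in>UNIV. Q i j) = 0)"

type_synonym ('a0, 'k, 'm) major_rate = "real \<Rightarrow> 'k \<Rightarrow> 'k \<Rightarrow> 'a0 \<Rightarrow> real^'m \<Rightarrow> real"
type_synonym ('a, 'k, 'm) minor_rate =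
  "real \<Rightarrow> 'm option \<Rightarrow> 'm option \<Rightarrow> 'a \<Rightarrow> 'k \<Rightarrow> real^'m \<Rightarrow> real"
type_synonym ('a0, 'k, 'm) major_cost_rate = "real \<Rightarrow> 'k \<Rightarrow> 'a0 \<Rightarrow> real^'m \<Rightarrow> real"
type_synonym ('a, 'k, 'm) minor_cost_rate =
  "real \<Rightarrow> 'm option \<Rightarrow> 'a \<Rightarrow> 'k \<Rightarrow> real^'m \<Rightarrow> real"

type_synonym ('a0, 'k, 'm) major_feedback = "real \<Rightarrow> 'k \<Rightarrow> real^'m \<Rightarrow> 'a0"
type_synonym ('a, 'k, 'm) minor_feedback = "real \<Rightarrow> 'm option \<Rightarrow> 'k \<Rightarrow> real^'m \<Rightarrow> 'a"

text \<open>Feedback functions are total; only their values on \<open>[0,T]\<close> and the simplex matter.\<close>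

definition admissible_major ::
  "real \<Rightarrow> 'a0::real_normed_vector set \<Rightarrow> ('a0, 'k::finite, 'm::finite) major_feedback \<Rightarrow> bool" where
  "admissible_major T A0 \<phi>0 \<longleftrightarrow>
     (\<forall>t\<in>{0..T}. \<forall>i0. \<forall>x\<in>simplex_coords. \<phi>0 t i0 x \<in> A0) \<and>
     (\<exists>K. \<forall>i0. K-lipschitz_on ({0..T} \<times> simplex_coords) (\<lambda>(t, x). \<phi>0 t i0 x))"

definition admissible_minor ::
  "real \<Rightarrow> 'a::real_normed_vector set \<Rightarrow> ('a, 'k::finite, 'm::finite) minor_feedback \<Rightarrow> bool" where
  "admissible_minor T A \<phi> \<longleftrightarrow>
     (\<forall>t\<in>{0..T}. \<forall>i i0. \<forall>x\<in>simplex_coords. \<phi> t i i0 x \<in> A) \<and>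
     (\<exists>K. \<forall>i i0. K-lipschitz_on ({0..T} \<times> simplex_coords) (\<lambda>(t, x). \<phi> t i i0 x))"


subsection \<open>Markov processes with a given space-time generator\<close>

text \<open>
  The processes below have states \<open>(d, x)\<close> with a discrete component \<open>d :: 'd\<close> and a component \<open>x\<close> in
  the simplex.  A time-inhomogeneous Markov process consists of a measurable space, a family of
  laws indexed by the starting time and the starting state, and the paths.
\<close>

record ('w, 's) process =
  outcomes :: "'w measure"
  law :: "real \<Rightarrow> 's \<Rightarrow> 'w measure"
  traj :: "real \<Rightarrow> 'w \<Rightarrow> 's"

definition state_borel :: "('d::finite \<times> (real^'m::finite)) measure" where
  "state_borel = count_space UNIV \<Otimes>\<^sub>M borel"

definition state_set :: "('d::finite \<times> (real^'m::finite)) set" where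
  "state_set = UNIV \<times> simplex_coords"

definition history ::
  "('w, 'd::finite \<times> (real^'m::finite)) process \<Rightarrow> real \<Rightarrow> real \<Rightarrow> 'w measure" where
  "history Y s r = sigma (space (outcomes Y))
     {traj Y u -` B \<inter> space (outcomes Y) | u B. u \<in> {s..r} \<and> B \<in> sets state_borel}"

text \<open>
  The last condition is the Markov property
  \<open>P\<^bsub>s,z\<^esub>(Z\<^sub>t \<in> B | Z\<^sub>u, s \<le> u \<le> r) = P\<^bsub>r,Z\<^sub>r\<^esub>(Z\<^sub>t \<in> B)\<close> almost surely.  Right-continuity of the paths
  refers to the discrete topology in the first component.
\<close>

definition markov_process ::
  "real \<Rightarrow> ('w, 'd::finite \<times> (real^'m::finite)) process \<Rightarrow> bool" where
  "markov_process T Y \<longleftrightarrow>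
     (\<forall>s\<in>{0..T}. \<forall>z\<in>state_set. prob_space (law Y s z) \<and> sets (law Y s z) = sets (outcomes Y)) \<and>
     (\<forall>t\<in>{0..T}. traj Y t \<in> measurable (outcomes Y) state_borel) \<and>
     (\<forall>t\<in>{0..T}. \<forall>\<omega>\<in>space (outcomes Y). traj Y t \<omega> \<in> state_set) \<and>
     (\<forall>t\<in>{0..<T}. \<forall>\<omega>\<in>space (outcomes Y).
        (\<forall>\<^sub>F r in at_right t. fst (traj Y r \<omega>) = fst (traj Y t \<omega>)) \<and>
        ((\<lambda>r. snd (traj Y r \<omega>)) \<longlongrightarrow> snd (traj Y t \<omega>)) (at_right t)) \<and>
     (\<forall>s\<in>{0..T}. \<forall>z\<in>state_set. AE \<omega> in law Y s z. traj Y s \<omega> = z) \<and>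
     (\<forall>s\<in>{0..T}. \<forall>t\<in>{s..T}. \<forall>B\<in>sets state_borel.
        (\<lambda>z. measure (law Y s z) {\<omega> \<in> space (outcomes Y). traj Y t \<omega> \<in> B})
          \<in> borel_measurable (restrict_space state_borel state_set)) \<and>
     (\<forall>s\<in>{0..T}. \<forall>r\<in>{s..T}. \<forall>t\<in>{r..T}. \<forall>z\<in>state_set. \<forall>B\<in>sets state_borel.
        AE \<omega> in law Y s z.
          real_cond_exp (law Y s z) (history Y s r) (indicator {\<omega> \<in> space (outcomes Y). traj Y t \<omega> \<in> B}) \<omega>
          = measure (law Y r (traj Y r \<omega>)) {\<omega>' \<in> space (outcomes Y). traj Y t \<omega>' \<in> B})"

text \<open>
  Test functions: restrictions to \<open>[0,T]\<close> and the simplex of functions that are \<open>C\<^sup>1\<close> in \<open>(t, x)\<close> on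
  the whole space.
\<close>

definition C1_test :: "(real \<Rightarrow> 'd \<Rightarrow> real^'m::finite \<Rightarrow> real) \<Rightarrow> bool" where
  "C1_test F \<longleftrightarrow>
     (\<forall>d. \<exists>F' :: real \<times> (real^'m) \<Rightarrow> (real \<times> (real^'m)) \<Rightarrow>\<^sub>L real.
        (\<forall>p. ((\<lambda>(t, x). F t d x) has_derivative blinfun_apply (F' p)) (at p)) \<and>
        continuous_on UNIV F')"

definition dt :: "(real \<Rightarrow> 'd \<Rightarrow> real^'m \<Rightarrow> real) \<Rightarrow> real \<Rightarrow> 'd \<Rightarrow> real^'m \<Rightarrow> real" where
  "dt F t d x = deriv (\<lambda>s. F s d x) t"

definition dx ::
  "'m::finite \<Rightarrow> (real \<Rightarrow> 'd \<Rightarrow> real^'m \<Rightarrow> real) \<Rightarrow> real \<Rightarrow> 'd \<Rightarrow> real^'m \<Rightarrow> real" where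
  "dx l F t d x = deriv (\<lambda>h. F t d (x + h *\<^sub>R axis l 1)) 0"

text \<open>
  \<open>G\<close> is the infinitesimal generator, on \<open>C\<^sup>1\<close> functions, of the transition semigroup of the space-time
  process \<open>(t, Z\<^sub>t)\<close>: the difference quotients converge in the supremum norm.
\<close>

definition has_generator ::
  "real \<Rightarrow> ('w, 'd::finite \<times> (real^'m::finite)) process
   \<Rightarrow> ((real \<Rightarrow> 'd \<Rightarrow> real^'m \<Rightarrow> real) \<Rightarrow> real \<Rightarrow> 'd \<Rightarrow> real^'m \<Rightarrow> real) \<Rightarrow> bool" where
  "has_generator T Y G \<longleftrightarrow>
     (\<forall>F. C1_test F \<longrightarrow>
       (\<forall>e>0. \<forall>\<^sub>F h in at_right 0. \<forall>t\<in>{0..T - h}. \<forall>d. \<forall>x\<in>simplex_coords.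
          \<bar>((\<integral>\<omega>. (case traj Y (t + h) \<omega> of (d', x') \<Rightarrow> F (t + h) d' x') \<partial>law Y t (d, x)) - F t d x) / h
             - G F t d x\<bar> < e))"


subsection \<open>The major player's problem\<close>

text \<open>The part of the generators coming from the flow of the distribution of the minor players;
  \<open>d\<close> is the discrete state and \<open>i0\<close> its major player component.\<close>

definition transport ::
  "('a, 'k::finite, 'm::finite) minor_rate \<Rightarrow> ('a, 'k, 'm) minor_feedback
   \<Rightarrow> (real \<Rightarrow> 'd \<Rightarrow> real^'m \<Rightarrow> real) \<Rightarrow> real \<Rightarrow> 'd \<Rightarrow> 'k \<Rightarrow> real^'m \<Rightarrow> real" where
  "transport q \<phi> F t d i0 x =
     (\<Sum>k\<in>UNIV. \<Sum>l\<in>UNIV.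
        dx l F t d x * x $ k * q t (Some k) (Some l) (\<phi> t (Some k) i0 x) i0 x)
     + (1 - (\<Sum>k\<in>UNIV. x $ k)) *
       (\<Sum>l\<in>UNIV. dx l F t d x * q t None (Some l) (\<phi> t None i0 x) i0 x)"

definition major_generator ::
  "('a0, 'k::finite, 'm::finite) major_rate \<Rightarrow> ('a, 'k, 'm) minor_rate
   \<Rightarrow> ('a0, 'k, 'm) major_feedback \<Rightarrow> ('a, 'k, 'm) minor_feedback
   \<Rightarrow> (real \<Rightarrow> 'k \<Rightarrow> real^'m \<Rightarrow> real) \<Rightarrow> real \<Rightarrow> 'k \<Rightarrow> real^'m \<Rightarrow> real" where
  "major_generator q0 q \<phi>0 \<phi> F t i0 x =
     dt F t i0 x
     + (\<Sum>j0\<in>UNIV - {i0}. (F t j0 x - F t i0 x) * q0 t i0 j0 (\<phi>0 t i0 x) x)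
     + transport q \<phi> F t i0 i0 x"

definition major_cost ::
  "real \<Rightarrow> ('a0, 'k::finite, 'm::finite) major_cost_rate \<Rightarrow> ('k \<Rightarrow> real^'m \<Rightarrow> real)
   \<Rightarrow> ('w, 'k \<times> (real^'m)) process \<Rightarrow> ('a0, 'k, 'm) major_feedback
   \<Rightarrow> real \<Rightarrow> 'k \<Rightarrow> real^'m \<Rightarrow> real" where
  "major_cost T f0 g0 Y \<phi>0 t i0 x =
     (\<integral>\<omega>. (LINT s:{t..T}|lborel. case traj Y s \<omega> of (j0, y) \<Rightarrow> f0 s j0 (\<phi>0 s j0 y) y)
          + (case traj Y T \<omega> of (j0, y) \<Rightarrow> g0 j0 y) \<partial>law Y t (i0, x))"

text \<open>
  \<open>Y \<phi>0 \<phi>\<close> is the state process under the feedback functions \<open>\<phi>0\<close> and \<open>\<phi>\<close>.  The infimum is taken in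
  the reals: if the Hamiltonian at \<open>v = 0\<close>, which is the running cost, has a minimizer in the control
  set that is Lipschitz in \<open>(t, x)\<close>, then the running cost, hence the expected cost, is bounded below.
\<close>

definition major_value ::
  "real \<Rightarrow> 'a0::real_normed_vector set \<Rightarrow> ('a0, 'k::finite, 'm::finite) major_cost_rate
   \<Rightarrow> ('k \<Rightarrow> real^'m \<Rightarrow> real)
   \<Rightarrow> (('a0, 'k, 'm) major_feedback \<Rightarrow> ('a, 'k, 'm) minor_feedback \<Rightarrow> ('w, 'k \<times> (real^'m)) process)
   \<Rightarrow> ('a, 'k, 'm) minor_feedback \<Rightarrow> real \<Rightarrow> 'k \<Rightarrow> real^'m \<Rightarrow> real" where
  "major_value T A0 f0 g0 Y \<phi> t i0 x =
     (INF \<phi>0\<in>{\<phi>0. admissible_major T A0 \<phi>0}. major_cost T f0 g0 (Y \<phi>0 \<phi>) \<phi>0 t i0 x)"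

definition major_best_response ::
  "real \<Rightarrow> 'a0::real_normed_vector set \<Rightarrow> ('a0, 'k::finite, 'm::finite) major_cost_rate
   \<Rightarrow> ('k \<Rightarrow> real^'m \<Rightarrow> real)
   \<Rightarrow> (('a0, 'k, 'm) major_feedback \<Rightarrow> ('a, 'k, 'm) minor_feedback \<Rightarrow> ('w, 'k \<times> (real^'m)) process)
   \<Rightarrow> ('a, 'k, 'm) minor_feedback \<Rightarrow> ('a0, 'k, 'm) major_feedback \<Rightarrow> bool" where
  "major_best_response T A0 f0 g0 Y \<phi> \<phi>0 \<longleftrightarrow>
     admissible_major T A0 \<phi>0 \<and>
     (\<forall>t\<in>{0..T}. \<forall>i0. \<forall>x\<in>simplex_coords.
        major_cost T f0 g0 (Y \<phi>0 \<phi>) \<phi>0 t i0 x = major_value T A0 f0 g0 Y \<phi> t i0 x)"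

definition major_hamiltonian ::
  "('a0, 'k::finite, 'm::finite) major_rate \<Rightarrow> ('a0, 'k, 'm) major_cost_rate
   \<Rightarrow> real \<Rightarrow> 'k \<Rightarrow> real^'m \<Rightarrow> real^'k \<Rightarrow> 'a0 \<Rightarrow> real" where
  "major_hamiltonian q0 f0 t i0 x v \<alpha>0 =
     f0 t i0 \<alpha>0 x + (\<Sum>j0\<in>UNIV - {i0}. (v $ j0 - v $ i0) * q0 t i0 j0 \<alpha>0 x)"

definition major_minimizer ::
  "'a0 set \<Rightarrow> ('a0, 'k::finite, 'm::finite) major_rate \<Rightarrow> ('a0, 'k, 'm) major_cost_rate
   \<Rightarrow> real \<Rightarrow> 'k \<Rightarrow> real^'m \<Rightarrow> real^'k \<Rightarrow> 'a0" where
  "major_minimizer A0 q0 f0 t i0 x v = arg_min_on (major_hamiltonian q0 f0 t i0 x v) A0"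


subsection \<open>The representative minor player's problem\<close>

text \<open>The state is \<open>((i, i0), x)\<close>; the other minor players use \<open>\<phi>\<close>, the representative one uses \<open>\<psi>\<close>.\<close>

definition minor_generator ::
  "('a0, 'k::finite, 'm::finite) major_rate \<Rightarrow> ('a, 'k, 'm) minor_rate
   \<Rightarrow> ('a0, 'k, 'm) major_feedback \<Rightarrow> ('a, 'k, 'm) minor_feedback \<Rightarrow> ('a, 'k, 'm) minor_feedback
   \<Rightarrow> (real \<Rightarrow> 'm option \<times> 'k \<Rightarrow> real^'m \<Rightarrow> real)
   \<Rightarrow> real \<Rightarrow> 'm option \<times> 'k \<Rightarrow> real^'m \<Rightarrow> real" where
  "minor_generator q0 q \<phi>0 \<phi> \<psi> F t d x =
     (case d of (i, i0) \<Rightarrow>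
       dt F t (i, i0) x
       + (\<Sum>j0\<in>UNIV - {i0}. (F t (i, j0) x - F t (i, i0) x) * q0 t i0 j0 (\<phi>0 t i0 x) x)
       + (\<Sum>j\<in>UNIV - {i}. (F t (j, i0) x - F t (i, i0) x) * q t i j (\<psi> t i i0 x) i0 x)
       + transport q \<phi> F t (i, i0) i0 x)"

definition minor_cost ::
  "real \<Rightarrow> ('a, 'k::finite, 'm::finite) minor_cost_rate \<Rightarrow> ('m option \<Rightarrow> 'k \<Rightarrow> real^'m \<Rightarrow> real)
   \<Rightarrow> ('w, ('m option \<times> 'k) \<times> (real^'m)) process \<Rightarrow> ('a, 'k, 'm) minor_feedback
   \<Rightarrow> real \<Rightarrow> 'm option \<Rightarrow> 'k \<Rightarrow> real^'m \<Rightarrow> real" where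
  "minor_cost T f g Y \<psi> t i i0 x =
     (\<integral>\<omega>. (LINT s:{t..T}|lborel. case traj Y s \<omega> of ((j, j0), y) \<Rightarrow> f s j (\<psi> s j j0 y) j0 y)
          + (case traj Y T \<omega> of ((j, j0), y) \<Rightarrow> g j j0 y) \<partial>law Y t ((i, i0), x))"

definition minor_value ::
  "real \<Rightarrow> 'a::real_normed_vector set \<Rightarrow> ('a, 'k::finite, 'm::finite) minor_cost_rate
   \<Rightarrow> ('m option \<Rightarrow> 'k \<Rightarrow> real^'m \<Rightarrow> real)
   \<Rightarrow> (('a0, 'k, 'm) major_feedback \<Rightarrow> ('a, 'k, 'm) minor_feedback \<Rightarrow> ('a, 'k, 'm) minor_feedback
       \<Rightarrow> ('w, ('m option \<times> 'k) \<times> (real^'m)) process)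
   \<Rightarrow> ('a0, 'k, 'm) major_feedback \<Rightarrow> ('a, 'k, 'm) minor_feedback
   \<Rightarrow> real \<Rightarrow> 'm option \<Rightarrow> 'k \<Rightarrow> real^'m \<Rightarrow> real" where
  "minor_value T A f g Y \<phi>0 \<phi> t i i0 x =
     (INF \<psi>\<in>{\<psi>. admissible_minor T A \<psi>}. minor_cost T f g (Y \<phi>0 \<phi> \<psi>) \<psi> t i i0 x)"

definition minor_best_response ::
  "real \<Rightarrow> 'a::real_normed_vector set \<Rightarrow> ('a, 'k::finite, 'm::finite) minor_cost_rate
   \<Rightarrow> ('m option \<Rightarrow> 'k \<Rightarrow> real^'m \<Rightarrow> real)
   \<Rightarrow> (('a0, 'k, 'm) major_feedback \<Rightarrow> ('a, 'k, 'm) minor_feedback \<Rightarrow> ('a, 'k, 'm) minor_feedback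
       \<Rightarrow> ('w, ('m option \<times> 'k) \<times> (real^'m)) process)
   \<Rightarrow> ('a0, 'k, 'm) major_feedback \<Rightarrow> ('a, 'k, 'm) minor_feedback
   \<Rightarrow> ('a, 'k, 'm) minor_feedback \<Rightarrow> bool" where
  "minor_best_response T A f g Y \<phi>0 \<phi> \<psi> \<longleftrightarrow>
     admissible_minor T A \<psi> \<and>
     (\<forall>t\<in>{0..T}. \<forall>i i0. \<forall>x\<in>simplex_coords.
        minor_cost T f g (Y \<phi>0 \<phi> \<psi>) \<psi> t i i0 x = minor_value T A f g Y \<phi>0 \<phi> t i i0 x)"

definition minor_hamiltonian ::
  "('a, 'k::finite, 'm::finite) minor_rate \<Rightarrow> ('a, 'k, 'm) minor_cost_rate
   \<Rightarrow> real \<Rightarrow> 'm option \<Rightarrow> 'k \<Rightarrow> real^'m \<Rightarrow> real^'k^('m option) \<Rightarrow> 'a \<Rightarrow> real" where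
  "minor_hamiltonian q f t i i0 x v \<alpha> =
     f t i \<alpha> i0 x + (\<Sum>j\<in>UNIV - {i}. (v $ j $ i0 - v $ i $ i0) * q t i j \<alpha> i0 x)"

definition minor_minimizer ::
  "'a set \<Rightarrow> ('a, 'k::finite, 'm::finite) minor_rate \<Rightarrow> ('a, 'k, 'm) minor_cost_rate
   \<Rightarrow> real \<Rightarrow> 'm option \<Rightarrow> 'k \<Rightarrow> real^'m \<Rightarrow> real^'k^('m option) \<Rightarrow> 'a" where
  "minor_minimizer A q f t i i0 x v = arg_min_on (minor_hamiltonian q f t i i0 x v) A"

end

theory Submission
  imports Defs
begin

text \<open>
  Both players solve a control problem of the same kind.  A discrete state jumps at rates that the
  control influences, while the distribution \<open>x\<close> of the population is transported along a Lipschitz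
  drift that depends on the discrete state but not on the control.  For the major player the discrete
  state is \<open>i0\<close>; for the representative minor player it is \<open>(i, i0)\<close>, and the jumps of \<open>i0\<close> only add
  to the Hamiltonian a term that does not contain the control, so they do not change its minimizer.

  The value function should solve the dynamic programming equation, but it is in general no more than
  Lipschitz continuous, whereas the generator of the state process is only known on continuously
  differentiable functions.  Two facts close this gap.

  First, \<open>x\<close> really moves along the drift.  Dynkin's formula for the squared distance to an Euler step
  bounds the second moment of the deviation after time \<open>h\<close> by a multiple of \<open>h\<^sup>3\<close>, see
  \<open>Euler_step_second_moment\<close>.  Hence the generator extends to every Lipschitz function that has a
  derivative along the drift, see \<open>generates_lipschitz\<close>.

  Second, the dynamic programming equation has such a solution \<open>u\<close>, see
  \<open>dynamic_programming_solution\<close>.  It is a limit of an explicit backward scheme, whose bounds and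
  Lipschitz constants do not depend on the mesh.  The bounds come first: they confine the arguments of
  the minimizer to a bounded set, on which the minimized Hamiltonian is Lipschitz although the rates
  may be unbounded in the control.

  Given \<open>u\<close>, Dynkin's formula shows that the cost of any admissible feedback exceeds \<open>u\<close> by the
  expected integral of the gap between the Hamiltonian at the chosen control and its minimum, see
  \<open>cost_eq\<close>.  The gap is nonnegative.  It vanishes for the minimizing feedback, which is admissible
  because \<open>u\<close> and the minimizer are Lipschitz; so \<open>u\<close> is the value function and the minimizing
  feedback is a best response.  Conversely, if a feedback has the cost \<open>u\<close> from every starting point,
  then right-continuity of the paths forces its gap to vanish everywhere, and uniqueness of the
  minimizer identifies it.
\<close>

section \<open>Markov processes: Chapman-Kolmogorov and Dynkin's formula\<close>

abbreviation simplex :: "(real^'m::finite) set" ("\<S>") where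
  "\<S> \<equiv> simplex_coords"

definition continuous_on_states :: "real \<Rightarrow> (real \<Rightarrow> 'd \<Rightarrow> real^'m::finite \<Rightarrow> real) \<Rightarrow> bool" where
  "continuous_on_states T v \<longleftrightarrow>
     (\<forall>d. continuous_on ({0..T} \<times> \<S>) (\<lambda>(t, x). v t d x))"

lemma simplex_coords_bounds:
  assumes "x \<in> \<S>"
  shows "norm x \<le> 1"
proof -
  have "norm x \<le> (\<Sum>i\<in>UNIV. \<bar>x $ i\<bar>)" by (rule norm_le_l1_cart)
  also have "\<dots> = (\<Sum>i\<in>UNIV. x $ i)" using assms by (auto simp: simplex_coords_def)
  also have "\<dots> \<le> 1" using assms by (auto simp: simplex_coords_def)
  finally show ?thesis .
qed

lemma compact_simplex_coords: "compact (\<S> :: (real^'m::finite) set)"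
proof (rule compact_eq_bounded_closed[THEN iffD2], rule conjI)
  show "bounded (\<S> :: (real^'m::finite) set)"
    using simplex_coords_bounds by (auto simp: bounded_iff)
  have "(\<S> :: (real^'m) set) = (\<Inter>i. {x. 0 \<le> x $ i}) \<inter> {x. (\<Sum>i\<in>UNIV. x $ i) \<le> 1}"
    by (auto simp: simplex_coords_def)
  also have "closed \<dots>"
    by (intro closed_Int closed_INT ballI closed_Collect_le continuous_intros)
  finally show "closed (\<S> :: (real^'m) set)" .
qed

lemma zero_in_simplex_coords: "0 \<in> \<S>"
  by (simp add: simplex_coords_def)

lemma simplex_coords_borel [measurable]: "\<S> \<in> sets borel"
  by (simp add: borel_closed compact_imp_closed compact_simplex_coords)

lemma space_state_borel [simp]: "space state_borel = UNIV"
  by (simp add: state_borel_def space_pair_measure)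

lemma continuous_on_states_bounded:
  fixes v :: "real \<Rightarrow> 'd::finite \<Rightarrow> real^'m::finite \<Rightarrow> real"
  assumes "continuous_on_states T v"
  obtains M where "M \<ge> 0" "\<And>t d x. t \<in> {0..T} \<Longrightarrow> x \<in> \<S> \<Longrightarrow> \<bar>v t d x\<bar> \<le> M"
proof -
  have "\<exists>M. \<forall>p\<in>{0..T} \<times> \<S>. \<bar>(\<lambda>(t, x). v t d x) p\<bar> \<le> M" for d
  proof -
    have "compact ((\<lambda>(t, x). v t d x) ` ({0..T} \<times> \<S>))"
      using assms unfolding continuous_on_states_def
      by (intro compact_continuous_image compact_Times compact_simplex_coords) auto
    from compact_imp_bounded[OF this] show ?thesis by (auto simp: bounded_iff)
  qed
  then obtain M where "\<And>d. \<forall>p\<in>{0..T} \<times> \<S>. \<bar>(\<lambda>(t, x). v t d x) p\<bar> \<le> M d" by metis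
  then have M: "\<bar>v t d x\<bar> \<le> M d" if "t \<in> {0..T}" "x \<in> \<S>" for t d x
    using that by fastforce
  show ?thesis
  proof (rule that)
    show "0 \<le> (\<Sum>d\<in>UNIV. \<bar>M d\<bar>)" by (simp add: sum_nonneg)
    fix t d and x :: "real^'m" assume "t \<in> {0..T}" "x \<in> \<S>"
    then have "\<bar>v t d x\<bar> \<le> \<bar>M d\<bar>" using M[of t x d] by linarith
    also have "\<dots> \<le> (\<Sum>d\<in>UNIV. \<bar>M d\<bar>)" by (intro member_le_sum) auto
    finally show "\<bar>v t d x\<bar> \<le> (\<Sum>d\<in>UNIV. \<bar>M d\<bar>)" .
  qed
qed

text \<open>Nothing is known about \<open>v\<close> outside the state set, which the indicator therefore cuts off.\<close>

lemma continuous_on_states_measurable: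
  fixes v :: "real \<Rightarrow> 'd::finite \<Rightarrow> real^'m::finite \<Rightarrow> real"
  assumes "continuous_on_states T v" "t \<in> {0..T}"
  shows "(\<lambda>z. indicator state_set z * v t (fst z) (snd z)) \<in> borel_measurable state_borel"
proof -
  have "(\<lambda>x. indicator \<S> x *\<^sub>R v t d x) \<in> borel_measurable borel" for d
  proof (rule borel_measurable_continuous_on_indicator)
    have "continuous_on \<S> ((\<lambda>(t, x). v t d x) \<circ> (\<lambda>x. (t, x)))"
      using assms unfolding continuous_on_states_def
      by (intro continuous_on_compose continuous_intros) (auto intro: continuous_on_subset)
    then show "continuous_on \<S> (\<lambda>x. v t d x)" by (simp add: o_def)
  qed simp
  then have *: "(\<lambda>z. indicator \<S> (snd z) *\<^sub>R v t d (snd z))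
      \<in> borel_measurable (state_borel :: ('d \<times> (real^'m)) measure)" for d
    unfolding state_borel_def by (rule measurable_compose[OF measurable_snd])
  have "(\<lambda>z. indicator \<S> (snd z) *\<^sub>R v t (fst z) (snd z)) \<in> borel_measurable state_borel"
    by (rule measurable_compose_countable[OF *]) (simp add: state_borel_def)
  moreover have "indicator state_set z = (indicator \<S> (snd z) :: real)"
    for z :: "'d \<times> (real^'m)"
    by (cases z) (auto simp: state_set_def indicator_def)
  ultimately show ?thesis by simp
qed

locale markov =
  fixes T :: real and Y :: "('w, 'd::finite \<times> (real^'m::finite)) process"
  assumes markov: "markov_process T Y"
begin

abbreviation on_path :: "(real \<Rightarrow> 'd \<Rightarrow> real^'m \<Rightarrow> real) \<Rightarrow> real \<Rightarrow> 'w \<Rightarrow> real" where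
  "on_path v t \<omega> \<equiv> v t (fst (traj Y t \<omega>)) (snd (traj Y t \<omega>))"

definition mean :: "real \<Rightarrow> 'd \<times> (real^'m) \<Rightarrow> (real \<Rightarrow> 'd \<Rightarrow> real^'m \<Rightarrow> real) \<Rightarrow> real \<Rightarrow> real" where
  "mean s z v r = (\<integral>\<omega>. on_path v r \<omega> \<partial>law Y s z)"

lemma law_prob_space: "s \<in> {0..T} \<Longrightarrow> z \<in> state_set \<Longrightarrow> prob_space (law Y s z)"
  and sets_law: "s \<in> {0..T} \<Longrightarrow> z \<in> state_set \<Longrightarrow> sets (law Y s z) = sets (outcomes Y)"
  and traj_measurable_outcomes: "t \<in> {0..T} \<Longrightarrow> traj Y t \<in> measurable (outcomes Y) state_borel"
  and traj_in_state_set: "t \<in> {0..T} \<Longrightarrow> \<omega> \<in> space (outcomes Y) \<Longrightarrow> traj Y t \<omega> \<in> state_set"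
  and traj_start: "s \<in> {0..T} \<Longrightarrow> z \<in> state_set \<Longrightarrow> AE \<omega> in law Y s z. traj Y s \<omega> = z"
  using markov unfolding markov_process_def by auto

lemma traj_right_continuous:
  assumes "t \<in> {0..<T}" "\<omega> \<in> space (outcomes Y)"
  shows "\<forall>\<^sub>F r in at_right t. fst (traj Y r \<omega>) = fst (traj Y t \<omega>)"
    and "((\<lambda>r. snd (traj Y r \<omega>)) \<longlongrightarrow> snd (traj Y t \<omega>)) (at_right t)"
  using markov assms unfolding markov_process_def by auto

lemma transition_measurable:
  assumes "s \<in> {0..T}" "t \<in> {s..T}" "B \<in> sets state_borel"
  shows "(\<lambda>z. measure (law Y s z) {\<omega> \<in> space (outcomes Y). traj Y t \<omega> \<in> B})
      \<in> borel_measurable (restrict_space state_borel state_set)"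
  using markov assms unfolding markov_process_def by blast

lemma markov_property:
  assumes "s \<in> {0..T}" "r \<in> {s..T}" "t \<in> {r..T}" "z \<in> state_set" "B \<in> sets state_borel"
  shows "AE \<omega> in law Y s z.
          real_cond_exp (law Y s z) (history Y s r) (indicator {\<omega> \<in> space (outcomes Y). traj Y t \<omega> \<in> B}) \<omega>
          = measure (law Y r (traj Y r \<omega>)) {\<omega>' \<in> space (outcomes Y). traj Y t \<omega>' \<in> B}"
  using markov assms unfolding markov_process_def by blast

lemma space_law: "s \<in> {0..T} \<Longrightarrow> z \<in> state_set \<Longrightarrow> space (law Y s z) = space (outcomes Y)"
  by (rule sets_eq_imp_space_eq[OF sets_law])

lemma traj_measurable:
  assumes "s \<in> {0..T}" "z \<in> state_set" "t \<in> {0..T}"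
  shows "traj Y t \<in> measurable (law Y s z) state_borel"
  using traj_measurable_outcomes[OF assms(3)] sets_law[OF assms(1,2)]
  by (simp cong: measurable_cong_sets)

lemma history_subalgebra:
  assumes "s \<in> {0..T}" "z \<in> state_set" "r \<le> T"
  shows "subalgebra (law Y s z) (history Y s r)"
proof -
  let ?G = "{traj Y u -` B \<inter> space (outcomes Y) | u B. u \<in> {s..r} \<and> B \<in> sets state_borel}"
  have "?G \<subseteq> sets (outcomes Y)"
    using traj_measurable_outcomes assms by (auto intro!: measurable_sets)
  then have "?G \<subseteq> Pow (space (outcomes Y))" "sigma_sets (space (outcomes Y)) ?G \<subseteq> sets (outcomes Y)"
    by (auto intro!: sets.sigma_sets_subset dest: sets.sets_into_space)
  then show ?thesis
    unfolding subalgebra_def history_def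
    by (simp add: sets_law[OF assms(1,2)] space_law[OF assms(1,2)])
qed

lemma path_function_measurable:
  assumes "continuous_on_states T v" "s \<in> {0..T}" "z \<in> state_set" "t \<in> {0..T}"
  shows "(\<lambda>\<omega>. on_path v t \<omega>) \<in> borel_measurable (law Y s z)"
proof -
  have "(\<lambda>\<omega>. indicator state_set (traj Y t \<omega>) * on_path v t \<omega>)
      \<in> borel_measurable (law Y s z)"
    using measurable_compose[OF traj_measurable[OF assms(2-4)] continuous_on_states_measurable[OF assms(1,4)]]
    by simp
  then show ?thesis
    by (rule measurable_cong[THEN iffD1, rotated])
      (use traj_in_state_set[OF assms(4)] space_law[OF assms(2,3)] in auto)
qed

lemma traj_snd_simplex:
  assumes "t \<in> {0..T}" "\<omega> \<in> space (outcomes Y)"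
  shows "snd (traj Y t \<omega>) \<in> \<S>"
  using traj_in_state_set[OF assms] by (auto simp: state_set_def)

lemma path_function_integrable:
  assumes v: "continuous_on_states T v" and "s \<in> {0..T}" "z \<in> state_set" "t \<in> {0..T}"
  shows "integrable (law Y s z) (\<lambda>\<omega>. on_path v t \<omega>)"
proof -
  interpret prob_space "law Y s z" by (rule law_prob_space[OF assms(2,3)])
  obtain M where M: "\<And>t d x. t \<in> {0..T} \<Longrightarrow> x \<in> \<S> \<Longrightarrow> \<bar>v t d x\<bar> \<le> M"
    using continuous_on_states_bounded[OF v] by metis
  show ?thesis
  proof (rule integrable_const_bound[where B=M])
    show "AE \<omega> in law Y s z. norm (on_path v t \<omega>) \<le> M"
      by (rule AE_I2) (use M traj_snd_simplex space_law assms in \<open>simp del: atLeastAtMost_iff\<close>)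
  qed (rule path_function_measurable[OF assms])
qed

text \<open>The Markov property speaks of events.  Taking expectations in it shows that the law of \<open>Z\<^sub>t\<close> is a
  composition of two transition kernels, and integrals of functions follow from that.\<close>

lemma Chapman_Kolmogorov:
  assumes s: "s \<in> {0..T}" and r: "r \<in> {s..T}" and t: "t \<in> {r..T}" and z: "z \<in> state_set"
    and v: "continuous_on_states T v"
  shows "mean s z v t = (\<integral>\<omega>. mean r (traj Y r \<omega>) v t \<partial>law Y s z)"
    and "(\<lambda>\<omega>. mean r (traj Y r \<omega>) v t) \<in> borel_measurable (law Y s z)"
proof -
  have r0: "r \<in> {0..T}" and t0: "t \<in> {0..T}" using s r t by auto
  interpret prob_space "law Y s z" by (rule law_prob_space[OF s z])
  interpret F: finite_measure_subalgebra "law Y s z" "history Y s r"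
    by unfold_locales (use history_subalgebra[OF s z] r in auto)
  let ?S = "restrict_space state_borel state_set :: ('d \<times> (real^'m)) measure"
  let ?K = "\<lambda>z. distr (law Y r z) state_borel (traj Y t)"
  let ?v = "\<lambda>z. indicator state_set z * v t (fst z) (snd z)"
  have spS: "space ?S = state_set" by (simp add: space_restrict_space)
  have em: "emeasure (?K z') B = ennreal (measure (law Y r z') {\<omega> \<in> space (outcomes Y). traj Y t \<omega> \<in> B})"
    if "z' \<in> state_set" "B \<in> sets state_borel" for z' B
  proof -
    interpret K: prob_space "law Y r z'" by (rule law_prob_space[OF r0 that(1)])
    have "traj Y t -` B \<inter> space (outcomes Y) = {\<omega> \<in> space (outcomes Y). traj Y t \<omega> \<in> B}" by auto
    then show ?thesis
      using emeasure_distr[OF traj_measurable[OF r0 that(1) t0] that(2)] space_law[OF r0 that(1)]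
      by (simp add: K.emeasure_eq_measure)
  qed
  have K: "?K \<in> measurable ?S (subprob_algebra state_borel)"
  proof (rule measurable_subprob_algebra)
    fix z' assume "z' \<in> space ?S"
    then have z': "z' \<in> state_set" by (simp add: spS)
    show "subprob_space (?K z')"
      by (intro prob_space_imp_subprob_space prob_space.prob_space_distr law_prob_space[OF r0 z']
          traj_measurable[OF r0 z' t0])
    show "sets (?K z') = sets state_borel" by simp
  next
    fix B :: "('d \<times> (real^'m)) set" assume B: "B \<in> sets state_borel"
    have "(\<lambda>z'. ennreal (measure (law Y r z') {\<omega> \<in> space (outcomes Y). traj Y t \<omega> \<in> B})) \<in> borel_measurable ?S"
      using transition_measurable[OF r0 t B] by simp
    then show "(\<lambda>z'. emeasure (?K z') B) \<in> borel_measurable ?S"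
      by (rule measurable_cong[THEN iffD1, rotated]) (use em B spS in auto)
  qed
  have trS: "traj Y r \<in> measurable (law Y s z) ?S"
    by (rule measurable_restrict_space2)
      (use traj_measurable[OF s z r0] traj_in_state_set[OF r0] space_law[OF s z] in auto)
  have KN: "(\<lambda>\<omega>. ?K (traj Y r \<omega>)) \<in> measurable (law Y s z) (subprob_algebra state_borel)"
    by (rule measurable_compose[OF trS K])
  have v_meas: "?v \<in> borel_measurable state_borel"
    by (rule continuous_on_states_measurable[OF v t0])
  obtain M where M: "M \<ge> 0" "\<And>t d x. t \<in> {0..T} \<Longrightarrow> x \<in> \<S> \<Longrightarrow> \<bar>v t d x\<bar> \<le> M"
    using continuous_on_states_bounded[OF v] by metis
  have vM: "\<bar>?v z'\<bar> \<le> M" for z'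
    using M t0 by (cases z') (auto simp: state_set_def indicator_def)
  have bind: "distr (law Y s z) state_borel (traj Y t) = law Y s z \<bind> (\<lambda>\<omega>. ?K (traj Y r \<omega>))"
  proof (rule measure_eqI)
    show "sets (distr (law Y s z) state_borel (traj Y t)) = sets (law Y s z \<bind> (\<lambda>\<omega>. ?K (traj Y r \<omega>)))"
      using sets_bind[of "law Y s z" "\<lambda>\<omega>. ?K (traj Y r \<omega>)" state_borel] not_empty by auto
  next
    fix B assume "B \<in> sets (distr (law Y s z) state_borel (traj Y t))"
    then have B: "B \<in> sets state_borel" by simp
    let ?E = "{\<omega> \<in> space (outcomes Y). traj Y t \<omega> \<in> B}"
    have E: "?E \<in> sets (law Y s z)"
      using measurable_sets[OF traj_measurable[OF s z t0] B] space_law[OF s z]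
      by (simp add: vimage_def Int_def conj_commute)
    have "emeasure (law Y s z \<bind> (\<lambda>\<omega>. ?K (traj Y r \<omega>))) B = (\<integral>\<^sup>+\<omega>. emeasure (?K (traj Y r \<omega>)) B \<partial>law Y s z)"
      by (rule emeasure_bind[OF not_empty KN B])
    also have "\<dots> = (\<integral>\<^sup>+\<omega>. ennreal (measure (law Y r (traj Y r \<omega>)) ?E) \<partial>law Y s z)"
      by (intro nn_integral_cong em B traj_in_state_set[OF r0]) (simp add: space_law[OF s z])
    also have "\<dots> = (\<integral>\<^sup>+\<omega>. ennreal (real_cond_exp (law Y s z) (history Y s r) (indicator ?E) \<omega>) \<partial>law Y s z)"
      using markov_property[OF s r t z B] by (intro nn_integral_cong_AE) auto
    also have "\<dots> = ennreal (\<integral>\<omega>. real_cond_exp (law Y s z) (history Y s r) (indicator ?E) \<omega> \<partial>law Y s z)"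
    proof (rule nn_integral_eq_integral)
      show "integrable (law Y s z) (real_cond_exp (law Y s z) (history Y s r) (indicator ?E))"
        by (rule F.real_cond_exp_int) (use E in \<open>simp add: emeasure_eq_measure\<close>)
      show "AE \<omega> in law Y s z. 0 \<le> real_cond_exp (law Y s z) (history Y s r) (indicator ?E) \<omega>"
        using markov_property[OF s r t z B] by eventually_elim simp
    qed
    also have "\<dots> = ennreal (\<integral>\<omega>. indicator ?E \<omega> \<partial>law Y s z)"
      by (subst F.real_cond_exp_int(2)) (use E in \<open>simp_all add: emeasure_eq_measure\<close>)
    also have "\<dots> = emeasure (law Y s z) ?E"
      using E by (simp add: emeasure_eq_measure)
    also have "?E = traj Y t -` B \<inter> space (law Y s z)"
      using space_law[OF s z] by auto
    also have "emeasure (law Y s z) \<dots> = emeasure (distr (law Y s z) state_borel (traj Y t)) B"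
      by (rule emeasure_distr[symmetric, OF traj_measurable[OF s z t0] B])
    finally show "emeasure (distr (law Y s z) state_borel (traj Y t)) B = emeasure (law Y s z \<bind> (\<lambda>\<omega>. ?K (traj Y r \<omega>))) B" ..
  qed
  have mean_K: "mean s' z' v t = integral\<^sup>L (distr (law Y s' z') state_borel (traj Y t)) ?v"
    if "s' \<in> {0..T}" "z' \<in> state_set" for s' z'
    unfolding mean_def integral_distr[OF traj_measurable[OF that t0] v_meas]
    by (rule Bochner_Integration.integral_cong)
      (use traj_in_state_set[OF t0] space_law[OF that] in auto)
  have eq: "mean r (traj Y r \<omega>) v t = integral\<^sup>L (?K (traj Y r \<omega>)) ?v" if "\<omega> \<in> space (law Y s z)" for \<omega>
    using that traj_in_state_set[OF r0] space_law[OF s z] by (intro mean_K[OF r0]) auto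
  have "mean s z v t = integral\<^sup>L (law Y s z \<bind> (\<lambda>\<omega>. ?K (traj Y r \<omega>))) ?v"
    unfolding mean_K[OF s z] bind ..
  also have "\<dots> = (\<integral>\<omega>. integral\<^sup>L (?K (traj Y r \<omega>)) ?v \<partial>law Y s z)"
  proof (rule integral_bind[where K = state_borel and B = M and B' = 1])
    show "AE \<omega> in law Y s z. emeasure (?K (traj Y r \<omega>)) (space (?K (traj Y r \<omega>))) \<le> ennreal 1"
    proof (rule AE_I2)
      fix \<omega> assume "\<omega> \<in> space (law Y s z)"
      then have "subprob_space (?K (traj Y r \<omega>))"
        using measurable_space[OF KN] by (auto simp: space_subprob_algebra)
      then show "emeasure (?K (traj Y r \<omega>)) (space (?K (traj Y r \<omega>))) \<le> ennreal 1"
        by (simp add: subprob_space.subprob_emeasure_le_1)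
    qed
  qed (use KN v_meas vM finite_measure_axioms in auto)
  finally show "mean s z v t = (\<integral>\<omega>. mean r (traj Y r \<omega>) v t \<partial>law Y s z)"
    using eq by (simp cong: Bochner_Integration.integral_cong)
  have "(\<lambda>\<omega>. integral\<^sup>L (?K (traj Y r \<omega>)) ?v) \<in> borel_measurable (law Y s z)"
    by (rule measurable_compose[OF KN integral_measurable_subprob_algebra[OF v_meas]])
  then show "(\<lambda>\<omega>. mean r (traj Y r \<omega>) v t) \<in> borel_measurable (law Y s z)"
    by (rule measurable_cong[THEN iffD1, rotated]) (use eq in auto)
qed

end

text \<open>Uniformity is what makes a right derivative enough: \<open>k\<close> is a uniform limit of continuous difference
  quotients, hence continuous, and then the difference quotients from the left converge to it as well.\<close>

lemma has_integral_of_uniform_right_difference: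
  fixes a k :: "real \<Rightarrow> real"
  assumes sr: "s \<le> r"
    and bound: "\<And>q. q \<in> {s..r} \<Longrightarrow> \<bar>k q\<bar> \<le> M"
    and diff: "\<And>e. e > 0 \<Longrightarrow> \<exists>h0>0. \<forall>h. 0 < h \<and> h < h0 \<longrightarrow>
                 (\<forall>q\<in>{s..r - h}. \<bar>a (q + h) - a q - h * k q\<bar> \<le> e * h)"
  shows "(k has_integral a r - a s) {s..r}"
proof -
  have M0: "M \<ge> 0" using bound[of s] sr by (force intro: order_trans[OF abs_ge_zero])
  have a_cont: "continuous_on {s..r} a"
  proof (rule continuous_onI)
    fix q e :: real assume q: "q \<in> {s..r}" and e: "0 < e"
    obtain h0 where h0: "h0 > 0" "\<And>h p. 0 < h \<Longrightarrow> h < h0 \<Longrightarrow> p \<in> {s..r - h} \<Longrightarrow> \<bar>a (p + h) - a p - h * k p\<bar> \<le> 1 * h"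
      using diff[of 1] by auto
    have step: "\<bar>a p' - a p\<bar> \<le> (1 + M) * (p' - p)" if "p < p'" "p' - p < h0" "p \<in> {s..r}" "p' \<in> {s..r}" for p p'
    proof -
      have "\<bar>a p' - a p - (p' - p) * k p\<bar> \<le> p' - p" using h0(2)[of "p' - p" p] that by simp
      moreover have "\<bar>(p' - p) * k p\<bar> \<le> (p' - p) * M"
        unfolding abs_mult using that bound[of p] by (intro mult_mono) auto
      ultimately show ?thesis by (simp add: algebra_simps abs_le_iff)
    qed
    let ?d = "min h0 (e / (1 + M))"
    have "dist (a p) (a q) \<le> e" if "p \<in> {s..r}" "dist p q < ?d" for p
    proof -
      have "\<bar>a p - a q\<bar> \<le> (1 + M) * \<bar>p - q\<bar>"
        using step[of p q] step[of q p] that q by (cases p q rule: linorder_cases) (auto simp: dist_real_def abs_minus_commute)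
      also have "\<dots> \<le> (1 + M) * (e / (1 + M))"
        using that M0 by (intro mult_left_mono) (auto simp: dist_real_def)
      also have "\<dots> = e" using M0 by simp
      finally show ?thesis by (simp add: dist_real_def)
    qed
    then show "\<exists>d>0. \<forall>p\<in>{s..r}. dist p q < d \<longrightarrow> dist (a p) (a q) \<le> e"
      using h0 e M0 by (intro exI[of _ ?d]) auto
  qed
  have k_cont: "\<exists>d>0. \<forall>p. \<bar>p - q\<bar> < d \<longrightarrow> p \<in> {s<..<r} \<and> \<bar>k p - k q\<bar> \<le> e"
    if q: "q \<in> {s<..<r}" and e: "e > 0" for q e
  proof -
    obtain h0 where h0: "h0 > 0" "\<And>h p. 0 < h \<Longrightarrow> h < h0 \<Longrightarrow> p \<in> {s..r - h} \<Longrightarrow> \<bar>a (p + h) - a p - h * k p\<bar> \<le> e / 3 * h"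
      using diff[of "e / 3"] e by auto
    define h where "h = min (h0 / 2) ((r - q) / 2)"
    have h: "0 < h" "h < h0" "h < r - q"
      using h0(1) q by (auto simp: h_def min_def)
    let ?D = "\<lambda>p. (a (p + h) - a p) / h"
    have D: "\<bar>?D p - k p\<bar> \<le> e / 3" if "p \<in> {s..r - h}" for p
    proof -
      have "?D p - k p = (a (p + h) - a p - h * k p) / h" using h by (simp add: field_simps)
      then show ?thesis using h0(2)[OF h(1,2) that] h by (simp add: abs_divide pos_divide_le_eq)
    qed
    have "continuous_on {s..r - h} ?D"
      using h by (intro continuous_intros continuous_on_compose2[OF a_cont] continuous_on_subset[OF a_cont]) auto
    then have "continuous_on {s<..<r - h} ?D" by (rule continuous_on_subset) auto
    then have "isCont ?D q" using q h by (simp add: continuous_on_eq_continuous_at)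
    then obtain d where d: "d > 0" "\<And>p. \<bar>p - q\<bar> < d \<Longrightarrow> \<bar>?D p - ?D q\<bar> < e / 3"
      using e unfolding continuous_at_eps_delta dist_real_def by (metis zero_less_divide_iff zero_less_numeral)
    let ?d = "min d (min (q - s) (r - h - q))"
    have "p \<in> {s<..<r} \<and> \<bar>k p - k q\<bar> \<le> e" if p: "\<bar>p - q\<bar> < ?d" for p
    proof
      show "p \<in> {s<..<r}" using p h by auto
      have "p \<in> {s..r - h}" "q \<in> {s..r - h}" using p q h by auto
      then show "\<bar>k p - k q\<bar> \<le> e" using D[of p] D[of q] d(2)[of p] p by linarith
    qed
    moreover have "?d > 0" using d q h by auto
    ultimately show ?thesis by blast
  qed
  show ?thesis
  proof (rule fundamental_theorem_of_calculus_interior[OF sr a_cont])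
    fix q assume q: "q \<in> {s<..<r}"
    show "(a has_vector_derivative k q) (at q)"
      unfolding has_vector_derivative_def has_derivative_at_alt
    proof (intro conjI allI impI)
      show "bounded_linear (\<lambda>x. x *\<^sub>R k q)" by (rule bounded_linear_scaleR_left)
      fix e :: real assume e: "0 < e"
      obtain h0 where h0: "h0 > 0" "\<And>h p. 0 < h \<Longrightarrow> h < h0 \<Longrightarrow> p \<in> {s..r - h} \<Longrightarrow> \<bar>a (p + h) - a p - h * k p\<bar> \<le> e / 2 * h"
        using diff[of "e / 2"] e by auto
      obtain d where d: "d > 0" "\<And>p. \<bar>p - q\<bar> < d \<Longrightarrow> p \<in> {s<..<r} \<and> \<bar>k p - k q\<bar> \<le> e / 2"
        using k_cont[OF q, of "e / 2"] e by auto
      have "\<bar>a y - a q - (y - q) * k q\<bar> \<le> e * \<bar>y - q\<bar>" if y: "\<bar>y - q\<bar> < min h0 d" for y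
      proof (cases y q rule: linorder_cases)
        case less
        have "\<bar>a q - a y - (q - y) * k y\<bar> \<le> e / 2 * (q - y)"
          using h0(2)[of "q - y" y] less d(2)[of y] y q by auto
        moreover have "\<bar>(q - y) * (k y - k q)\<bar> \<le> (q - y) * (e / 2)"
          unfolding abs_mult using less d(2)[of y] y by (intro mult_mono) auto
        moreover have "a y - a q - (y - q) * k q = - (a q - a y - (q - y) * k y) - (q - y) * (k y - k q)"
          by (simp add: algebra_simps)
        moreover have "e * \<bar>y - q\<bar> = e / 2 * (q - y) + (q - y) * (e / 2)"
          using less by (simp add: algebra_simps)
        ultimately show ?thesis by linarith
      next
        case greater
        then have "\<bar>a y - a q - (y - q) * k q\<bar> \<le> e / 2 * (y - q)"
          using h0(2)[of "y - q" q] d(2)[of y] y q by auto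
        also have "\<dots> \<le> e * \<bar>y - q\<bar>" using greater e by (intro mult_mono) auto
        finally show ?thesis .
      qed simp
      then show "\<exists>d>0. \<forall>y. norm (y - q) < d \<longrightarrow> norm (a y - a q - (y - q) *\<^sub>R k q) \<le> e * norm (y - q)"
        using h0(1) d(1) by (intro exI[of _ "min h0 d"]) auto
    qed
  qed
qed

context markov
begin

lemma path_function_right_continuous:
  assumes v: "continuous_on_states T v" and t: "t \<in> {0..<T}" and \<omega>: "\<omega> \<in> space (outcomes Y)"
  shows "((\<lambda>r. on_path v r \<omega>) \<longlongrightarrow> on_path v t \<omega>) (at_right t)"
proof -
  let ?d = "fst (traj Y t \<omega>)"
  have ev: "\<forall>\<^sub>F r in at_right t. r \<in> {t<..<T}"
    using t by (intro eventually_at_right_real) auto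
  have "((\<lambda>r. (\<lambda>(t, x). v t ?d x) (r, snd (traj Y r \<omega>))) \<longlongrightarrow> (\<lambda>(t, x). v t ?d x) (t, snd (traj Y t \<omega>))) (at_right t)"
  proof (rule continuous_on_tendsto_compose[where f = "\<lambda>(t, x). v t ?d x" and s = "{0..T} \<times> \<S>"])
    show "continuous_on ({0..T} \<times> \<S>) (\<lambda>(t, x). v t ?d x)"
      using v by (simp add: continuous_on_states_def)
    show "((\<lambda>r. (r, snd (traj Y r \<omega>))) \<longlongrightarrow> (t, snd (traj Y t \<omega>))) (at_right t)"
      by (intro tendsto_Pair tendsto_ident_at traj_right_continuous(2)[OF t \<omega>])
    show "(t, snd (traj Y t \<omega>)) \<in> {0..T} \<times> \<S>"
      using t traj_snd_simplex[OF _ \<omega>] by auto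
    show "\<forall>\<^sub>F r in at_right t. (r, snd (traj Y r \<omega>)) \<in> {0..T} \<times> \<S>"
      using ev by eventually_elim (use t traj_snd_simplex[OF _ \<omega>] in auto)
  qed
  moreover have "\<forall>\<^sub>F r in at_right t. (\<lambda>(t, x). v t ?d x) (r, snd (traj Y r \<omega>)) = on_path v r \<omega>"
    using traj_right_continuous(1)[OF t \<omega>] by eventually_elim simp
  ultimately show ?thesis
    by (auto elim: Lim_transform_eventually)
qed

text \<open>Sampling the path at the next point of an ever finer grid approximates it from the right, so
  right-continuity makes the path jointly measurable in time and outcome.\<close>

lemma path_function_jointly_measurable:
  assumes v: "continuous_on_states T v" and s: "s \<in> {0..T}" and z: "z \<in> state_set"
  shows "(\<lambda>(r, \<omega>). indicator {s..T} r * on_path v r \<omega>)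
    \<in> borel_measurable (lborel \<Otimes>\<^sub>M law Y s z)"
proof -
  let ?M = "lborel \<Otimes>\<^sub>M law Y s z"
  define G where "G n k = max s (min T (s + (real_of_int k + 1) / real (Suc n)))" for n :: nat and k :: int
  define K where "K n r = \<lfloor>(r - s) * real (Suc n)\<rfloor>" for n :: nat and r :: real
  define X where "X n p = indicator {s..T} (fst p) * on_path v (G n (K n (fst p))) (snd p)" for n p
  have G: "G n k \<in> {0..T}" for n k using s by (auto simp: G_def)
  have Xm: "X n \<in> borel_measurable ?M" for n
  proof -
    have "(\<lambda>p. (\<lambda>k p. indicator {s..T} (fst p) * on_path v (G n k) (snd p)) (K n (fst p)) p)
        \<in> borel_measurable ?M"
    proof (rule measurable_compose_countable)
      show "(\<lambda>p. K n (fst p)) \<in> measurable ?M (count_space UNIV)"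
        unfolding K_def by measurable
      fix k
      have "(\<lambda>\<omega>. on_path v (G n k) \<omega>) \<in> borel_measurable (law Y s z)"
        by (rule path_function_measurable[OF v s z G])
      from measurable_compose[OF measurable_snd this]
      have [measurable]: "(\<lambda>p. on_path v (G n k) (snd p)) \<in> borel_measurable ?M" .
      have [measurable]: "(\<lambda>p. indicator {s..T} (fst p) :: real) \<in> borel_measurable ?M"
        by (rule measurable_compose[OF measurable_fst]) simp
      show "(\<lambda>p. indicator {s..T} (fst p) * on_path v (G n k) (snd p)) \<in> borel_measurable ?M"
        by (rule borel_measurable_times) fact+
    qed
    then show ?thesis unfolding X_def .
  qed
  have lim: "(\<lambda>n. X n p) \<longlonglongrightarrow> indicator {s..T} (fst p) * on_path v (fst p) (snd p)"
    if p: "p \<in> space ?M" for p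
  proof (cases "fst p \<in> {s..T}")
    case True
    let ?r = "fst p"
    have \<omega>: "snd p \<in> space (outcomes Y)"
      using p by (simp add: space_pair_measure space_law[OF s z] mem_Times_iff)
    have lower: "?r < s + (real_of_int (K n ?r) + 1) / real (Suc n)" for n
    proof -
      have "(?r - s) * real (Suc n) < real_of_int (K n ?r) + 1" unfolding K_def by linarith
      then have "?r - s < (real_of_int (K n ?r) + 1) / real (Suc n)" by (simp add: pos_less_divide_eq)
      then show ?thesis by simp
    qed
    have upper: "s + (real_of_int (K n ?r) + 1) / real (Suc n) \<le> ?r + 1 / real (Suc n)" for n
    proof -
      have "real_of_int (K n ?r) \<le> (?r - s) * real (Suc n)" unfolding K_def by linarith
      then have "(real_of_int (K n ?r) + 1) / real (Suc n) \<le> ((?r - s) * real (Suc n) + 1) / real (Suc n)"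
        by (intro divide_right_mono) auto
      also have "\<dots> = (?r - s) + 1 / real (Suc n)" by (simp add: field_simps)
      finally show ?thesis by simp
    qed
    show ?thesis
    proof (cases "?r = T")
      case True
      have "G n (K n ?r) = T" for n
        using lower[of n] True s by (simp add: G_def)
      then show ?thesis using True by (simp add: X_def)
    next
      case False
      then have r: "?r \<in> {s..<T}" using True by auto
      have "filterlim (\<lambda>n. G n (K n ?r)) (at_right ?r) sequentially"
        unfolding filterlim_at
      proof
        have gt: "?r < G n (K n ?r)" for n using lower[of n] r unfolding G_def by auto
        then show "\<forall>\<^sub>F n in sequentially. G n (K n ?r) \<in> {?r<..} \<and> G n (K n ?r) \<noteq> ?r"
          by (auto intro!: always_eventually simp: less_imp_neq less_imp_neq[symmetric])
        have le: "G n (K n ?r) \<le> ?r + inverse (real (Suc n))" for n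
        proof -
          have "s \<le> ?r + inverse (real (Suc n))" using r by (simp add: add_increasing2)
          then show ?thesis using upper[of n] by (simp add: G_def min_le_iff_disj inverse_eq_divide)
        qed
        have "(\<lambda>n. ?r + inverse (real (Suc n))) \<longlonglongrightarrow> ?r + 0"
          by (intro tendsto_add tendsto_const LIMSEQ_inverse_real_of_nat)
        then have u: "(\<lambda>n. ?r + inverse (real (Suc n))) \<longlonglongrightarrow> ?r" by simp
        have "\<forall>n. ?r \<le> G n (K n ?r)" using gt less_imp_le by blast
        moreover have "\<forall>n. G n (K n ?r) \<le> ?r + inverse (real (Suc n))" using le by blast
        ultimately show "(\<lambda>n. G n (K n ?r)) \<longlonglongrightarrow> ?r"
          by (rule tendsto_sandwich[OF always_eventually always_eventually tendsto_const u])
      qed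
      moreover have "((\<lambda>r. on_path v r (snd p)) \<longlongrightarrow>
          on_path v ?r (snd p)) (at_right ?r)"
        using r s by (intro path_function_right_continuous[OF v _ \<omega>]) auto
      ultimately have "(\<lambda>n. on_path v (G n (K n ?r)) (snd p)) \<longlonglongrightarrow>
          on_path v ?r (snd p)"
        by (rule filterlim_compose[rotated])
      then show ?thesis unfolding X_def by (intro tendsto_mult tendsto_const)
    qed
  qed (simp add: X_def)
  have "(\<lambda>p. indicator {s..T} (fst p) * on_path v (fst p) (snd p))
      \<in> borel_measurable ?M"
    by (rule borel_measurable_LIMSEQ_real[OF lim Xm])
  then show ?thesis by (simp add: case_prod_beta)
qed

lemma mean_abs_le:
  assumes s: "s \<in> {0..T}" and z: "z \<in> state_set" and t: "t \<in> {0..T}" and v: "continuous_on_states T v"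
    and M: "\<And>d x. x \<in> \<S> \<Longrightarrow> \<bar>v t d x\<bar> \<le> M"
  shows "\<bar>mean s z v t\<bar> \<le> M"
proof -
  interpret prob_space "law Y s z" by (rule law_prob_space[OF s z])
  have "\<bar>mean s z v t\<bar> \<le> (\<integral>\<omega>. \<bar>on_path v t \<omega>\<bar> \<partial>law Y s z)"
    unfolding mean_def by (rule integral_abs_bound)
  also have "\<dots> \<le> (\<integral>\<omega>. M \<partial>law Y s z)"
    by (intro integral_mono integrable_abs path_function_integrable[OF v s z t] M traj_snd_simplex[OF t])
      (auto simp: space_law[OF s z])
  finally show ?thesis by (simp add: prob_space)
qed

lemma mean_time_integral:
  assumes v: "continuous_on_states T v" and s: "s \<in> {0..T}" and z: "z \<in> state_set" and r: "r \<in> {s..T}"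
  shows "set_integrable lborel {s..r} (mean s z v)"
    and "integrable (law Y s z) (\<lambda>\<omega>. LINT q:{s..r}|lborel. on_path v q \<omega>)"
    and "(\<integral>\<omega>. (LINT q:{s..r}|lborel. on_path v q \<omega>) \<partial>law Y s z)
       = (LINT q:{s..r}|lborel. mean s z v q)"
proof -
  interpret Pr: prob_space "law Y s z" by (rule law_prob_space[OF s z])
  interpret pair_sigma_finite lborel "law Y s z" ..
  let ?f = "\<lambda>q \<omega>. indicator {s..r} q *\<^sub>R on_path v q \<omega>"
  obtain M where M: "M \<ge> 0" "\<And>t d x. t \<in> {0..T} \<Longrightarrow> x \<in> \<S> \<Longrightarrow> \<bar>v t d x\<bar> \<le> M"
    using continuous_on_states_bounded[OF v] by metis
  have "(\<lambda>p. indicator {s..r} (fst p) * (\<lambda>(r, \<omega>). indicator {s..T} r * on_path v r \<omega>) p)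
      \<in> borel_measurable (lborel \<Otimes>\<^sub>M law Y s z)"
    by (intro borel_measurable_times path_function_jointly_measurable[OF v s z]) simp
  moreover have "(\<lambda>p. indicator {s..r} (fst p) * (\<lambda>(r, \<omega>). indicator {s..T} r * on_path v r \<omega>) p)
      = case_prod ?f"
    using r by (auto simp: fun_eq_iff indicator_def)
  ultimately have meas: "case_prod ?f \<in> borel_measurable (lborel \<Otimes>\<^sub>M law Y s z)" by simp
  have int: "integrable (lborel \<Otimes>\<^sub>M law Y s z) (case_prod ?f)"
  proof (rule Bochner_Integration.integrable_bound[OF _ meas])
    have "emeasure (lborel \<Otimes>\<^sub>M law Y s z) ({s..r} \<times> space (law Y s z)) = emeasure lborel {s..r} * emeasure (law Y s z) (space (law Y s z))"
      by (rule Pr.emeasure_pair_measure_Times) auto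
    also have "\<dots> < \<infinity>" using r by (simp add: Pr.emeasure_space_1)
    finally show "integrable (lborel \<Otimes>\<^sub>M law Y s z) (\<lambda>p. M * indicator ({s..r} \<times> space (law Y s z)) p)"
      by (intro integrable_mult_right integrable_real_indicator pair_measureI) auto
    show "AE p in lborel \<Otimes>\<^sub>M law Y s z. norm (case_prod ?f p) \<le> norm (M * indicator ({s..r} \<times> space (law Y s z)) p)"
    proof (rule AE_I2)
      fix p :: "real \<times> 'w" assume p: "p \<in> space (lborel \<Otimes>\<^sub>M law Y s z)"
      then have \<omega>: "snd p \<in> space (law Y s z)" by (simp add: space_pair_measure mem_Times_iff)
      show "norm (case_prod ?f p) \<le> norm (M * indicator ({s..r} \<times> space (law Y s z)) p)"
      proof (cases "fst p \<in> {s..r}")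
        case True
        then have "fst p \<in> {0..T}" using s r by auto
        then show ?thesis
          using True \<omega> M traj_snd_simplex[of "fst p" "snd p"] space_law[OF s z]
          by (cases p) (simp add: indicator_def)
      qed (cases p, simp)
    qed
  qed
  have mean_eq: "(\<integral>\<omega>. ?f q \<omega> \<partial>law Y s z) = indicator {s..r} q *\<^sub>R mean s z v q" for q
    by (simp add: mean_def)
  show "set_integrable lborel {s..r} (mean s z v)"
    using integrable_fst[OF int] unfolding set_integrable_def mean_eq .
  show "integrable (law Y s z) (\<lambda>\<omega>. LINT q:{s..r}|lborel. on_path v q \<omega>)"
    using integrable_snd[OF int] unfolding set_lebesgue_integral_def .
  show "(\<integral>\<omega>. (LINT q:{s..r}|lborel. on_path v q \<omega>) \<partial>law Y s z)
       = (LINT q:{s..r}|lborel. mean s z v q)"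
    unfolding set_lebesgue_integral_def mean_eq[symmetric]
    by (simp only: integral_fst[OF int] integral_snd[OF int])
qed

text \<open>\<open>\<kappa>\<close> is the value of the space-time generator at \<open>v\<close>.  Convergence is uniform in the starting point,
  so that it can be used at the random states that the process visits.\<close>

definition generates :: "(real \<Rightarrow> 'd \<Rightarrow> real^'m \<Rightarrow> real) \<Rightarrow> (real \<Rightarrow> 'd \<Rightarrow> real^'m \<Rightarrow> real) \<Rightarrow> bool" where
  "generates v \<kappa> \<longleftrightarrow> (\<forall>e>0. \<exists>h0>0. \<forall>h. 0 < h \<and> h < h0 \<longrightarrow>
     (\<forall>t\<in>{0..T - h}. \<forall>d. \<forall>x\<in>\<S>. \<bar>mean t (d, x) v (t + h) - v t d x - h * \<kappa> t d x\<bar> \<le> e * h))"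

lemma mean_start:
  assumes "s \<in> {0..T}" "x \<in> \<S>" and v: "continuous_on_states T v"
  shows "mean s (d, x) v s = v s d x"
proof -
  have z: "(d, x) \<in> state_set" using assms by (simp add: state_set_def)
  interpret prob_space "law Y s (d, x)" by (rule law_prob_space[OF assms(1) z])
  have "mean s (d, x) v s = (\<integral>\<omega>. v s d x \<partial>law Y s (d, x))"
    unfolding mean_def
  proof (rule integral_cong_AE)
    show "AE \<omega> in law Y s (d, x). on_path v s \<omega> = v s d x"
      using traj_start[OF assms(1) z] by eventually_elim simp
  qed (use path_function_measurable[OF v assms(1) z assms(1)] in auto)
  then show ?thesis by (simp add: prob_space)
qed

text \<open>By the Chapman-Kolmogorov equation the difference quotients of \<open>r \<mapsto> E v(r, Z\<^sub>r)\<close> are averages of those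
  at deterministic starting points, so they approach \<open>E \<kappa>(r, Z\<^sub>r)\<close> uniformly.\<close>

theorem Dynkin:
  assumes v: "continuous_on_states T v" and \<kappa>: "continuous_on_states T \<kappa>" and gen: "generates v \<kappa>"
    and s: "s \<in> {0..T}" and r: "r \<in> {s..T}" and x: "x \<in> \<S>"
  shows "mean s (d, x) v r = v s d x + (LINT q:{s..r}|lborel. mean s (d, x) \<kappa> q)"
proof -
  let ?z = "(d, x)"
  have z: "?z \<in> state_set" using x by (simp add: state_set_def)
  interpret prob_space "law Y s ?z" by (rule law_prob_space[OF s z])
  obtain M where M: "\<And>t d x. t \<in> {0..T} \<Longrightarrow> x \<in> \<S> \<Longrightarrow> \<bar>\<kappa> t d x\<bar> \<le> M"
    using continuous_on_states_bounded[OF \<kappa>] by metis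
  have "(mean s ?z \<kappa> has_integral mean s ?z v r - mean s ?z v s) {s..r}"
  proof (rule has_integral_of_uniform_right_difference)
    show "\<bar>mean s ?z \<kappa> q\<bar> \<le> M" if "q \<in> {s..r}" for q
      using that s r by (intro mean_abs_le[OF s z _ \<kappa>] M) auto
    fix e :: real assume "e > 0"
    then obtain h0 where h0: "h0 > 0" "\<And>h t d x. 0 < h \<Longrightarrow> h < h0 \<Longrightarrow> t \<in> {0..T - h} \<Longrightarrow> x \<in> \<S> \<Longrightarrow>
        \<bar>mean t (d, x) v (t + h) - v t d x - h * \<kappa> t d x\<bar> \<le> e * h"
      using gen unfolding generates_def by meson
    have "\<bar>mean s ?z v (q + h) - mean s ?z v q - h * mean s ?z \<kappa> q\<bar> \<le> e * h"
      if h: "0 < h" "h < h0" and q: "q \<in> {s..r - h}" for h q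
    proof -
      have q0: "q \<in> {0..T}" and qs: "q \<in> {s..T}" and qh: "q + h \<in> {q..T}" and qT: "q \<in> {0..T - h}"
        using q s r h by auto
      let ?g = "\<lambda>\<omega>. mean q (traj Y q \<omega>) v (q + h) - on_path v q \<omega>
          - h * on_path \<kappa> q \<omega>"
      have bound: "\<bar>?g \<omega>\<bar> \<le> e * h" if "\<omega> \<in> space (law Y s ?z)" for \<omega>
        using h0(2)[OF h qT traj_snd_simplex[OF q0], of \<omega> "fst (traj Y q \<omega>)"] that
        by (simp add: space_law[OF s z])
      have i1: "integrable (law Y s ?z) (\<lambda>\<omega>. on_path v q \<omega>)"
        and i2: "integrable (law Y s ?z) (\<lambda>\<omega>. on_path \<kappa> q \<omega>)"
        by (rule path_function_integrable[OF v s z q0] path_function_integrable[OF \<kappa> s z q0])+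
      have m3: "(\<lambda>\<omega>. mean q (traj Y q \<omega>) v (q + h)) \<in> borel_measurable (law Y s ?z)"
        by (rule Chapman_Kolmogorov[OF s qs qh z v])
      have ig: "integrable (law Y s ?z) ?g"
        by (rule integrable_const_bound[where B = "e * h"])
          (use bound m3 i1 i2 in \<open>auto intro!: AE_I2 borel_measurable_diff borel_measurable_times\<close>)
      have "integrable (law Y s ?z) (\<lambda>\<omega>. ?g \<omega> + on_path v q \<omega>
          + h * on_path \<kappa> q \<omega>)"
        by (intro Bochner_Integration.integrable_add integrable_mult_right ig i1 i2)
      then have i3: "integrable (law Y s ?z) (\<lambda>\<omega>. mean q (traj Y q \<omega>) v (q + h))" by simp
      have eq: "mean s ?z v (q + h) - mean s ?z v q - h * mean s ?z \<kappa> q = (\<integral>\<omega>. ?g \<omega> \<partial>law Y s ?z)"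
        unfolding Chapman_Kolmogorov(1)[OF s qs qh z v]
        using i1 i2 i3 by (simp add: mean_def)
      have "\<bar>\<integral>\<omega>. ?g \<omega> \<partial>law Y s ?z\<bar> \<le> (\<integral>\<omega>. \<bar>?g \<omega>\<bar> \<partial>law Y s ?z)" by (rule integral_abs_bound)
      also have "\<dots> \<le> (\<integral>\<omega>. e * h \<partial>law Y s ?z)"
        by (rule integral_mono[OF integrable_abs[OF ig] integrable_const bound])
      finally show ?thesis by (simp add: prob_space eq)
    qed
    then show "\<exists>h0>0. \<forall>h. 0 < h \<and> h < h0 \<longrightarrow> (\<forall>q\<in>{s..r - h}.
        \<bar>mean s ?z v (q + h) - mean s ?z v q - h * mean s ?z \<kappa> q\<bar> \<le> e * h)"
      using h0(1) by blast
  qed (use r in auto)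
  then have "mean s ?z v r - mean s ?z v s = integral {s..r} (mean s ?z \<kappa>)"
    by (rule integral_unique[symmetric])
  also have "\<dots> = (LINT q:{s..r}|lborel. mean s ?z \<kappa> q)"
    by (rule set_borel_integral_eq_integral(2)[symmetric, OF mean_time_integral(1)[OF \<kappa> s z r]])
  finally show ?thesis by (simp add: mean_start[OF s x v])
qed

end

section \<open>Jump processes driving a flow on the simplex\<close>

text \<open>The common form of the generators of both players: \<open>d\<close> jumps at the rates \<open>lam\<close>, and \<open>x\<close> is transported
  along \<open>b\<close>.\<close>

definition jump_flow_generator ::
  "(real \<Rightarrow> 'd::finite \<Rightarrow> 'd \<Rightarrow> real^'m::finite \<Rightarrow> real) \<Rightarrow> (real \<Rightarrow> 'd \<Rightarrow> real^'m \<Rightarrow> real^'m)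
   \<Rightarrow> (real \<Rightarrow> 'd \<Rightarrow> real^'m \<Rightarrow> real) \<Rightarrow> real \<Rightarrow> 'd \<Rightarrow> real^'m \<Rightarrow> real" where
  "jump_flow_generator lam b F t d x =
     dt F t d x + (\<Sum>d'\<in>UNIV - {d}. (F t d' x - F t d x) * lam t d d' x)
     + (\<Sum>l\<in>UNIV. dx l F t d x * b t d x $ l)"

text \<open>The derivative of \<open>u\<close> along the curves \<open>x' = b\<close>.  An Euler step agrees with the curve up to an error
  of second order, so for Lipschitz \<open>u\<close> it can take its place, and no flow has to be constructed.\<close>

definition derivative_along_flow ::
  "real \<Rightarrow> (real \<Rightarrow> 'd \<Rightarrow> real^'m::finite \<Rightarrow> real^'m) \<Rightarrow> (real \<Rightarrow> 'd \<Rightarrow> real^'m \<Rightarrow> real)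
   \<Rightarrow> (real \<Rightarrow> 'd \<Rightarrow> real^'m \<Rightarrow> real) \<Rightarrow> bool" where
  "derivative_along_flow T b u c \<longleftrightarrow> (\<forall>e>0. \<exists>h0>0. \<forall>h. 0 < h \<and> h < h0 \<longrightarrow>
     (\<forall>t\<in>{0..T - h}. \<forall>d. \<forall>x\<in>\<S>.
        \<bar>u (t + h) d (x + h *\<^sub>R b t d x) - u t d x - h * c t d x\<bar> \<le> e * h))"

lemma continuous_on_states_lipschitz:
  assumes "\<And>d. K-lipschitz_on ({0..T} \<times> \<S>) (\<lambda>(t, x). v t d x)"
  shows "continuous_on_states T v"
  unfolding continuous_on_states_def using assms lipschitz_on_continuous_on by blast

lemma continuous_on_states_const: "continuous_on_states T (\<lambda>t d x. c d)"
  unfolding continuous_on_states_def case_prod_beta by (intro allI continuous_intros)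

lemma continuous_on_states_add:
  "continuous_on_states T v \<Longrightarrow> continuous_on_states T w \<Longrightarrow> continuous_on_states T (\<lambda>t d x. v t d x + w t d x)"
  unfolding continuous_on_states_def case_prod_beta by (intro allI continuous_on_add) auto

lemma continuous_on_states_diff:
  "continuous_on_states T v \<Longrightarrow> continuous_on_states T w \<Longrightarrow> continuous_on_states T (\<lambda>t d x. v t d x - w t d x)"
  unfolding continuous_on_states_def case_prod_beta by (intro allI continuous_on_diff) auto

lemma continuous_on_states_mult:
  "continuous_on_states T v \<Longrightarrow> continuous_on_states T w \<Longrightarrow> continuous_on_states T (\<lambda>t d x. v t d x * w t d x)"
  unfolding continuous_on_states_def case_prod_beta by (intro allI continuous_on_mult) auto

lemma continuous_on_states_jumps:
  fixes v :: "real \<Rightarrow> 'd::finite \<Rightarrow> real^'m::finite \<Rightarrow> real"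
  assumes v: "continuous_on_states T v" and lam: "\<And>d'. continuous_on_states T (\<lambda>t d x. lam t d d' x)"
  shows "continuous_on_states T (\<lambda>t d x. \<Sum>d'\<in>UNIV - {d}. (v t d' x - v t d x) * lam t d d' x)"
  using assms unfolding continuous_on_states_def case_prod_beta
  by (intro allI continuous_on_sum continuous_on_mult continuous_on_diff) auto

definition squared_distance :: "real \<Rightarrow> real^'m::finite \<Rightarrow> real^'m \<Rightarrow> real \<Rightarrow> 'd \<Rightarrow> real^'m \<Rightarrow> real" where
  "squared_distance t0 x0 c t d y = (y - x0 - (t - t0) *\<^sub>R c) \<bullet> (y - x0 - (t - t0) *\<^sub>R c)"

lemma squared_distance_derivative:
  "((\<lambda>(t, y). squared_distance t0 x0 c t d y) has_derivative
     (\<lambda>(\<tau>, \<eta>). 2 * ((snd p - x0 - (fst p - t0) *\<^sub>R c) \<bullet> (\<eta> - \<tau> *\<^sub>R c)))) (at p)"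
  unfolding squared_distance_def case_prod_beta
  by (auto intro!: derivative_eq_intros ext simp: inner_commute algebra_simps)

lemma C1_test_squared_distance:
  fixes x0 c :: "real^'m::finite"
  shows "C1_test (squared_distance t0 x0 c :: real \<Rightarrow> 'd \<Rightarrow> real^'m \<Rightarrow> real)"
  unfolding C1_test_def
proof
  fix d :: 'd
  let ?w = "\<lambda>p :: real \<times> (real^'m). snd p - x0 - (fst p - t0) *\<^sub>R c"
  let ?D = "\<lambda>p (\<tau>, \<eta>). 2 * (?w p \<bullet> (\<eta> - \<tau> *\<^sub>R c))"
  have bl: "bounded_linear (?D p)" for p
    using squared_distance_derivative[of t0 x0 c] by (rule has_derivative_bounded_linear)
  have app: "blinfun_apply (Blinfun (?D p)) = ?D p" for p
    by (rule bounded_linear_Blinfun_apply[OF bl])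
  have "continuous_on UNIV (\<lambda>p. Blinfun (?D p))"
  proof (rule continuous_on_blinfun_componentwise)
    fix i :: "real \<times> (real^'m)" assume "i \<in> Basis"
    show "continuous_on UNIV (\<lambda>p. blinfun_apply (Blinfun (?D p)) i)"
      unfolding app by (cases i) (auto intro!: continuous_intros)
  qed
  then show "\<exists>F' :: real \<times> (real^'m) \<Rightarrow> (real \<times> (real^'m)) \<Rightarrow>\<^sub>L real.
      (\<forall>p. ((\<lambda>(t, x). squared_distance t0 x0 c t d x) has_derivative blinfun_apply (F' p)) (at p)) \<and>
      continuous_on UNIV F'"
    using squared_distance_derivative[of t0 x0 c d] by (intro exI[of _ "\<lambda>p. Blinfun (?D p)"]) (simp add: app)
qed

lemma C1_test_const: "C1_test (\<lambda>t d x. c d)"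
  unfolding C1_test_def
proof
  fix d
  show "\<exists>F'. (\<forall>p. ((\<lambda>(t, x). c d) has_derivative blinfun_apply (F' p)) (at p)) \<and> continuous_on UNIV F'"
    by (intro exI[of _ "\<lambda>_. 0"]) (auto simp: case_prod_unfold zero_blinfun.rep_eq)
qed

lemma generator_const:
  "jump_flow_generator lam b (\<lambda>t d x. c d) t d x = (\<Sum>d'\<in>UNIV - {d}. (c d' - c d) * lam t d d' x)"
  by (simp add: jump_flow_generator_def dt_def dx_def)

lemma generator_squared_distance:
  "jump_flow_generator lam b (squared_distance t0 x0 c) t d y =
     2 * ((y - x0 - (t - t0) *\<^sub>R c) \<bullet> (b t d y - c))"
proof -
  let ?w = "y - x0 - (t - t0) *\<^sub>R c"
  have "((\<lambda>s. squared_distance t0 x0 c s d y) has_real_derivative - 2 * (?w \<bullet> c)) (at t)"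
    unfolding squared_distance_def has_field_derivative_def
    by (auto intro!: derivative_eq_intros ext simp: inner_commute algebra_simps)
  then have "dt (squared_distance t0 x0 c) t d y = - 2 * (?w \<bullet> c)"
    unfolding dt_def by (rule DERIV_imp_deriv)
  moreover have "dx l (squared_distance t0 x0 c) t d y = 2 * ?w $ l" for l
  proof -
    have "((\<lambda>h. squared_distance t0 x0 c t d (y + h *\<^sub>R axis l 1)) has_real_derivative 2 * (?w \<bullet> axis l 1)) (at 0)"
      unfolding squared_distance_def has_field_derivative_def
      by (auto intro!: derivative_eq_intros ext simp: inner_commute algebra_simps)
    then show ?thesis
      unfolding dx_def by (simp add: DERIV_imp_deriv inner_axis)
  qed
  moreover have "(\<Sum>l\<in>UNIV. 2 * ?w $ l * b t d y $ l) = 2 * (?w \<bullet> b t d y)"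
    by (simp add: inner_vec_def sum_distrib_left algebra_simps)
  ultimately show ?thesis
    by (simp add: jump_flow_generator_def squared_distance_def inner_diff_right)
qed

lemma continuous_on_states_squared_distance:
  "continuous_on_states T (squared_distance t0 x0 c)"
  unfolding continuous_on_states_def squared_distance_def case_prod_beta
  by (intro allI continuous_intros)

context markov
begin

lemma mean_add:
  assumes "continuous_on_states T v" "continuous_on_states T w" "s \<in> {0..T}" "z \<in> state_set" "r \<in> {0..T}"
  shows "mean s z (\<lambda>t d x. v t d x + w t d x) r = mean s z v r + mean s z w r"
  unfolding mean_def using assms by (intro Bochner_Integration.integral_add path_function_integrable)

lemma mean_diff:
  assumes "continuous_on_states T v" "continuous_on_states T w" "s \<in> {0..T}" "z \<in> state_set" "r \<in> {0..T}"
  shows "mean s z (\<lambda>t d x. v t d x - w t d x) r = mean s z v r - mean s z w r"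
  unfolding mean_def using assms by (intro Bochner_Integration.integral_diff path_function_integrable)

lemma mean_cmult: "mean s z (\<lambda>t d x. c * v t d x) r = c * mean s z v r"
  unfolding mean_def by simp

lemma mean_sum:
  assumes "\<And>i. i \<in> I \<Longrightarrow> continuous_on_states T (v i)" "s \<in> {0..T}" "z \<in> state_set" "r \<in> {0..T}"
  shows "mean s z (\<lambda>t d x. \<Sum>i\<in>I. v i t d x) r = (\<Sum>i\<in>I. mean s z (v i) r)"
  unfolding mean_def using assms by (intro Bochner_Integration.integral_sum path_function_integrable)

lemma mean_const:
  assumes "s \<in> {0..T}" "z \<in> state_set"
  shows "mean s z (\<lambda>t d x. c) r = c"
  using prob_space.prob_space[OF law_prob_space[OF assms]] by (simp add: mean_def)

lemma mean_mono:
  assumes "continuous_on_states T v" "continuous_on_states T w" "s \<in> {0..T}" "z \<in> state_set" "r \<in> {0..T}"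
    and "\<And>d x. x \<in> \<S> \<Longrightarrow> v r d x \<le> w r d x"
  shows "mean s z v r \<le> mean s z w r"
  unfolding mean_def using assms traj_snd_simplex[OF assms(5)] space_law[OF assms(3,4)]
  by (intro integral_mono path_function_integrable) auto

lemma mean_abs_diff_le:
  assumes v: "continuous_on_states T v" and w: "continuous_on_states T w" and y: "continuous_on_states T y"
    and s: "s \<in> {0..T}" and z: "z \<in> state_set" and r: "r \<in> {0..T}"
    and le: "\<And>d x. x \<in> \<S> \<Longrightarrow> \<bar>v r d x - w r d x\<bar> \<le> y r d x"
  shows "\<bar>mean s z v r - mean s z w r\<bar> \<le> mean s z y r"
proof -
  have "mean s z v r - mean s z w r \<le> mean s z y r"
    unfolding mean_diff[OF v w s z r, symmetric]
    by (intro mean_mono continuous_on_states_diff v w y s z r) (use le in \<open>auto simp: abs_le_iff\<close>)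
  moreover have "mean s z w r - mean s z v r \<le> mean s z y r"
    unfolding mean_diff[OF w v s z r, symmetric]
    by (intro mean_mono continuous_on_states_diff v w y s z r) (use le in \<open>auto simp: abs_le_iff\<close>)
  ultimately show ?thesis by linarith
qed

lemma Dynkin_upper_bound:
  assumes v: "continuous_on_states T v" and \<kappa>: "continuous_on_states T \<kappa>" and gen: "generates v \<kappa>"
    and s: "s \<in> {0..T}" and r: "r \<in> {s..T}" and x: "x \<in> \<S>"
    and le: "\<And>q. q \<in> {s..r} \<Longrightarrow> mean s (d, x) \<kappa> q \<le> M"
  shows "mean s (d, x) v r \<le> v s d x + M * (r - s)"
proof -
  have z: "(d, x) \<in> state_set" using x by (simp add: state_set_def)
  have "(LINT q:{s..r}|lborel. mean s (d, x) \<kappa> q) \<le> (LINT q:{s..r}|lborel. M)"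
  proof (rule set_integral_mono[OF mean_time_integral(1)[OF \<kappa> s z r] _ le])
    show "set_integrable lborel {s..r} (\<lambda>_. M)"
      unfolding set_integrable_def
      by (intro integrable_scaleR_left integrable_real_indicator) (auto simp: emeasure_lborel_Icc_eq)
  qed
  also have "\<dots> = M * (r - s)"
    using r by (simp add: set_lebesgue_integral_def)
  finally show ?thesis using Dynkin[OF v \<kappa> gen s r x] by simp
qed

corollary Dynkin_pointwise_bound:
  assumes v: "continuous_on_states T v" and \<kappa>: "continuous_on_states T \<kappa>" and gen: "generates v \<kappa>"
    and s: "s \<in> {0..T}" and r: "r \<in> {s..T}" and x: "x \<in> \<S>"
    and le: "\<And>q d y. q \<in> {0..T} \<Longrightarrow> y \<in> \<S> \<Longrightarrow> \<kappa> q d y \<le> M"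
  shows "mean s (d, x) v r \<le> v s d x + M * (r - s)"
proof (rule Dynkin_upper_bound[OF v \<kappa> gen s r x])
  have z: "(d, x) \<in> state_set" using x by (simp add: state_set_def)
  fix q assume "q \<in> {s..r}"
  then have q: "q \<in> {0..T}" using s r by auto
  show "mean s (d, x) \<kappa> q \<le> M"
    using mean_mono[OF \<kappa> continuous_on_states_const[where c = "\<lambda>_. M"] s z q] le[OF q]
    by (simp add: mean_const[OF s z])
qed

end


locale jump_flow = markov T Y
  for T :: real and Y :: "('w, 'd::finite \<times> (real^'m::finite)) process" +
  fixes lam :: "real \<Rightarrow> 'd \<Rightarrow> 'd \<Rightarrow> real^'m \<Rightarrow> real" and b :: "real \<Rightarrow> 'd \<Rightarrow> real^'m \<Rightarrow> real^'m"
    and Lb B \<Lambda> hS :: real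
  assumes T_pos: "T > 0"
    and gen: "has_generator T Y (jump_flow_generator lam b)"
    and lam_continuous: "\<And>d'. continuous_on_states T (\<lambda>t d x. lam t d d' x)"
    and lam_bound: "\<And>t d d' x. t \<in> {0..T} \<Longrightarrow> x \<in> \<S> \<Longrightarrow> \<bar>lam t d d' x\<bar> \<le> \<Lambda>"
    and b_lipschitz: "\<And>d. Lb-lipschitz_on ({0..T} \<times> \<S>) (\<lambda>(t, x). b t d x)"
    and b_bound: "\<And>t d x. t \<in> {0..T} \<Longrightarrow> x \<in> \<S> \<Longrightarrow> norm (b t d x) \<le> B"
    and hS: "hS > 0"
    and flow_in_simplex: "\<And>t d x h. t \<in> {0..T} \<Longrightarrow> x \<in> \<S> \<Longrightarrow> 0 \<le> h \<Longrightarrow> h \<le> hS \<Longrightarrow>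
           x + h *\<^sub>R b t d x \<in> \<S>"
begin

lemma b_lipschitz_sq:
  assumes "t \<in> {0..T}" "x \<in> \<S>" "s \<in> {0..T}" "y \<in> \<S>"
  shows "(norm (b s d y - b t d x))\<^sup>2 \<le> Lb\<^sup>2 * ((s - t)\<^sup>2 + (norm (y - x))\<^sup>2)"
proof -
  have "norm (b s d y - b t d x) \<le> Lb * dist (s, y) (t, x)"
    using lipschitz_onD[OF b_lipschitz, of "(s, y)" "(t, x)" d] assms by (simp add: dist_norm)
  then have "(norm (b s d y - b t d x))\<^sup>2 \<le> (Lb * dist (s, y) (t, x))\<^sup>2"
    by (intro power_mono) auto
  also have "\<dots> = Lb\<^sup>2 * ((s - t)\<^sup>2 + (norm (y - x))\<^sup>2)"
    unfolding power_mult_distrib dist_Pair_Pair by (simp add: dist_norm)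
  finally show ?thesis .
qed

lemma B_nonneg: "0 \<le> B" and \<Lambda>_nonneg: "0 \<le> \<Lambda>"
  using b_bound[of 0 0] lam_bound[of 0 0] T_pos zero_in_simplex_coords
  by (force intro: order_trans[OF norm_ge_zero] order_trans[OF abs_ge_zero])+

lemma generates_C1:
  assumes F: "C1_test F"
  shows "generates F (jump_flow_generator lam b F)"
  unfolding generates_def
proof (intro allI impI)
  fix e :: real assume "e > 0"
  then have "\<forall>\<^sub>F h in at_right 0. \<forall>t\<in>{0..T - h}. \<forall>d. \<forall>x\<in>\<S>.
      \<bar>((\<integral>\<omega>. (case traj Y (t + h) \<omega> of (d', x') \<Rightarrow> F (t + h) d' x') \<partial>law Y t (d, x)) - F t d x) / h
         - jump_flow_generator lam b F t d x\<bar> < e"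
    using gen F unfolding has_generator_def by blast
  then obtain h0 where h0: "h0 > 0" "\<And>h t d x. 0 < h \<Longrightarrow> h < h0 \<Longrightarrow> t \<in> {0..T - h} \<Longrightarrow> x \<in> \<S> \<Longrightarrow>
      \<bar>(mean t (d, x) F (t + h) - F t d x) / h - jump_flow_generator lam b F t d x\<bar> < e"
    unfolding eventually_at_right_field mean_def case_prod_beta by blast
  have "\<bar>mean t (d, x) F (t + h) - F t d x - h * jump_flow_generator lam b F t d x\<bar> \<le> e * h"
    if h: "0 < h" "h < h0" and "t \<in> {0..T - h}" "x \<in> \<S>" for h t d x
  proof -
    have "\<bar>h * ((mean t (d, x) F (t + h) - F t d x) / h - jump_flow_generator lam b F t d x)\<bar> \<le> h * e"
      unfolding abs_mult using h0(2)[OF that, of d] h by (intro mult_mono less_imp_le) auto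
    moreover have "h * ((mean t (d, x) F (t + h) - F t d x) / h - jump_flow_generator lam b F t d x)
        = mean t (d, x) F (t + h) - F t d x - h * jump_flow_generator lam b F t d x"
      using h by (simp add: right_diff_distrib diff_divide_distrib)
    ultimately show ?thesis by (simp add: mult.commute)
  qed
  then show "\<exists>h0>0. \<forall>h. 0 < h \<and> h < h0 \<longrightarrow> (\<forall>t\<in>{0..T - h}. \<forall>d. \<forall>x\<in>\<S>.
      \<bar>mean t (d, x) F (t + h) - F t d x - h * jump_flow_generator lam b F t d x\<bar> \<le> e * h)"
    using h0(1) by blast
qed

lemma jump_probability_bound:
  assumes t: "t \<in> {0..T}" and s: "s \<in> {t..T}" and x: "x \<in> \<S>"
  shows "mean t (d, x) (\<lambda>_ d' _. of_bool (d' \<noteq> d)) s \<le> real CARD('d) * \<Lambda> * (s - t)"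
proof -
  let ?F = "\<lambda>(_::real) d' (_::real^'m). of_bool (d' \<noteq> d) :: real"
  let ?\<kappa> = "\<lambda>t d'' x. \<Sum>d'\<in>UNIV - {d''}. (?F t d' x - ?F t d'' x) * lam t d'' d' x"
  have cF: "continuous_on_states T ?F" by (rule continuous_on_states_const)
  have c\<kappa>: "continuous_on_states T ?\<kappa>"
    by (rule continuous_on_states_jumps[OF cF lam_continuous])
  have g: "generates ?F ?\<kappa>"
    using generates_C1[OF C1_test_const] unfolding generator_const .
  have "?\<kappa> q d'' y \<le> real CARD('d) * \<Lambda>" if "q \<in> {0..T}" "y \<in> \<S>" for q d'' y
  proof -
    have "?\<kappa> q d'' y \<le> (\<Sum>d'\<in>UNIV - {d''}. \<Lambda>)"
    proof (rule sum_mono)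
      fix d'
      have "(?F q d' y - ?F q d'' y) * lam q d'' d' y \<le> \<bar>?F q d' y - ?F q d'' y\<bar> * \<bar>lam q d'' d' y\<bar>"
        unfolding abs_mult[symmetric] by (rule abs_ge_self)
      also have "\<dots> \<le> 1 * \<Lambda>" using lam_bound that by (intro mult_mono) auto
      finally show "(?F q d' y - ?F q d'' y) * lam q d'' d' y \<le> \<Lambda>" by simp
    qed
    also have "\<dots> \<le> real CARD('d) * \<Lambda>" using \<Lambda>_nonneg by (auto intro!: mult_right_mono card_mono)
    finally show ?thesis .
  qed
  from Dynkin_pointwise_bound[where d = d, OF cF c\<kappa> g t s x this] show ?thesis by simp
qed

lemma generates_squared_distance:
  "generates (squared_distance t0 x0 c) (\<lambda>t d y. 2 * ((y - x0 - (t - t0) *\<^sub>R c) \<bullet> (b t d y - c)))"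
  using generates_C1[OF C1_test_squared_distance[of t0 x0 c]] by (simp add: generator_squared_distance[abs_def])

lemma drift_error_continuous:
  "continuous_on_states T (\<lambda>t d y. 2 * ((y - x0 - (t - t0) *\<^sub>R c) \<bullet> (b t d y - c)))"
  "continuous_on_states T (\<lambda>t d y. (norm (b t d y - c))\<^sup>2)"
  unfolding continuous_on_states_def case_prod_beta
  using lipschitz_on_continuous_on[OF b_lipschitz]
  by (auto intro!: continuous_intros simp: case_prod_beta)

lemma displacement_bound:
  assumes t: "t \<in> {0..T}" and s: "s \<in> {t..T}" and x: "x \<in> \<S>"
  shows "mean t (d, x) (squared_distance 0 x 0) s \<le> 4 * B * (s - t)"
proof -
  have "2 * ((y - x - (q - 0) *\<^sub>R 0) \<bullet> (b q d' y - 0)) \<le> 4 * B" if "q \<in> {0..T}" "y \<in> \<S>" for q d' y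
  proof -
    have "(y - x) \<bullet> b q d' y \<le> norm (y - x) * norm (b q d' y)" by (rule norm_cauchy_schwarz)
    also have "\<dots> \<le> 2 * B"
      using norm_triangle_ineq4[of y x] simplex_coords_bounds[OF x] simplex_coords_bounds[OF that(2)] b_bound[OF that]
      by (intro mult_mono) auto
    finally show ?thesis by simp
  qed
  from Dynkin_pointwise_bound[OF continuous_on_states_squared_distance drift_error_continuous(1)
      generates_squared_distance t s x this]
  have "mean t (d, x) (squared_distance 0 x 0) s \<le> squared_distance 0 x 0 t d x + 4 * B * (s - t)" .
  then show ?thesis by (simp add: squared_distance_def[of _ _ _ t])
qed

definition deviation_constant :: real where
  "deviation_constant = 4 * B\<^sup>2 * (real CARD('d) * \<Lambda>) + Lb\<^sup>2 * T + Lb\<^sup>2 * (4 * B)"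

lemma deviation_constant_nonneg: "0 \<le> deviation_constant"
  unfolding deviation_constant_def using B_nonneg \<Lambda>_nonneg T_pos by simp

text \<open>The drift changes either because the discrete state has jumped, which has a probability of first order,
  or by Lipschitz continuity in proportion to the time and distance covered.\<close>

lemma drift_deviation_bound:
  assumes t: "t \<in> {0..T}" and s: "s \<in> {t..T}" and x: "x \<in> \<S>"
  shows "mean t (d, x) (\<lambda>q d' y. (norm (b q d' y - b t d x))\<^sup>2) s \<le> deviation_constant * (s - t)"
proof -
  have z: "(d, x) \<in> state_set" using x by (simp add: state_set_def)
  have s0: "s \<in> {0..T}" using s t by auto
  let ?J = "\<lambda>(_::real) d' (_::real^'m). of_bool (d' \<noteq> d) :: real"
  let ?F = "squared_distance 0 x 0 :: real \<Rightarrow> 'd \<Rightarrow> real^'m \<Rightarrow> real"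
  let ?c = "\<lambda>(_::real) (_::'d) (_::real^'m). Lb\<^sup>2 * (s - t)\<^sup>2"
  let ?w = "\<lambda>q d' y. (4 * B\<^sup>2 * ?J q d' y + ?c q d' y) + Lb\<^sup>2 * ?F q d' y"
  have c1: "continuous_on_states T (\<lambda>q d' y. 4 * B\<^sup>2 * ?J q d' y)" by (rule continuous_on_states_const)
  have c2: "continuous_on_states T ?c" by (rule continuous_on_states_const)
  have c3: "continuous_on_states T (\<lambda>q d' y. Lb\<^sup>2 * ?F q d' y)"
    by (rule continuous_on_states_mult[OF continuous_on_states_const continuous_on_states_squared_distance])
  have cb: "continuous_on_states T (\<lambda>q d' y. (norm (b q d' y - b t d x))\<^sup>2)"
    by (rule drift_error_continuous(2))
  have "(norm (b s d' y - b t d x))\<^sup>2 \<le> ?w s d' y" if y: "y \<in> \<S>" for d' y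
  proof (cases "d' = d")
    case True
    have "(norm (y - x))\<^sup>2 = ?F s d' y" by (simp add: squared_distance_def power2_norm_eq_inner)
    then show ?thesis using b_lipschitz_sq[OF t x s0 y, of d] True by (simp add: distrib_left)
  next
    case False
    have "norm (b s d' y - b t d x) \<le> 2 * B"
      using norm_triangle_ineq4[of "b s d' y" "b t d x"] b_bound[OF s0 y, of d'] b_bound[OF t x, of d] by simp
    then have "(norm (b s d' y - b t d x))\<^sup>2 \<le> (2 * B)\<^sup>2" by (intro power_mono) auto
    moreover have "0 \<le> ?F s d' y" by (simp add: squared_distance_def)
    ultimately show ?thesis using False by (simp add: power_mult_distrib add_increasing2)
  qed
  then have "mean t (d, x) (\<lambda>q d' y. (norm (b q d' y - b t d x))\<^sup>2) s \<le> mean t (d, x) ?w s"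
    by (intro mean_mono cb continuous_on_states_add c1 c2 c3 t z s0)
  also have "\<dots> = 4 * B\<^sup>2 * mean t (d, x) ?J s + Lb\<^sup>2 * (s - t)\<^sup>2 + Lb\<^sup>2 * mean t (d, x) ?F s"
    by (simp only: mean_add[OF continuous_on_states_add[OF c1 c2] c3 t z s0] mean_add[OF c1 c2 t z s0]
        mean_cmult mean_const[OF t z])
  also have "\<dots> \<le> 4 * B\<^sup>2 * (real CARD('d) * \<Lambda> * (s - t)) + Lb\<^sup>2 * (T * (s - t)) + Lb\<^sup>2 * (4 * B * (s - t))"
  proof (intro add_mono mult_left_mono)
    show "(s - t)\<^sup>2 \<le> T * (s - t)"
      unfolding power2_eq_square using s t by (intro mult_right_mono) auto
  qed (use jump_probability_bound[OF t s x] displacement_bound[OF t s x] in auto)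
  also have "\<dots> = deviation_constant * (s - t)" by (simp add: deviation_constant_def algebra_simps)
  finally show ?thesis .
qed

text \<open>The squared distance to the Euler step has no first-order term: its rate of change is the
  scalar product of the deviation with the drift error.  Bounding that product by weighted squares
  lets the supremum of the second moment absorb itself.\<close>

lemma Euler_step_second_moment:
  assumes th: "t \<in> {0..T - h}" and h: "0 < h" and x: "x \<in> \<S>"
  shows "mean t (d, x) (squared_distance t x (b t d x)) (t + h) \<le> 4 * deviation_constant * h ^ 3"
proof -
  have t: "t \<in> {0..T}" using th h by auto
  have z: "(d, x) \<in> state_set" using x by (simp add: state_set_def)
  let ?F = "squared_distance t x (b t d x) :: real \<Rightarrow> 'd \<Rightarrow> real^'m \<Rightarrow> real"
  let ?\<kappa> = "\<lambda>q d' y. 2 * ((y - x - (q - t) *\<^sub>R b t d x) \<bullet> (b q d' y - b t d x))"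
  let ?b = "\<lambda>q d' y. (norm (b q d' y - b t d x))\<^sup>2"
  have cF: "continuous_on_states T ?F" by (rule continuous_on_states_squared_distance)
  have c\<kappa>: "continuous_on_states T ?\<kappa>" and cb: "continuous_on_states T ?b"
    by (rule drift_error_continuous)+
  have g: "generates ?F ?\<kappa>" by (rule generates_squared_distance)
  let ?m = "\<lambda>q. mean t (d, x) ?F q"
  define S where "S = (SUP q\<in>{t..t + h}. ?m q)"
  obtain M where M: "M \<ge> 0" "\<And>q d' y. q \<in> {0..T} \<Longrightarrow> y \<in> \<S> \<Longrightarrow> \<bar>?F q d' y\<bar> \<le> M"
    using continuous_on_states_bounded[OF cF] by metis
  have bdd: "bdd_above (?m ` {t..t + h})"
  proof (rule bdd_aboveI2)
    fix q assume "q \<in> {t..t + h}"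
    then have q: "q \<in> {0..T}" using th by auto
    show "?m q \<le> M" using mean_abs_le[OF t z q cF M(2)[OF q]] by simp
  qed
  have m_le: "?m q \<le> S" if "q \<in> {t..t + h}" for q
    unfolding S_def by (rule cSUP_upper[OF that bdd])
  have weighted: "?\<kappa> q d' y \<le> 1 / (2 * h) * ?F q d' y + 2 * h * ?b q d' y" for q d' y
  proof -
    let ?w = "y - x - (q - t) *\<^sub>R b t d x" and ?v = "b q d' y - b t d x"
    have "0 \<le> (norm (?w - (2 * h) *\<^sub>R ?v))\<^sup>2" by simp
    also have "\<dots> = ?w \<bullet> ?w - 4 * h * (?w \<bullet> ?v) + 4 * h\<^sup>2 * (norm ?v)\<^sup>2"
      unfolding power2_norm_eq_inner
      by (simp add: inner_diff_left inner_diff_right inner_commute power2_eq_square algebra_simps)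
    finally have "4 * h * (?w \<bullet> ?v) / (2 * h) \<le> (?w \<bullet> ?w + 4 * h\<^sup>2 * (norm ?v)\<^sup>2) / (2 * h)"
      using h by (intro divide_right_mono) auto
    then show ?thesis using h by (simp add: squared_distance_def add_divide_distrib power2_eq_square)
  qed
  have le: "mean t (d, x) ?\<kappa> q \<le> S / (2 * h) + 2 * deviation_constant * h\<^sup>2" if q: "q \<in> {t..t + h}" for q
  proof -
    have q0: "q \<in> {0..T}" and qt: "q \<in> {t..T}" using q th by auto
    have "mean t (d, x) ?\<kappa> q \<le> mean t (d, x) (\<lambda>q d' y. 1 / (2 * h) * ?F q d' y + 2 * h * ?b q d' y) q"
      by (intro mean_mono c\<kappa> weighted t z q0 continuous_on_states_add cF cb
          continuous_on_states_mult[OF continuous_on_states_const])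
    also have "\<dots> = 1 / (2 * h) * ?m q + 2 * h * mean t (d, x) ?b q"
      by (simp only: mean_add[OF continuous_on_states_mult[OF continuous_on_states_const cF]
          continuous_on_states_mult[OF continuous_on_states_const cb] t z q0] mean_cmult)
    also have "\<dots> \<le> 1 / (2 * h) * S + 2 * h * (deviation_constant * h)"
    proof (intro add_mono mult_left_mono)
      show "?m q \<le> S" by (rule m_le[OF q])
      have "mean t (d, x) ?b q \<le> deviation_constant * (q - t)" by (rule drift_deviation_bound[OF t qt x])
      also have "\<dots> \<le> deviation_constant * h" using deviation_constant_nonneg q by (intro mult_left_mono) auto
      finally show "mean t (d, x) ?b q \<le> deviation_constant * h" .
    qed (use h in auto)
    finally show ?thesis by (simp add: power2_eq_square mult_ac)
  qed
  have F0: "?F t d x = 0" by (simp add: squared_distance_def)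
  have "0 \<le> S" using m_le[of t] mean_start[OF t x cF, of d] F0 h by simp
  have "?m q \<le> S / 2 + 2 * deviation_constant * h ^ 3" if q: "q \<in> {t..t + h}" for q
  proof -
    have qt: "q \<in> {t..T}" using q th by auto
    have "?m q \<le> ?F t d x + (S / (2 * h) + 2 * deviation_constant * h\<^sup>2) * (q - t)"
      by (rule Dynkin_upper_bound[OF cF c\<kappa> g t qt x]) (use le q in auto)
    also have "\<dots> \<le> (S / (2 * h) + 2 * deviation_constant * h\<^sup>2) * h"
      unfolding F0 using q h \<open>0 \<le> S\<close> deviation_constant_nonneg by (simp add: mult_left_mono)
    also have "\<dots> = S / 2 + 2 * deviation_constant * h ^ 3"
      using h by (simp add: field_simps power2_eq_square power3_eq_cube)
    finally show ?thesis .
  qed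
  then have "S \<le> S / 2 + 2 * deviation_constant * h ^ 3"
    unfolding S_def using h by (intro cSUP_least) auto
  then show ?thesis
    using m_le[of "t + h"] h by simp
qed


text \<open>The bound \<open>norm w \<le> (norm w)\<^sup>2 / (e h) + e h / 4\<close> turns the second moment of order \<open>h\<^sup>3\<close> into a
  first moment below \<open>e h\<close>.\<close>

lemma Euler_step_deviation:
  assumes e: "e > 0"
  obtains h0 where "h0 > 0" "\<And>h t d x. 0 < h \<Longrightarrow> h < h0 \<Longrightarrow> t \<in> {0..T - h} \<Longrightarrow> x \<in> \<S> \<Longrightarrow>
      mean t (d, x) (\<lambda>_ _ y. norm (y - x - h *\<^sub>R b t d x)) (t + h) \<le> e * h"
proof -
  define D where "D = 4 * deviation_constant"
  have D: "0 \<le> D" using deviation_constant_nonneg by (simp add: D_def)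
  show ?thesis
  proof (rule that)
    show "0 < e\<^sup>2 / (2 * D + 1)" using e D by simp
    fix h t and d :: 'd and x :: "real^'m"
    assume h: "0 < h" and hs: "h < e\<^sup>2 / (2 * D + 1)" and th: "t \<in> {0..T - h}" and x: "x \<in> \<S>"
    have t: "t \<in> {0..T}" and r: "t + h \<in> {0..T}" using th h by auto
    have z: "(d, x) \<in> state_set" using x by (simp add: state_set_def)
    let ?F = "squared_distance t x (b t d x) :: real \<Rightarrow> 'd \<Rightarrow> real^'m \<Rightarrow> real"
    let ?n = "\<lambda>(_::real) (_::'d) y. norm (y - x - h *\<^sub>R b t d x)"
    have cF: "continuous_on_states T ?F" by (rule continuous_on_states_squared_distance)
    have cn: "continuous_on_states T ?n"
      unfolding continuous_on_states_def case_prod_beta by (intro allI continuous_intros)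
    have "?n (t + h) d' y \<le> 1 / (e * h) * ?F (t + h) d' y + e * h / 4" for d' y
    proof -
      let ?a = "norm (y - x - h *\<^sub>R b t d x)"
      have F: "?F (t + h) d' y = ?a\<^sup>2" by (simp add: squared_distance_def power2_norm_eq_inner)
      have "0 \<le> (?a - e * h / 2)\<^sup>2 / (e * h)" using e h by simp
      also have "\<dots> = ?a\<^sup>2 / (e * h) - ?a + e * h / 4"
        using e h by (simp add: power2_eq_square field_simps)
      finally show ?thesis unfolding F by simp
    qed
    then have "mean t (d, x) ?n (t + h) \<le> mean t (d, x) (\<lambda>q d' y. 1 / (e * h) * ?F q d' y + e * h / 4) (t + h)"
      by (intro mean_mono cn t z r continuous_on_states_add cF continuous_on_states_const
          continuous_on_states_mult[OF continuous_on_states_const])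
    also have "\<dots> = 1 / (e * h) * mean t (d, x) ?F (t + h) + e * h / 4"
      by (simp only: mean_add[OF continuous_on_states_mult[OF continuous_on_states_const cF]
          continuous_on_states_const t z r] mean_cmult mean_const[OF t z])
    also have "\<dots> \<le> 1 / (e * h) * (D * h ^ 3) + e * h / 4"
      using Euler_step_second_moment[OF th h x, of d] e h unfolding D_def[symmetric] by (intro add_mono mult_left_mono) auto
    also have "\<dots> = (D * h / e) * h + e * h / 4"
      using e h by (simp add: power3_eq_cube)
    also have "\<dots> \<le> (e / 2) * h + e * h / 4"
    proof -
      have "(2 * D + 1) * h \<le> e\<^sup>2" using hs D by (simp add: pos_less_divide_eq mult.commute)
      then have "2 * (D * h) \<le> e * e" using h by (simp add: algebra_simps power2_eq_square)
      then have "D * h / e \<le> e / 2" using e by (simp add: field_simps)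
      then show ?thesis using h by (intro add_mono mult_right_mono) auto
    qed
    also have "\<dots> \<le> e * h" using e h by simp
    finally show "mean t (d, x) ?n (t + h) \<le> e * h" .
  qed
qed

text \<open>The indicator of one discrete state is a test function, and there are only finitely many states.\<close>

lemma jump_probability_expansion:
  assumes e: "e > 0"
  obtains h0 where "h0 > 0" "\<And>h t d c x. 0 < h \<Longrightarrow> h < h0 \<Longrightarrow> t \<in> {0..T - h} \<Longrightarrow> x \<in> \<S> \<Longrightarrow> c \<noteq> d \<Longrightarrow>
      \<bar>mean t (d, x) (\<lambda>_ d' _. of_bool (d' = c)) (t + h) - h * lam t d c x\<bar> \<le> e * h"
proof -
  have "\<exists>h0>0. \<forall>h t d x. 0 < h \<longrightarrow> h < h0 \<longrightarrow> t \<in> {0..T - h} \<longrightarrow> x \<in> \<S> \<longrightarrow> c \<noteq> d \<longrightarrow>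
      \<bar>mean t (d, x) (\<lambda>_ d' _. of_bool (d' = c)) (t + h) - h * lam t d c x\<bar> \<le> e * h" for c
  proof -
    let ?F = "\<lambda>(_::real) d' (_::real^'m). of_bool (d' = c) :: real"
    have gF: "jump_flow_generator lam b ?F t d x = lam t d c x" if "c \<noteq> d" for t d x
    proof -
      have "jump_flow_generator lam b ?F t d x = (\<Sum>d'\<in>UNIV - {d}. if d' = c then lam t d c x else 0)"
        unfolding generator_const using that by (intro sum.cong) auto
      then show ?thesis using that by simp
    qed
    have "generates ?F (jump_flow_generator lam b ?F)"
      by (rule generates_C1[OF C1_test_const])
    then obtain h0 where h0: "h0 > 0" "\<And>h t d x. 0 < h \<Longrightarrow> h < h0 \<Longrightarrow> t \<in> {0..T - h} \<Longrightarrow> x \<in> \<S> \<Longrightarrow>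
        \<bar>mean t (d, x) ?F (t + h) - ?F t d x - h * jump_flow_generator lam b ?F t d x\<bar> \<le> e * h"
      using e unfolding generates_def by meson
    have "\<bar>mean t (d, x) ?F (t + h) - h * lam t d c x\<bar> \<le> e * h"
      if "0 < h" "h < h0" "t \<in> {0..T - h}" "x \<in> \<S>" "c \<noteq> d" for h t d x
      using h0(2)[OF that(1-4), of d] that(5) unfolding gF[OF that(5)] by simp
    then show ?thesis using h0(1) by blast
  qed
  then obtain h0 where h0: "\<And>c. h0 c > 0" "\<And>c h t d x. 0 < h \<Longrightarrow> h < h0 c \<Longrightarrow> t \<in> {0..T - h} \<Longrightarrow> x \<in> \<S> \<Longrightarrow> c \<noteq> d \<Longrightarrow>
      \<bar>mean t (d, x) (\<lambda>_ d' _. of_bool (d' = c)) (t + h) - h * lam t d c x\<bar> \<le> e * h"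
    by metis
  show ?thesis
  proof (rule that[of "Min (range h0)"])
    show "0 < Min (range h0)" using h0(1) by (subst Min_gr_iff) auto
    fix h t and d c :: 'd and x :: "real^'m"
    assume "0 < h" "h < Min (range h0)" "t \<in> {0..T - h}" "x \<in> \<S>" "c \<noteq> d"
    then show "\<bar>mean t (d, x) (\<lambda>_ d' _. of_bool (d' = c)) (t + h) - h * lam t d c x\<bar> \<le> e * h"
      by (intro h0(2)) auto
  qed
qed

lemma scaled_fraction_le:
  fixes c e :: real
  assumes "0 \<le> c" "0 < e"
  shows "c * (e / (4 * (c + 1))) \<le> e / 4"
proof -
  have "c * (e / (4 * (c + 1))) = (c / (c + 1)) * (e / 4)" by simp
  also have "\<dots> \<le> 1 * (e / 4)" using assms by (intro mult_right_mono) (auto simp: divide_le_eq_1)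
  finally show ?thesis by simp
qed

text \<open>A Lipschitz function need not be differentiable, but the process only moves along the flow and
  by jumps.  The deviation from one Euler step is negligible by the second moment bound, so a derivative
  along the flow is enough.\<close>

theorem generates_lipschitz:
  assumes u: "\<And>d. K-lipschitz_on ({0..T} \<times> \<S>) (\<lambda>(t, x). u t d x)"
    and c: "derivative_along_flow T b u c"
  shows "generates u (\<lambda>t d x. c t d x + (\<Sum>d'\<in>UNIV - {d}. (u t d' x - u t d x) * lam t d d' x))"
  unfolding generates_def
proof (intro allI impI)
  fix e :: real assume e: "0 < e"
  have cu: "continuous_on_states T u" by (rule continuous_on_states_lipschitz[OF u])
  have K: "K \<ge> 0" by (rule lipschitz_on_nonneg[OF u])
  obtain M where M: "M \<ge> 0" "\<And>t d x. t \<in> {0..T} \<Longrightarrow> x \<in> \<S> \<Longrightarrow> \<bar>u t d x\<bar> \<le> M"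
    using continuous_on_states_bounded[OF cu] by metis
  note B = B_nonneg b_bound and \<Lambda> = \<Lambda>_nonneg lam_bound
  define N where "N = real CARD('d)"
  have N: "N \<ge> 0" by (simp add: N_def)
  (* Each of the four sources of error gets its share of e h: the jump probabilities (e1), the deviation
     from the Euler step (e2), the derivative along the flow, and the change of u over one step (h4). *)
  define e1 where "e1 = e / (4 * (2 * N * M + 1))"
  define e2 where "e2 = e / (4 * (K + 1))"
  define h4 where "h4 = e / (4 * (2 * N * \<Lambda> * K * (1 + B) + 1))"
  have e1: "e1 > 0" and e2: "e2 > 0" and h4: "h4 > 0"
    using e N M(1) K \<Lambda>(1) B(1) by (auto simp: e1_def e2_def h4_def intro!: divide_pos_pos mult_pos_pos add_nonneg_pos)
  obtain h1 where h1: "h1 > 0" "\<And>h t d c x. 0 < h \<Longrightarrow> h < h1 \<Longrightarrow> t \<in> {0..T - h} \<Longrightarrow> x \<in> \<S> \<Longrightarrow> c \<noteq> d \<Longrightarrow>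
      \<bar>mean t (d, x) (\<lambda>_ d' _. of_bool (d' = c)) (t + h) - h * lam t d c x\<bar> \<le> e1 * h"
    using jump_probability_expansion[OF e1] by metis
  obtain h2 where h2: "h2 > 0" "\<And>h t d x. 0 < h \<Longrightarrow> h < h2 \<Longrightarrow> t \<in> {0..T - h} \<Longrightarrow> x \<in> \<S> \<Longrightarrow>
      mean t (d, x) (\<lambda>_ _ y. norm (y - x - h *\<^sub>R b t d x)) (t + h) \<le> e2 * h"
    using Euler_step_deviation[OF e2] by metis
  have "e / 4 > 0" using e by simp
  then obtain h3 where h3: "h3 > 0" "\<And>h t d x. 0 < h \<Longrightarrow> h < h3 \<Longrightarrow> t \<in> {0..T - h} \<Longrightarrow> x \<in> \<S> \<Longrightarrow>
      \<bar>u (t + h) d (x + h *\<^sub>R b t d x) - u t d x - h * c t d x\<bar> \<le> e / 4 * h"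
    using c unfolding derivative_along_flow_def by meson
  let ?h0 = "min (min h1 h2) (min (min h3 h4) hS)"
  have "\<bar>mean t (d, x) u (t + h) - u t d x - h * (c t d x + (\<Sum>d'\<in>UNIV - {d}. (u t d' x - u t d x) * lam t d d' x))\<bar> \<le> e * h"
    if h: "0 < h" "h < ?h0" and th: "t \<in> {0..T - h}" and x: "x \<in> \<S>" for h t d x
  proof -
    have t: "t \<in> {0..T}" and r: "t + h \<in> {0..T}" using th h by auto
    have z: "(d, x) \<in> state_set" using x by (simp add: state_set_def)
    define y where "y = x + h *\<^sub>R b t d x"
    have y: "y \<in> \<S>" unfolding y_def using h by (intro flow_in_simplex t x) auto
    define p where "p d' = mean t (d, x) (\<lambda>_ d'' _. of_bool (d'' = d')) (t + h)" for d'
    define \<Delta> where "\<Delta> d' = u (t + h) d' y - u (t + h) d y" for d'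
    (* The value of u after one Euler step, as a combination of indicators of the discrete state. *)
    let ?v = "\<lambda>(_::real) d' (_::real^'m). u (t + h) d y + (\<Sum>c\<in>UNIV - {d}. \<Delta> c * of_bool (d' = c))"
    have v: "?v q d' y' = u (t + h) d' y" for q d' y'
      by (cases "d' = d") (simp_all add: \<Delta>_def)
    have cv: "continuous_on_states T ?v" by (rule continuous_on_states_const)
    have mv: "mean t (d, x) ?v (t + h) = u (t + h) d y + (\<Sum>c\<in>UNIV - {d}. \<Delta> c * p c)"
      unfolding p_def
      by (simp only: mean_add[OF continuous_on_states_const continuous_on_states_const t z r]
          mean_sum[OF continuous_on_states_const t z r] mean_cmult mean_const[OF t z])
    have "\<bar>mean t (d, x) u (t + h) - mean t (d, x) ?v (t + h)\<bar>
        \<le> mean t (d, x) (\<lambda>_ _ y'. K * norm (y' - x - h *\<^sub>R b t d x)) (t + h)"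
    proof (rule mean_abs_diff_le[OF cu cv _ t z r])
      show "continuous_on_states T (\<lambda>_ _ y'. K * norm (y' - x - h *\<^sub>R b t d x))"
        unfolding continuous_on_states_def case_prod_beta by (intro allI continuous_intros)
      fix d' and y' :: "real^'m" assume "y' \<in> \<S>"
      then have "\<bar>u (t + h) d' y' - u (t + h) d' y\<bar> \<le> K * norm (y' - y)"
        using lipschitz_onD[OF u, of "(t + h, y')" "(t + h, y)" d'] r y
        by (simp add: dist_Pair_Pair dist_real_def[symmetric]) (simp add: dist_norm)
      then show "\<bar>u (t + h) d' y' - ?v (t + h) d' y'\<bar> \<le> K * norm (y' - x - h *\<^sub>R b t d x)"
        unfolding v by (simp add: y_def diff_diff_eq)
    qed
    also have "\<dots> = K * mean t (d, x) (\<lambda>_ _ y'. norm (y' - x - h *\<^sub>R b t d x)) (t + h)"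
      by (rule mean_cmult)
    also have "\<dots> \<le> K * (e2 * h)"
      using h by (intro mult_left_mono h2(2) th x K) auto
    also have "\<dots> \<le> e / 4 * h"
    proof -
      have "K * e2 \<le> e / 4" using K e unfolding e2_def by (rule scaled_fraction_le)
      then show ?thesis using h by (simp add: mult.assoc[symmetric])
    qed
    finally have E1: "\<bar>mean t (d, x) u (t + h) - (u (t + h) d y + (\<Sum>c\<in>UNIV - {d}. \<Delta> c * p c))\<bar> \<le> e / 4 * h"
      unfolding mv .
    have E2: "\<bar>u (t + h) d y - u t d x - h * c t d x\<bar> \<le> e / 4 * h"
      unfolding y_def using h by (intro h3(2) th x) auto
    have dyx: "\<bar>u (t + h) d' y - u t d' x\<bar> \<le> K * (1 + B) * h" for d'
    proof -
      have "dist (t + h, y) (t, x) \<le> dist (t + h) t + dist y x"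
        unfolding dist_Pair_Pair by (rule sqrt_sum_squares_le_sum) auto
      also have "\<dots> \<le> h + h * B"
        using h B(2)[OF t x, of d] by (simp add: dist_norm y_def)
      finally have "K * dist (t + h, y) (t, x) \<le> K * (h + h * B)"
        using K by (rule mult_left_mono)
      moreover have "\<bar>u (t + h) d' y - u t d' x\<bar> \<le> K * dist (t + h, y) (t, x)"
        using lipschitz_onD[OF u, of "(t + h, y)" "(t, x)" d'] r y t x by (simp add: dist_real_def)
      ultimately show ?thesis by (simp add: algebra_simps)
    qed
    have E3: "\<bar>\<Delta> c * p c - h * ((u t c x - u t d x) * lam t d c x)\<bar> \<le> (2 * M * e1 + 2 * \<Lambda> * K * (1 + B) * h) * h"
      if "c \<noteq> d" for c
    proof -
      have "\<bar>\<Delta> c * (p c - h * lam t d c x)\<bar> \<le> (2 * M) * (e1 * h)"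
        unfolding abs_mult
      proof (intro mult_mono)
        show "\<bar>\<Delta> c\<bar> \<le> 2 * M" using M(2)[OF r y, of c] M(2)[OF r y, of d] by (simp add: \<Delta>_def)
        show "\<bar>p c - h * lam t d c x\<bar> \<le> e1 * h"
          unfolding p_def using h by (intro h1(2) th x that) auto
      qed (use M in auto)
      moreover have "\<bar>(\<Delta> c - (u t c x - u t d x)) * (h * lam t d c x)\<bar> \<le> (2 * (K * (1 + B) * h)) * (h * \<Lambda>)"
        unfolding abs_mult
      proof (intro mult_mono)
        show "\<bar>\<Delta> c - (u t c x - u t d x)\<bar> \<le> 2 * (K * (1 + B) * h)"
          using dyx[of c] dyx[of d] by (simp add: \<Delta>_def)
      qed (use h \<Lambda> t x K B in auto)
      moreover have "\<Delta> c * p c - h * ((u t c x - u t d x) * lam t d c x) =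
          \<Delta> c * (p c - h * lam t d c x) + (\<Delta> c - (u t c x - u t d x)) * (h * lam t d c x)"
        by (simp add: algebra_simps)
      moreover have "(2 * M * e1 + 2 * \<Lambda> * K * (1 + B) * h) * h = (2 * M) * (e1 * h) + (2 * (K * (1 + B) * h)) * (h * \<Lambda>)"
        by (simp add: algebra_simps)
      ultimately show ?thesis by linarith
    qed
    have "\<bar>(\<Sum>c\<in>UNIV - {d}. \<Delta> c * p c) - h * (\<Sum>d'\<in>UNIV - {d}. (u t d' x - u t d x) * lam t d d' x)\<bar>
        \<le> (\<Sum>c\<in>UNIV - {d}. \<bar>\<Delta> c * p c - h * ((u t c x - u t d x) * lam t d c x)\<bar>)"
      unfolding sum_distrib_left sum_subtractf[symmetric] by (rule sum_abs)
    also have "\<dots> \<le> (\<Sum>c\<in>UNIV - {d}. (2 * M * e1 + 2 * \<Lambda> * K * (1 + B) * h) * h)"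
      by (intro sum_mono E3) auto
    also have "\<dots> \<le> N * ((2 * M * e1 + 2 * \<Lambda> * K * (1 + B) * h) * h)"
      unfolding N_def sum_constant using M(1) e1 \<Lambda>(1) K B(1) h
      by (intro mult_right_mono) (auto intro!: card_mono)
    also have "\<dots> \<le> (e / 4 + e / 4) * h"
    proof -
      have "2 * N * M * e1 \<le> e / 4"
        unfolding e1_def using N M(1) e by (intro scaled_fraction_le) auto
      moreover have "2 * N * \<Lambda> * K * (1 + B) * h \<le> e / 4"
      proof -
        have "0 \<le> 2 * N * \<Lambda> * K * (1 + B)" using N \<Lambda>(1) K B(1) by simp
        then have "2 * N * \<Lambda> * K * (1 + B) * h \<le> 2 * N * \<Lambda> * K * (1 + B) * h4"
          using h by (intro mult_left_mono) auto
        also have "\<dots> \<le> e / 4"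
          unfolding h4_def using \<open>0 \<le> 2 * N * \<Lambda> * K * (1 + B)\<close> e by (rule scaled_fraction_le)
        finally show ?thesis .
      qed
      ultimately have "N * (2 * M * e1 + 2 * \<Lambda> * K * (1 + B) * h) \<le> e / 4 + e / 4"
        by (simp add: algebra_simps)
      from mult_right_mono[OF this, of h] show ?thesis using h by (simp only: mult.assoc)
    qed
    finally have E4: "\<bar>(\<Sum>c\<in>UNIV - {d}. \<Delta> c * p c) - h * (\<Sum>d'\<in>UNIV - {d}. (u t d' x - u t d x) * lam t d d' x)\<bar>
        \<le> (e / 4 + e / 4) * h" .
    have "e / 4 * h + e / 4 * h + (e / 4 + e / 4) * h = e * h" by (simp add: algebra_simps)
    then show ?thesis using E1 E2 E4 unfolding distrib_left[of h] by linarith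
  qed
  moreover have "?h0 > 0" using h1(1) h2(1) h3(1) h4 hS by simp
  ultimately show "\<exists>h0>0. \<forall>h. 0 < h \<and> h < h0 \<longrightarrow> (\<forall>t\<in>{0..T - h}. \<forall>d. \<forall>x\<in>\<S>.
      \<bar>mean t (d, x) u (t + h) - u t d x - h * (c t d x + (\<Sum>d'\<in>UNIV - {d}. (u t d' x - u t d x) * lam t d d' x))\<bar> \<le> e * h)"
    by blast
qed

end

section \<open>A Lipschitz solution of the dynamic programming equation\<close>

text \<open>The constants of most composites are irrelevant; only their existence is tracked.\<close>

definition is_lipschitz :: "'a::metric_space set \<Rightarrow> ('a \<Rightarrow> 'b::metric_space) \<Rightarrow> bool" where
  "is_lipschitz D f \<longleftrightarrow> (\<exists>K. K-lipschitz_on D f)"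

lemma is_lipschitz_bounded:
  fixes f :: "'a::metric_space \<Rightarrow> real"
  assumes "is_lipschitz D f" "bounded D"
  shows "\<exists>M\<ge>0. \<forall>p\<in>D. \<bar>f p\<bar> \<le> M"
proof (cases "D = {}")
  case False
  then obtain p0 where p0: "p0 \<in> D" by auto
  obtain K where K: "K-lipschitz_on D f" using assms by (auto simp: is_lipschitz_def)
  obtain e where e: "\<And>p. p \<in> D \<Longrightarrow> dist p0 p \<le> e"
    using assms(2) bounded_any_center[of D p0] by auto
  have "\<bar>f p\<bar> \<le> \<bar>f p0\<bar> + K * e" if "p \<in> D" for p
  proof -
    have "\<bar>f p0 - f p\<bar> \<le> K * dist p0 p"
      using lipschitz_onD[OF K p0 that] by (simp add: dist_real_def)
    also have "\<dots> \<le> K * e" using e[OF that] lipschitz_on_nonneg[OF K] by (rule mult_left_mono)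
    finally show ?thesis by linarith
  qed
  then show ?thesis
    using e[OF p0] lipschitz_on_nonneg[OF K] by (intro exI[of _ "\<bar>f p0\<bar> + K * e"]) auto
qed auto

lemma is_lipschitz_add:
  fixes f g :: "'a::metric_space \<Rightarrow> real"
  assumes "is_lipschitz D f" "is_lipschitz D g"
  shows "is_lipschitz D (\<lambda>p. f p + g p)"
proof -
  obtain K K' where K: "K-lipschitz_on D f" "K'-lipschitz_on D g" using assms by (auto simp: is_lipschitz_def)
  show ?thesis unfolding is_lipschitz_def by (rule exI, rule lipschitz_on_add[OF K])
qed

lemma is_lipschitz_diff:
  fixes f g :: "'a::metric_space \<Rightarrow> real"
  assumes "is_lipschitz D f" "is_lipschitz D g"
  shows "is_lipschitz D (\<lambda>p. f p - g p)"
proof -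
  obtain K K' where K: "K-lipschitz_on D f" "K'-lipschitz_on D g" using assms by (auto simp: is_lipschitz_def)
  show ?thesis unfolding is_lipschitz_def by (rule exI, rule lipschitz_on_diff[OF K])
qed

lemma is_lipschitz_sum:
  fixes f :: "'i \<Rightarrow> 'a::metric_space \<Rightarrow> real"
  assumes "\<And>i. i \<in> I \<Longrightarrow> is_lipschitz D (f i)"
  shows "is_lipschitz D (\<lambda>p. \<Sum>i\<in>I. f i p)"
  using assms
proof (induction I rule: infinite_finite_induct)
  case (insert i I)
  then show ?case by (simp add: is_lipschitz_add)
qed (auto simp: is_lipschitz_def intro: lipschitz_on_constant)

lemma is_lipschitz_mult:
  fixes f g :: "'a::metric_space \<Rightarrow> real"
  assumes f: "is_lipschitz D f" and g: "is_lipschitz D g" and D: "bounded D"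
  shows "is_lipschitz D (\<lambda>p. f p * g p)"
proof -
  obtain K K' where K: "K-lipschitz_on D f" and K': "K'-lipschitz_on D g"
    using f g by (auto simp: is_lipschitz_def)
  obtain M M' where M: "M \<ge> 0" "\<And>p. p \<in> D \<Longrightarrow> \<bar>f p\<bar> \<le> M" and M': "M' \<ge> 0" "\<And>p. p \<in> D \<Longrightarrow> \<bar>g p\<bar> \<le> M'"
    using is_lipschitz_bounded[OF f D] is_lipschitz_bounded[OF g D] by metis
  have "(M * K' + M' * K)-lipschitz_on D (\<lambda>p. f p * g p)"
  proof (rule lipschitz_onI)
    fix p q assume p: "p \<in> D" and q: "q \<in> D"
    have "\<bar>f p * (g p - g q)\<bar> \<le> M * (K' * dist p q)"
      unfolding abs_mult using M(1) M(2)[OF p] lipschitz_onD[OF K' p q]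
      by (intro mult_mono) (auto simp: dist_real_def)
    moreover have "\<bar>g q * (f p - f q)\<bar> \<le> M' * (K * dist p q)"
      unfolding abs_mult using M'(1) M'(2)[OF q] lipschitz_onD[OF K p q]
      by (intro mult_mono) (auto simp: dist_real_def)
    moreover have "f p * g p - f q * g q = f p * (g p - g q) + g q * (f p - f q)"
      by (simp add: algebra_simps)
    ultimately show "dist (f p * g p) (f q * g q) \<le> (M * K' + M' * K) * dist p q"
      unfolding dist_real_def distrib_right mult.assoc by linarith
  qed (use M(1) M'(1) lipschitz_on_nonneg[OF K] lipschitz_on_nonneg[OF K'] in simp)
  then show ?thesis by (auto simp: is_lipschitz_def)
qed

lemma is_lipschitz_compose:
  assumes g: "is_lipschitz E g" and f: "is_lipschitz D f" and sub: "f ` D \<subseteq> E"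
  shows "is_lipschitz D (\<lambda>p. g (f p))"
proof -
  obtain K K' where K: "K-lipschitz_on E g" and K': "K'-lipschitz_on D f"
    using f g by (auto simp: is_lipschitz_def)
  have "(K * K')-lipschitz_on D (\<lambda>p. g (f p))"
    by (rule lipschitz_on_compose2[OF K' lipschitz_on_subset[OF K sub]])
  then show ?thesis by (auto simp: is_lipschitz_def)
qed

lemma is_lipschitz_Pair:
  assumes "is_lipschitz D f" "is_lipschitz D g"
  shows "is_lipschitz D (\<lambda>p. (f p, g p))"
proof -
  obtain K K' where K: "K-lipschitz_on D f" "K'-lipschitz_on D g" using assms by (auto simp: is_lipschitz_def)
  show ?thesis unfolding is_lipschitz_def by (rule exI, rule lipschitz_on_Pair[OF K])
qed

lemma is_lipschitz_fst: "is_lipschitz D fst" and is_lipschitz_snd: "is_lipschitz D snd"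
  unfolding is_lipschitz_def
  by (rule exI[of _ 1], rule lipschitz_onI, simp_all add: dist_fst_le dist_snd_le)+

lemma is_lipschitz_vec_nth: "is_lipschitz D (\<lambda>v. v $ i)"
  unfolding is_lipschitz_def
  by (rule exI[of _ 1], rule lipschitz_onI) (simp_all add: dist_vec_nth_le)

lemma is_lipschitz_uniform:
  fixes f :: "'i::finite \<Rightarrow> 'a::metric_space \<Rightarrow> 'b::metric_space"
  assumes "\<And>i. is_lipschitz D (f i)"
  obtains K where "K \<ge> 0" "\<And>i. K-lipschitz_on D (f i)"
proof -
  obtain K where K: "\<And>i. (K i)-lipschitz_on D (f i)" using assms unfolding is_lipschitz_def by metis
  have nn: "K i \<ge> 0" for i by (rule lipschitz_on_nonneg[OF K])
  have "(\<Sum>i\<in>UNIV. K i)-lipschitz_on D (f i)" for i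
    by (rule lipschitz_on_mono[OF K order_refl]) (auto intro!: member_le_sum nn)
  then show ?thesis by (intro that[of "\<Sum>i\<in>UNIV. K i"] sum_nonneg nn)
qed

lemma norm_vec_le:
  fixes w :: "real^'d::finite"
  assumes "\<And>d. \<bar>w $ d\<bar> \<le> m"
  shows "norm w \<le> real CARD('d) * m"
proof -
  have "norm w \<le> (\<Sum>d\<in>UNIV. \<bar>w $ d\<bar>)" by (rule norm_le_l1_cart)
  also have "\<dots> \<le> real CARD('d) * m" by (rule sum_bounded_above) (use assms in auto)
  finally show ?thesis .
qed

text \<open>A bounded sequence of functions on an uncountable set need not have a pointwise convergent
  subsequence, but by Tychonoff's theorem it converges at every point along a finer filter.\<close>

lemma pointwise_limit_along_filter:
  fixes f :: "nat \<Rightarrow> 'i \<Rightarrow> real"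
  assumes bound: "\<And>n i. \<bar>f n i\<bar> \<le> C"
  obtains G u where "G \<noteq> bot" "G \<le> sequentially" "\<And>i. ((\<lambda>n. f n i) \<longlongrightarrow> u i) G" "\<And>i. \<bar>u i\<bar> \<le> C"
proof -
  let ?K = "PiE UNIV (\<lambda>_. {- C..C}) :: ('i \<Rightarrow> real) set"
  have "compactin (product_topology (\<lambda>_. euclidean) UNIV) ?K"
    unfolding compactin_PiE by simp
  then have "compact ?K" by (simp only: euclidean_product_topology compactin_euclidean_iff)
  moreover have "eventually (\<lambda>x. x \<in> ?K) (filtermap f sequentially)"
    using bound by (auto simp: eventually_filtermap abs_le_iff minus_le_iff intro!: always_eventually)
  moreover have "filtermap f sequentially \<noteq> bot" by (simp add: filtermap_bot_iff)
  ultimately obtain u where uK: "u \<in> ?K" and u: "inf (nhds u) (filtermap f sequentially) \<noteq> bot"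
    unfolding compact_filter by blast
  let ?G = "inf sequentially (filtercomap f (nhds u))"
  have "?G \<noteq> bot"
  proof
    assume "?G = bot"
    then have "eventually (\<lambda>_. False) ?G" by simp
    then obtain P Q where P: "eventually P sequentially" and Q: "eventually Q (filtercomap f (nhds u))"
      and PQ: "\<And>n. P n \<and> Q n \<Longrightarrow> False"
      unfolding eventually_inf by blast
    obtain Q' where Q': "eventually Q' (nhds u)" "\<And>n. Q' (f n) \<Longrightarrow> Q n"
      using Q unfolding eventually_filtercomap by blast
    have "eventually (\<lambda>y. \<exists>n. P n \<and> y = f n) (filtermap f sequentially)"
      unfolding eventually_filtermap using P by eventually_elim auto
    then have "eventually (\<lambda>_. False) (inf (nhds u) (filtermap f sequentially))"
      unfolding eventually_inf using Q' PQ by blast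
    then show False using u by (simp add: eventually_False)
  qed
  moreover have "((\<lambda>n. f n i) \<longlongrightarrow> u i) ?G" for i
  proof -
    have f: "filterlim f (nhds u) ?G"
      by (rule filterlim_mono[OF filterlim_filtercomap order_refl]) simp
    show ?thesis
    proof (rule topological_tendstoI)
      fix S :: "real set" assume S: "open S" "u i \<in> S"
      have "open ((\<lambda>x :: 'i \<Rightarrow> real. x i) -` S)"
        by (rule open_vimage[OF S(1)]) (rule continuous_on_product_coordinates)
      then have "eventually (\<lambda>x. x i \<in> S) (nhds u)"
        using S(2) eventually_nhds_in_open[of "(\<lambda>x :: 'i \<Rightarrow> real. x i) -` S" u] by simp
      then show "eventually (\<lambda>n. f n i \<in> S) ?G"
        by (rule eventually_compose_filterlim[OF _ f])
    qed
  qed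
  moreover have "\<bar>u i\<bar> \<le> C" for i using uK by (auto simp: PiE_def Pi_def abs_le_iff minus_le_iff)
  ultimately show ?thesis by (intro that[of ?G u]) auto
qed

lemma control_substitution_lipschitz:
  fixes \<phi> :: "real \<Rightarrow> 'a::real_normed_vector \<Rightarrow> real^'m::finite \<Rightarrow> real"
  assumes \<phi>: "L-lipschitz_on ({0..T} \<times> A \<times> \<S>) (\<lambda>(t, a, x). \<phi> t a x)"
    and t: "is_lipschitz D \<tau>" and a: "is_lipschitz D \<alpha>" and x: "is_lipschitz D \<xi>"
    and mem: "\<And>p. p \<in> D \<Longrightarrow> \<tau> p \<in> {0..T} \<and> \<alpha> p \<in> A \<and> \<xi> p \<in> \<S>"
  shows "is_lipschitz D (\<lambda>p. \<phi> (\<tau> p) (\<alpha> p) (\<xi> p))"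
proof -
  have "is_lipschitz ({0..T} \<times> A \<times> \<S>) (\<lambda>(t, a, x). \<phi> t a x)"
    using \<phi> by (auto simp: is_lipschitz_def)
  then have "is_lipschitz D (\<lambda>p. (\<lambda>(t, a, x). \<phi> t a x) (\<tau> p, \<alpha> p, \<xi> p))"
    by (rule is_lipschitz_compose[OF _ is_lipschitz_Pair[OF t is_lipschitz_Pair[OF a x]]]) (use mem in auto)
  then show ?thesis by simp
qed

lemma is_lipschitz_const: "is_lipschitz D (\<lambda>p. c)"
  by (auto simp: is_lipschitz_def intro: lipschitz_on_constant)

definition jump_hamiltonian ::
  "(real \<Rightarrow> 'd::finite \<Rightarrow> 'd \<Rightarrow> 'a \<Rightarrow> real^'m \<Rightarrow> real) \<Rightarrow> (real \<Rightarrow> 'd \<Rightarrow> 'a \<Rightarrow> real^'m \<Rightarrow> real)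
   \<Rightarrow> real \<Rightarrow> 'd \<Rightarrow> real^'m \<Rightarrow> real^'d \<Rightarrow> 'a \<Rightarrow> real" where
  "jump_hamiltonian lam ell t d x v a =
     ell t d a x + (\<Sum>d'\<in>UNIV - {d}. (v $ d' - v $ d) * lam t d d' a x)"

text \<open>\<open>flow_in_simplex\<close> expresses that the drift does not leave the simplex, for Euler steps instead of
  integral curves.\<close>

locale control_problem =
  fixes T :: real and A :: "'a::real_normed_vector set"
    and lam :: "real \<Rightarrow> 'd::finite \<Rightarrow> 'd \<Rightarrow> 'a \<Rightarrow> real^'m::finite \<Rightarrow> real"
    and b :: "real \<Rightarrow> 'd \<Rightarrow> real^'m \<Rightarrow> real^'m"
    and ell :: "real \<Rightarrow> 'd \<Rightarrow> 'a \<Rightarrow> real^'m \<Rightarrow> real" and g :: "'d \<Rightarrow> real^'m \<Rightarrow> real"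
    and ahat :: "real \<Rightarrow> 'd \<Rightarrow> real^'m \<Rightarrow> real^'d \<Rightarrow> 'a"
    and L La Lb B hS :: real
  assumes T_pos: "T > 0"
    and lam_nonneg: "\<And>t d d' a x. t \<in> {0..T} \<Longrightarrow> a \<in> A \<Longrightarrow> x \<in> \<S> \<Longrightarrow> d \<noteq> d' \<Longrightarrow> 0 \<le> lam t d d' a x"
    and lam_lipschitz: "\<And>d d'. L-lipschitz_on ({0..T} \<times> A \<times> \<S>) (\<lambda>(t, a, x). lam t d d' a x)"
    and ell_lipschitz: "\<And>d. L-lipschitz_on ({0..T} \<times> A \<times> \<S>) (\<lambda>(t, a, x). ell t d a x)"
    and g_lipschitz: "\<And>d. L-lipschitz_on \<S> (g d)"
    and b_lipschitz: "\<And>d. Lb-lipschitz_on ({0..T} \<times> \<S>) (\<lambda>(t, x). b t d x)"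
    and b_bound: "\<And>t d x. t \<in> {0..T} \<Longrightarrow> x \<in> \<S> \<Longrightarrow> norm (b t d x) \<le> B"
    and hS: "hS > 0"
    and flow_in_simplex: "\<And>t d x h. t \<in> {0..T} \<Longrightarrow> x \<in> \<S> \<Longrightarrow> 0 \<le> h \<Longrightarrow> h \<le> hS \<Longrightarrow>
           x + h *\<^sub>R b t d x \<in> \<S>"
    and ahat_in: "\<And>t d x v. t \<in> {0..T} \<Longrightarrow> x \<in> \<S> \<Longrightarrow> ahat t d x v \<in> A"
    and ahat_lipschitz: "\<And>d. La-lipschitz_on ({0..T} \<times> \<S> \<times> UNIV) (\<lambda>(t, x, v). ahat t d x v)"
    and ahat_min: "\<And>t d x v a. t \<in> {0..T} \<Longrightarrow> x \<in> \<S> \<Longrightarrow> a \<in> A \<Longrightarrow>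
          jump_hamiltonian lam ell t d x v (ahat t d x v) \<le> jump_hamiltonian lam ell t d x v a"
begin

abbreviation hamiltonian :: "real \<Rightarrow> 'd \<Rightarrow> real^'m \<Rightarrow> real^'d \<Rightarrow> 'a \<Rightarrow> real" where
  "hamiltonian \<equiv> jump_hamiltonian lam ell"

definition min_hamiltonian :: "real \<Rightarrow> 'd \<Rightarrow> real^'m \<Rightarrow> real^'d \<Rightarrow> real" where
  "min_hamiltonian t d x v = hamiltonian t d x v (ahat t d x v)"

lemma min_hamiltonian_le:
  "t \<in> {0..T} \<Longrightarrow> x \<in> \<S> \<Longrightarrow> a \<in> A \<Longrightarrow> min_hamiltonian t d x v \<le> hamiltonian t d x v a"
  unfolding min_hamiltonian_def by (rule ahat_min)

abbreviation slab :: "real \<Rightarrow> (real \<times> (real^'m) \<times> (real^'d)) set" where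
  "slab R \<equiv> {0..T} \<times> \<S> \<times> cball 0 R"

lemma bounded_slab: "bounded (slab R)"
  using compact_imp_bounded[OF compact_simplex_coords] by (intro bounded_Times) auto

lemma optimal_lipschitz:
  fixes \<psi> :: "real \<Rightarrow> 'a \<Rightarrow> real^'m \<Rightarrow> real"
  assumes "L-lipschitz_on ({0..T} \<times> A \<times> \<S>) (\<lambda>(t, a, x). \<psi> t a x)"
  shows "is_lipschitz (slab R) (\<lambda>p. \<psi> (fst p) (ahat (fst p) d (fst (snd p)) (snd (snd p))) (fst (snd p)))"
proof -
  have x: "is_lipschitz (slab R) (\<lambda>p. fst (snd p))"
    by (rule is_lipschitz_compose[OF is_lipschitz_fst is_lipschitz_snd subset_UNIV])
  have "La-lipschitz_on (slab R) (\<lambda>(t, x, v). ahat t d x v)"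
    by (rule lipschitz_on_subset[OF ahat_lipschitz]) auto
  then have a: "is_lipschitz (slab R) (\<lambda>p. ahat (fst p) d (fst (snd p)) (snd (snd p)))"
    by (auto simp: is_lipschitz_def case_prod_unfold)
  show ?thesis
    by (rule control_substitution_lipschitz[OF assms is_lipschitz_fst a x]) (use ahat_in in auto)
qed

lemma min_hamiltonian_lipschitz:
  "is_lipschitz (slab R) (\<lambda>p. min_hamiltonian (fst p) d (fst (snd p)) (snd (snd p)))"
proof -
  have v: "is_lipschitz (slab R) (\<lambda>p. snd (snd p) $ d')" for d'
    by (rule is_lipschitz_compose[OF is_lipschitz_vec_nth _ subset_UNIV])
      (rule is_lipschitz_compose[OF is_lipschitz_snd is_lipschitz_snd subset_UNIV])
  show ?thesis
    unfolding min_hamiltonian_def jump_hamiltonian_def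
    by (intro is_lipschitz_add is_lipschitz_sum is_lipschitz_mult is_lipschitz_diff v bounded_slab
        optimal_lipschitz[OF ell_lipschitz] optimal_lipschitz[OF lam_lipschitz])
qed


end

text \<open>The expression is an average of the entries of \<open>w\<close>: entry \<open>d'\<close> has the weight \<open>\<delta> * p d'\<close>, and the
  remaining weight lies on \<open>d\<close>.\<close>

lemma jump_average_bounds:
  fixes w :: "real^'d::finite"
  assumes w: "\<And>d'. \<bar>w $ d'\<bar> \<le> m" and p: "\<And>d'. d' \<noteq> d \<Longrightarrow> 0 \<le> p d'"
    and small: "\<delta> * (\<Sum>d'\<in>UNIV - {d}. p d') \<le> 1" and \<delta>: "0 \<le> \<delta>"
  shows "\<bar>w $ d + \<delta> * (\<Sum>d'\<in>UNIV - {d}. (w $ d' - w $ d) * p d')\<bar> \<le> m"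
proof -
  let ?P = "\<Sum>d'\<in>UNIV - {d}. p d'"
  have "(\<Sum>d'\<in>UNIV - {d}. (w $ d' - w $ d) * p d') \<le> (\<Sum>d'\<in>UNIV - {d}. (m - w $ d) * p d')"
    using w p by (intro sum_mono mult_right_mono) (auto simp: abs_le_iff)
  then have "\<delta> * (\<Sum>d'\<in>UNIV - {d}. (w $ d' - w $ d) * p d') \<le> (m - w $ d) * (\<delta> * ?P)"
    using \<delta> by (simp add: sum_distrib_left[symmetric] mult_left_mono mult.left_commute)
  also have "\<dots> \<le> (m - w $ d) * 1"
    using small w[of d] by (intro mult_left_mono) auto
  finally have upper: "w $ d + \<delta> * (\<Sum>d'\<in>UNIV - {d}. (w $ d' - w $ d) * p d') \<le> m" by simp
  have "(- m - w $ d) * 1 \<le> (- m - w $ d) * (\<delta> * ?P)"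
    using small w[of d] by (intro mult_left_mono_neg) auto
  also have "\<dots> = \<delta> * (\<Sum>d'\<in>UNIV - {d}. (- m - w $ d) * p d')"
    by (simp add: sum_distrib_left[symmetric] mult.left_commute)
  also have "\<dots> \<le> \<delta> * (\<Sum>d'\<in>UNIV - {d}. (w $ d' - w $ d) * p d')"
    using w p \<delta> by (intro mult_left_mono sum_mono mult_right_mono) (auto simp: abs_le_iff minus_le_iff)
  finally have lower: "- m \<le> w $ d + \<delta> * (\<Sum>d'\<in>UNIV - {d}. (w $ d' - w $ d) * p d')" by simp
  show ?thesis
    by (rule abs_leI[OF upper]) (use lower in \<open>simp only: minus_le_iff\<close>)
qed

text \<open>A fixed mesh \<open>\<delta>\<close>, together with constants that do not depend on it.  The values of the scheme will
  stay in the ball of radius \<open>CARD('d) * (c + c * T)\<close>; \<open>\<Lambda>\<close> bounds the total jump rates under the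
  minimizers for arguments in this ball and under one fixed control \<open>a0\<close>, \<open>KH\<close> and \<open>MH\<close> are a Lipschitz
  constant and a bound of the minimized Hamiltonian there.\<close>

locale time_discretization = control_problem T A lam b ell g ahat L La Lb B hS
  for T :: real and A :: "'a::real_normed_vector set"
    and lam :: "real \<Rightarrow> 'd::finite \<Rightarrow> 'd \<Rightarrow> 'a \<Rightarrow> real^'m::finite \<Rightarrow> real"
    and b ell g ahat L La Lb B hS +
  fixes c \<Lambda> KH MH \<delta> :: real and a0 :: 'a
  assumes a0: "a0 \<in> A"
    and c: "c \<ge> 0"
    and g_bound: "\<And>d x. x \<in> \<S> \<Longrightarrow> \<bar>g d x\<bar> \<le> c"
    and ell_lower: "\<And>t d a x. t \<in> {0..T} \<Longrightarrow> a \<in> A \<Longrightarrow> x \<in> \<S> \<Longrightarrow> - c \<le> ell t d a x"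
    and ell_upper: "\<And>t d x. t \<in> {0..T} \<Longrightarrow> x \<in> \<S> \<Longrightarrow> ell t d a0 x \<le> c"
    and lam_a0: "\<And>t d x. t \<in> {0..T} \<Longrightarrow> x \<in> \<S> \<Longrightarrow> (\<Sum>d'\<in>UNIV - {d}. lam t d d' a0 x) \<le> \<Lambda>"
    and lam_ahat: "\<And>t d x v. t \<in> {0..T} \<Longrightarrow> x \<in> \<S> \<Longrightarrow> norm v \<le> real CARD('d) * (c + c * T) \<Longrightarrow>
           (\<Sum>d'\<in>UNIV - {d}. lam t d d' (ahat t d x v) x) \<le> \<Lambda>"
    and KH: "\<And>d. KH-lipschitz_on (slab (real CARD('d) * (c + c * T)))
           (\<lambda>p. min_hamiltonian (fst p) d (fst (snd p)) (snd (snd p)))"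
    and MH: "\<And>t d x v. t \<in> {0..T} \<Longrightarrow> x \<in> \<S> \<Longrightarrow> norm v \<le> real CARD('d) * (c + c * T) \<Longrightarrow>
           \<bar>min_hamiltonian t d x v\<bar> \<le> MH"
    and \<delta>: "0 < \<delta>" "\<delta> \<le> hS" "\<delta> \<le> 1" "\<delta> * \<Lambda> \<le> 1"
begin

definition Euler :: "real \<Rightarrow> 'd \<Rightarrow> real^'m \<Rightarrow> real^'m" where
  "Euler t d x = x + \<delta> *\<^sub>R b t d x"

text \<open>Backward recursion: \<open>W j\<close> approximates the value function at time \<open>T - j \<delta>\<close>.\<close>

primrec W :: "nat \<Rightarrow> real^'m \<Rightarrow> real^'d" where
  "W 0 x = (\<chi> d. g d x)"
| "W (Suc j) x = (\<chi> d. W j (Euler (T - real (Suc j) * \<delta>) d x) $ d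
      + \<delta> * min_hamiltonian (T - real (Suc j) * \<delta>) d x (W j (Euler (T - real (Suc j) * \<delta>) d x)))"

lemma Suc_time:
  assumes "real (Suc j) * \<delta> \<le> T"
  shows "real j * \<delta> \<le> T" "T - real (Suc j) * \<delta> \<in> {0..T}"
proof -
  have "0 \<le> real j * \<delta>" "real (Suc j) * \<delta> = real j * \<delta> + \<delta>" using \<delta>(1) by (auto simp: algebra_simps)
  then show "real j * \<delta> \<le> T" "T - real (Suc j) * \<delta> \<in> {0..T}"
    unfolding atLeastAtMost_iff using assms \<delta>(1) by linarith+
qed

lemma time_mem: "real j * \<delta> \<le> T \<Longrightarrow> T - real j * \<delta> \<in> {0..T}"
  using \<delta>(1) by auto

lemma Euler_in: "t \<in> {0..T} \<Longrightarrow> x \<in> \<S> \<Longrightarrow> Euler t d x \<in> \<S>"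
  unfolding Euler_def using \<delta> by (intro flow_in_simplex) auto

lemma B_nonneg: "0 \<le> B"
  using b_bound[of 0 0 undefined] T_pos zero_in_simplex_coords by (force intro: order_trans[OF norm_ge_zero])

lemma norm_le_R: "(\<And>d. \<bar>w $ d\<bar> \<le> c + c * T) \<Longrightarrow> norm w \<le> real CARD('d) * (c + c * T)" for w :: "real^'d"
  by (rule norm_vec_le)

text \<open>The recursion is monotone as long as the jump probabilities \<open>\<delta> lam\<close> over one step do not
  exceed one.  Comparison with the constant control \<open>a0\<close> from above and with the lower bound of the running
  cost from below therefore bounds the scheme independently of the mesh, which in turn keeps the
  minimizing controls, hence \<open>lam\<close>, bounded.\<close>

lemma W_bound:
  assumes "real j * \<delta> \<le> T" "x \<in> \<S>"
  shows "\<bar>W j x $ d\<bar> \<le> c + c * (real j * \<delta>)"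
  using assms
proof (induction j arbitrary: x d)
  case 0
  then show ?case using g_bound by simp
next
  case (Suc j)
  let ?t = "T - real (Suc j) * \<delta>"
  let ?m = "c + c * (real j * \<delta>)"
  note t = Suc_time(2)[OF Suc.prems(1)] and j = Suc_time(1)[OF Suc.prems(1)]
  let ?w = "W j (Euler ?t d x)"
  have w: "\<bar>?w $ d'\<bar> \<le> ?m" for d' by (rule Suc.IH[OF j Euler_in[OF t Suc.prems(2)]])
  have "?m \<le> c + c * T" using j c by (simp add: mult_left_mono)
  then have wR: "norm ?w \<le> real CARD('d) * (c + c * T)" using w by (intro norm_le_R) (meson order_trans)
  have step: "W (Suc j) x $ d = ?w $ d + \<delta> * min_hamiltonian ?t d x ?w" by simp
  let ?a = "ahat ?t d x ?w"
  have a: "?a \<in> A" by (rule ahat_in[OF t Suc.prems(2)])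
  have avg: "\<bar>?w $ d + \<delta> * (\<Sum>d'\<in>UNIV - {d}. (?w $ d' - ?w $ d) * lam ?t d d' a x)\<bar> \<le> ?m"
    if "a \<in> A" "(\<Sum>d'\<in>UNIV - {d}. lam ?t d d' a x) \<le> \<Lambda>" for a
  proof (rule jump_average_bounds)
    have "\<delta> * (\<Sum>d'\<in>UNIV - {d}. lam ?t d d' a x) \<le> \<delta> * \<Lambda>"
      using that(2) \<delta>(1) by (intro mult_left_mono) auto
    also have "\<dots> \<le> 1" by (rule \<delta>(4))
    finally show "\<delta> * (\<Sum>d'\<in>UNIV - {d}. lam ?t d d' a x) \<le> 1" .
  qed (use w lam_nonneg[OF t that(1) Suc.prems(2)] \<delta> in auto)
  have "W (Suc j) x $ d \<le> ?w $ d + \<delta> * hamiltonian ?t d x ?w a0"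
    unfolding step using min_hamiltonian_le[OF t Suc.prems(2) a0] \<delta> by (simp add: mult_left_mono)
  also have "\<dots> = ?w $ d + \<delta> * (\<Sum>d'\<in>UNIV - {d}. (?w $ d' - ?w $ d) * lam ?t d d' a0 x) + \<delta> * ell ?t d a0 x"
    by (simp add: jump_hamiltonian_def distrib_left)
  also have "\<dots> \<le> ?m + \<delta> * c"
    by (rule add_mono[OF abs_le_D1[OF avg[OF a0 lam_a0[OF t Suc.prems(2)]]]])
      (rule mult_left_mono[OF ell_upper[OF t Suc.prems(2)] less_imp_le[OF \<delta>(1)]])
  also have "\<dots> = c + c * (real (Suc j) * \<delta>)" by (simp add: algebra_simps)
  finally have upper: "W (Suc j) x $ d \<le> c + c * (real (Suc j) * \<delta>)" .
  have "- (c + c * (real (Suc j) * \<delta>)) = - ?m + \<delta> * (- c)" by (simp add: algebra_simps)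
  also have "\<dots> \<le> ?w $ d + \<delta> * (\<Sum>d'\<in>UNIV - {d}. (?w $ d' - ?w $ d) * lam ?t d d' ?a x) + \<delta> * ell ?t d ?a x"
    by (rule add_mono[OF _ mult_left_mono[OF ell_lower[OF t a Suc.prems(2)] less_imp_le[OF \<delta>(1)]]])
      (use abs_le_D2[OF avg[OF a lam_ahat[OF t Suc.prems(2) wR]]] in \<open>simp only: minus_le_iff\<close>)
  also have "\<dots> = W (Suc j) x $ d"
    unfolding step by (simp add: min_hamiltonian_def jump_hamiltonian_def distrib_left)
  finally show ?case using upper by linarith
qed

lemma W_bound_T:
  assumes "real j * \<delta> \<le> T" "x \<in> \<S>"
  shows "\<bar>W j x $ d\<bar> \<le> c + c * T" and "norm (W j x) \<le> real CARD('d) * (c + c * T)"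
proof -
  have *: "\<bar>W j x $ d\<bar> \<le> c + c * T" for d
    using W_bound[OF assms, of d] mult_left_mono[OF assms(1) c] by linarith
  then show "\<bar>W j x $ d\<bar> \<le> c + c * T" "norm (W j x) \<le> real CARD('d) * (c + c * T)" by (auto intro: norm_le_R)
qed

lemma KH_nonneg: "0 \<le> KH" by (rule lipschitz_on_nonneg[OF KH])
lemma Lb_nonneg: "0 \<le> Lb" by (rule lipschitz_on_nonneg[OF b_lipschitz])
lemma L_nonneg: "0 \<le> L" by (rule lipschitz_on_nonneg[OF g_lipschitz])

lemma dist_triple_le:
  fixes t t' :: real and x x' :: "real^'m" and v v' :: "real^'d"
  shows "dist (t, x, v) (t', x', v') \<le> \<bar>t - t'\<bar> + norm (x - x') + norm (v - v')"
proof -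
  have "dist (t, x, v) (t', x', v') \<le> dist t t' + dist (x, v) (x', v')"
    unfolding dist_Pair_Pair[of t] by (rule sqrt_sum_squares_le_sum) auto
  also have "dist (x, v) (x', v') \<le> dist x x' + dist v v'"
    unfolding dist_Pair_Pair by (rule sqrt_sum_squares_le_sum) auto
  finally show ?thesis by (simp add: dist_norm)
qed

lemma min_hamiltonian_diff:
  assumes "t \<in> {0..T}" "x \<in> \<S>" "norm v \<le> real CARD('d) * (c + c * T)" "t' \<in> {0..T}" "x' \<in> \<S>" "norm v' \<le> real CARD('d) * (c + c * T)"
  shows "\<bar>min_hamiltonian t d x v - min_hamiltonian t' d x' v'\<bar>
    \<le> KH * (\<bar>t - t'\<bar> + norm (x - x') + norm (v - v'))"
proof -
  have "\<bar>min_hamiltonian t d x v - min_hamiltonian t' d x' v'\<bar> \<le> KH * dist (t, x, v) (t', x', v')"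
    using lipschitz_onD[OF KH, of "(t, x, v)" "(t', x', v')" d] assms by (simp add: dist_real_def)
  also have "\<dots> \<le> KH * (\<bar>t - t'\<bar> + norm (x - x') + norm (v - v'))"
    using dist_triple_le KH_nonneg by (rule mult_left_mono)
  finally show ?thesis .
qed

lemma b_diff:
  assumes "t \<in> {0..T}" "x \<in> \<S>" "t' \<in> {0..T}" "x' \<in> \<S>"
  shows "norm (b t d x - b t' d x') \<le> Lb * (\<bar>t - t'\<bar> + norm (x - x'))"
proof -
  have "norm (b t d x - b t' d x') \<le> Lb * dist (t, x) (t', x')"
    using lipschitz_onD[OF b_lipschitz, of "(t, x)" "(t', x')" d] assms by (simp add: dist_norm)
  also have "dist (t, x) (t', x') \<le> dist t t' + dist x x'"
    unfolding dist_Pair_Pair by (rule sqrt_sum_squares_le_sum) auto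
  finally show ?thesis using Lb_nonneg by (simp add: dist_norm mult_left_mono)
qed

definition "growth = Lb + KH * real CARD('d) * (1 + Lb) + KH"
definition "Kx = (L + 1) * exp (growth * T)"

lemma growth_nonneg: "0 \<le> growth"
  unfolding growth_def using Lb_nonneg KH_nonneg by simp

lemma Kx_nonneg: "0 \<le> Kx" unfolding Kx_def using L_nonneg by simp

text \<open>One step multiplies the Lipschitz constant in \<open>x\<close> by a factor and adds \<open>\<delta> * KH\<close>.  Starting from \<open>L + 1\<close>
  rather than \<open>L\<close> keeps the constant above one, so that the factor \<open>1 + growth * \<delta>\<close> accounts for both.\<close>

lemma W_lipschitz_x_aux:
  assumes "real j * \<delta> \<le> T" "x \<in> \<S>" "x' \<in> \<S>"
  shows "\<bar>W j x $ d - W j x' $ d\<bar> \<le> (L + 1) * exp (growth * (real j * \<delta>)) * norm (x - x')"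
  using assms
proof (induction j arbitrary: x x' d)
  case 0
  have "\<bar>g d x - g d x'\<bar> \<le> L * norm (x - x')"
    using lipschitz_onD[OF g_lipschitz 0(2,3)] by (simp add: dist_norm)
  also have "\<dots> \<le> (L + 1) * norm (x - x')" by (intro mult_right_mono) auto
  finally show ?case by simp
next
  case (Suc j)
  let ?t = "T - real (Suc j) * \<delta>"
  let ?k = "(L + 1) * exp (growth * (real j * \<delta>))"
  let ?n = "norm (x - x')"
  note t = Suc_time(2)[OF Suc.prems(1)] and j = Suc_time(1)[OF Suc.prems(1)]
  let ?y = "Euler ?t d x" and ?y' = "Euler ?t d x'"
  have y: "?y \<in> \<S>" "?y' \<in> \<S>" using Suc.prems t by (auto intro: Euler_in)
  have k1: "1 \<le> ?k"
  proof -
    have "1 * 1 \<le> ?k" using L_nonneg growth_nonneg \<delta>(1) by (intro mult_mono) auto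
    then show ?thesis by simp
  qed
  have yy: "norm (?y - ?y') \<le> (1 + \<delta> * Lb) * ?n"
  proof -
    have "norm (?y - ?y') = norm ((x - x') + \<delta> *\<^sub>R (b ?t d x - b ?t d x'))"
      by (simp add: Euler_def algebra_simps)
    also have "\<dots> \<le> ?n + \<delta> * norm (b ?t d x - b ?t d x')"
      using norm_triangle_ineq[of "x - x'" "\<delta> *\<^sub>R (b ?t d x - b ?t d x')"] \<delta>(1) by simp
    also have "\<dots> \<le> ?n + \<delta> * (Lb * ?n)"
      using b_diff[OF t Suc.prems(2) t Suc.prems(3), of d] \<delta>(1) by (simp add: mult_left_mono)
    finally show ?thesis by (simp add: algebra_simps)
  qed
  have wd: "\<bar>W j ?y $ d' - W j ?y' $ d'\<bar> \<le> ?k * ((1 + \<delta> * Lb) * ?n)" for d'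
    using Suc.IH[OF j y, of d'] mult_left_mono[OF yy, of ?k] k1 by linarith
  have wn: "norm (W j ?y - W j ?y') \<le> real CARD('d) * (?k * ((1 + \<delta> * Lb) * ?n))"
    by (rule norm_vec_le) (use wd in simp)
  have "\<bar>min_hamiltonian ?t d x (W j ?y) - min_hamiltonian ?t d x' (W j ?y')\<bar>
      \<le> KH * (?n + real CARD('d) * (?k * ((1 + \<delta> * Lb) * ?n)))"
    using min_hamiltonian_diff[OF t Suc.prems(2) W_bound_T(2)[OF j y(1)] t Suc.prems(3) W_bound_T(2)[OF j y(2)], of d]
      mult_left_mono[OF add_left_mono[OF wn, of ?n] KH_nonneg] by simp
  also have "\<dots> \<le> KH * (?k * ?n + real CARD('d) * (?k * ((1 + Lb) * ?n)))"
  proof -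
    have "?n \<le> ?k * ?n" using mult_right_mono[OF k1, of ?n] by simp
    moreover have "(1 + \<delta> * Lb) * ?n \<le> (1 + Lb) * ?n"
      using mult_right_mono[OF \<delta>(3) Lb_nonneg] by (intro mult_right_mono) auto
    ultimately show ?thesis
      using k1 by (intro mult_left_mono[OF add_mono KH_nonneg] mult_left_mono[of "(1 + \<delta> * Lb) * ?n"] mult_left_mono[of "?k * _"]) auto
  qed
  finally have mh: "\<bar>min_hamiltonian ?t d x (W j ?y) - min_hamiltonian ?t d x' (W j ?y')\<bar>
      \<le> KH * (?k * ?n + real CARD('d) * (?k * ((1 + Lb) * ?n)))" .
  have "\<bar>W (Suc j) x $ d - W (Suc j) x' $ d\<bar>
      \<le> \<bar>W j ?y $ d - W j ?y' $ d\<bar> + \<delta> * \<bar>min_hamiltonian ?t d x (W j ?y) - min_hamiltonian ?t d x' (W j ?y')\<bar>"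
  proof -
    have "W (Suc j) x $ d - W (Suc j) x' $ d = (W j ?y $ d - W j ?y' $ d)
        + \<delta> * (min_hamiltonian ?t d x (W j ?y) - min_hamiltonian ?t d x' (W j ?y'))"
      by (simp add: algebra_simps)
    moreover have "\<bar>\<delta> * (min_hamiltonian ?t d x (W j ?y) - min_hamiltonian ?t d x' (W j ?y'))\<bar>
        = \<delta> * \<bar>min_hamiltonian ?t d x (W j ?y) - min_hamiltonian ?t d x' (W j ?y')\<bar>"
      by (simp only: abs_mult abs_of_pos[OF \<delta>(1)])
    ultimately show ?thesis by linarith
  qed
  also have "\<dots> \<le> ?k * ((1 + \<delta> * Lb) * ?n) + \<delta> * (KH * (?k * ?n + real CARD('d) * (?k * ((1 + Lb) * ?n))))"
    using wd mh \<delta>(1) by (intro add_mono mult_left_mono) auto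
  also have "\<dots> = ?k * ?n * (1 + growth * \<delta>)"
    by (simp add: growth_def algebra_simps)
  also have "\<dots> \<le> ?k * ?n * exp (growth * \<delta>)"
    using k1 by (intro mult_left_mono exp_ge_add_one_self) auto
  also have "\<dots> = (L + 1) * exp (growth * (real (Suc j) * \<delta>)) * ?n"
    by (simp add: algebra_simps exp_add[symmetric])
  finally show ?case .
qed

lemma W_lipschitz_x:
  assumes "real j * \<delta> \<le> T" "x \<in> \<S>" "x' \<in> \<S>"
  shows "\<bar>W j x $ d - W j x' $ d\<bar> \<le> Kx * norm (x - x')"
proof -
  have "(L + 1) * exp (growth * (real j * \<delta>)) \<le> Kx"
    unfolding Kx_def using assms(1) growth_nonneg L_nonneg by (intro mult_left_mono) (auto intro: mult_left_mono)
  then have "(L + 1) * exp (growth * (real j * \<delta>)) * norm (x - x') \<le> Kx * norm (x - x')"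
    by (rule mult_right_mono) simp
  then show ?thesis using W_lipschitz_x_aux[OF assms, of d] by linarith
qed

definition "Kt = Kx * B + MH"

lemma MH_nonneg: "0 \<le> MH"
  using MH[of 0 0 0 undefined] T_pos zero_in_simplex_coords c by (force intro: order_trans[OF abs_ge_zero])

lemma Kt_nonneg: "0 \<le> Kt" unfolding Kt_def using Kx_nonneg B_nonneg MH_nonneg by simp

lemma Euler_displacement:
  assumes "t \<in> {0..T}" "x \<in> \<S>"
  shows "norm (Euler t d x - x) \<le> \<delta> * B"
  using b_bound[OF assms, of d] \<delta>(1) by (simp add: Euler_def mult_left_mono)

lemma W_Suc_diff:
  assumes "real (Suc j) * \<delta> \<le> T" "x \<in> \<S>"
  shows "\<bar>W (Suc j) x $ d - W j x $ d\<bar> \<le> Kt * \<delta>"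
proof -
  let ?t = "T - real (Suc j) * \<delta>"
  note t = Suc_time(2)[OF assms(1)] and j = Suc_time(1)[OF assms(1)]
  let ?y = "Euler ?t d x"
  have y: "?y \<in> \<S>" using assms t by (auto intro: Euler_in)
  have "\<bar>W j ?y $ d - W j x $ d\<bar> \<le> Kx * (\<delta> * B)"
    using W_lipschitz_x[OF j y assms(2), of d] mult_left_mono[OF Euler_displacement[OF t assms(2), of d] Kx_nonneg]
    by linarith
  moreover have "\<bar>\<delta> * min_hamiltonian ?t d x (W j ?y)\<bar> \<le> \<delta> * MH"
    unfolding abs_mult using MH[OF t assms(2) W_bound_T(2)[OF j y], of d] \<delta>(1) by (simp add: mult_left_mono)
  moreover have "W (Suc j) x $ d - W j x $ d = (W j ?y $ d - W j x $ d) + \<delta> * min_hamiltonian ?t d x (W j ?y)" by simp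
  moreover have "Kt * \<delta> = Kx * (\<delta> * B) + \<delta> * MH" by (simp add: Kt_def algebra_simps)
  ultimately show ?thesis by linarith
qed

lemma W_lipschitz_t:
  assumes "real (i + k) * \<delta> \<le> T" "x \<in> \<S>"
  shows "\<bar>W (i + k) x $ d - W i x $ d\<bar> \<le> Kt * (real k * \<delta>)"
  using assms(1)
proof (induction k)
  case (Suc k)
  have "real (i + k) * \<delta> \<le> T" using Suc_time(1)[of "i + k"] Suc.prems by simp
  with Suc.IH have "\<bar>W (i + k) x $ d - W i x $ d\<bar> \<le> Kt * (real k * \<delta>)" by simp
  moreover have "\<bar>W (i + Suc k) x $ d - W (i + k) x $ d\<bar> \<le> Kt * \<delta>"
    using W_Suc_diff[of "i + k" x d] Suc.prems assms(2) by simp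
  moreover have "Kt * (real (Suc k) * \<delta>) = Kt * (real k * \<delta>) + Kt * \<delta>" by (simp add: algebra_simps)
  ultimately show ?case by linarith
qed simp


definition "K3 = Kx * Lb * (1 + B) + KH * (1 + B + real CARD('d) * (Kx * B + Kt))"

lemma K3_nonneg: "0 \<le> K3"
  unfolding K3_def using Kx_nonneg Lb_nonneg B_nonneg KH_nonneg Kt_nonneg by simp

text \<open>Several steps of the scheme agree with a single step of the same total length up to a second
  order error that does not depend on the mesh.\<close>

lemma W_consistent:
  assumes "real (j + m) * \<delta> \<le> T" "real m * \<delta> \<le> hS" "x \<in> \<S>"
  defines "t \<equiv> T - real (j + m) * \<delta>"
  shows "\<bar>W (j + m) x $ d - W j (x + (real m * \<delta>) *\<^sub>R b t d x) $ d
      - real m * \<delta> * min_hamiltonian t d x (W (j + m) x)\<bar> \<le> K3 * (real m * \<delta>)\<^sup>2"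
  using assms(1-3) unfolding t_def
proof (induction m arbitrary: x)
  case (Suc m)
  define s where "s = T - real (j + m) * \<delta>"
  define t where "t = T - real (j + Suc m) * \<delta>"
  define h where "h = real m * \<delta>"
  define y where "y = Euler t d x"
  define w where "w = W (j + m) y"
  define w' where "w' = W (j + Suc m) x"
  note x = Suc.prems(3)
  have jm: "real (Suc (j + m)) * \<delta> \<le> T" using Suc.prems(1) by simp
  have jm': "real (j + m) * \<delta> \<le> T" by (rule Suc_time(1)[OF jm])
  have j0: "real j * \<delta> \<le> T"
  proof -
    have "real j * \<delta> \<le> real (j + m) * \<delta>" using \<delta>(1) by (intro mult_right_mono) auto
    then show ?thesis using jm' by linarith
  qed
  have h0: "0 \<le> h" using \<delta>(1) by (simp add: h_def)
  have hSuc: "real (Suc m) * \<delta> = h + \<delta>" by (simp add: h_def algebra_simps)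
  have hle: "h \<le> hS" "h + \<delta> \<le> hS" using Suc.prems(2) \<delta>(1) unfolding hSuc by auto
  have st: "s = t + \<delta>" by (simp add: s_def t_def algebra_simps)
  have t: "t \<in> {0..T}" using Suc_time(2)[OF jm] by (simp add: t_def)
  have s: "s \<in> {0..T}" using time_mem[OF jm'] by (simp add: s_def)
  have y: "y \<in> \<S>" unfolding y_def by (rule Euler_in[OF t x])
  have yx: "norm (y - x) \<le> \<delta> * B" unfolding y_def by (rule Euler_displacement[OF t x])
  have wR: "norm w \<le> real CARD('d) * (c + c * T)" unfolding w_def by (rule W_bound_T(2)[OF jm' y])
  have w'R: "norm w' \<le> real CARD('d) * (c + c * T)"
    unfolding w'_def using W_bound_T(2)[OF Suc.prems(1) x] .
  have ww: "norm (w - w') \<le> real CARD('d) * ((Kx * B + Kt) * \<delta>)"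
  proof (rule norm_vec_le)
    fix d'
    have "\<bar>w $ d' - W (j + m) x $ d'\<bar> \<le> Kx * (\<delta> * B)"
      unfolding w_def using W_lipschitz_x[OF jm' y x, of d'] mult_left_mono[OF yx Kx_nonneg] by linarith
    moreover have "\<bar>w' $ d' - W (j + m) x $ d'\<bar> \<le> Kt * \<delta>"
      unfolding w'_def using W_Suc_diff[OF jm x, of d'] by simp
    moreover have "(Kx * B + Kt) * \<delta> = Kx * (\<delta> * B) + Kt * \<delta>" by (simp add: algebra_simps)
    ultimately show "\<bar>(w - w') $ d'\<bar> \<le> (Kx * B + Kt) * \<delta>" by simp
  qed
  have step: "w' $ d = w $ d + \<delta> * min_hamiltonian t d x w"
    unfolding w'_def w_def y_def t_def by simp
  let ?p = "y + h *\<^sub>R b s d y" and ?p' = "x + (h + \<delta>) *\<^sub>R b t d x"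
  have p: "?p \<in> \<S>" by (rule flow_in_simplex[OF s y h0 hle(1)])
  have p': "?p' \<in> \<S>" using h0 \<delta>(1) by (intro flow_in_simplex[OF t x _ hle(2)]) simp
  have IH: "\<bar>w $ d - W j ?p $ d - h * min_hamiltonian s d y w\<bar> \<le> K3 * h\<^sup>2"
    using Suc.IH[OF jm' _ y] hle(1) unfolding h_def w_def s_def by simp
  have E1: "\<bar>W j ?p $ d - W j ?p' $ d\<bar> \<le> Kx * (h * (Lb * ((1 + B) * \<delta>)))"
  proof -
    have "norm (?p - ?p') = h * norm (b s d y - b t d x)"
    proof -
      have "?p - ?p' = h *\<^sub>R (b s d y - b t d x)" by (simp add: y_def Euler_def algebra_simps)
      then show ?thesis using h0 by simp
    qed
    also have "\<dots> \<le> h * (Lb * (\<bar>s - t\<bar> + norm (y - x)))"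
      by (rule mult_left_mono[OF b_diff[OF s y t x] h0])
    also have "\<dots> \<le> h * (Lb * ((1 + B) * \<delta>))"
      using yx \<delta>(1) by (intro mult_left_mono h0 Lb_nonneg) (simp add: st algebra_simps)
    finally have "Kx * norm (?p - ?p') \<le> Kx * (h * (Lb * ((1 + B) * \<delta>)))"
      by (rule mult_left_mono[OF _ Kx_nonneg])
    then show ?thesis using W_lipschitz_x[OF j0 p p', of d] by linarith
  qed
  let ?D = "(1 + B + real CARD('d) * (Kx * B + Kt)) * \<delta>"
  have E2: "\<bar>min_hamiltonian s d y w - min_hamiltonian t d x w'\<bar> \<le> KH * ?D"
  proof -
    have "\<bar>s - t\<bar> + norm (y - x) + norm (w - w') \<le> ?D"
      using yx ww \<delta>(1) by (simp add: st algebra_simps)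
    from mult_left_mono[OF this KH_nonneg] show ?thesis
      using min_hamiltonian_diff[OF s y wR t x w'R, of d] by linarith
  qed
  have E3: "\<bar>min_hamiltonian t d x w - min_hamiltonian t d x w'\<bar> \<le> KH * ?D"
  proof -
    have "\<bar>t - t\<bar> + norm (x - x) + norm (w - w') \<le> ?D"
    proof -
      have "?D = (1 + B) * \<delta> + real CARD('d) * ((Kx * B + Kt) * \<delta>)" by (simp add: algebra_simps)
      moreover have "0 \<le> (1 + B) * \<delta>" using B_nonneg \<delta>(1) by simp
      ultimately show ?thesis using ww by simp
    qed
    from mult_left_mono[OF this KH_nonneg] show ?thesis
      using min_hamiltonian_diff[OF t x wR t x w'R, of d] by linarith
  qed
  have F2: "\<bar>h * (min_hamiltonian s d y w - min_hamiltonian t d x w')\<bar> \<le> h * (KH * ?D)"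
    unfolding abs_mult using E2 h0 by (intro mult_mono) auto
  have F3: "\<bar>\<delta> * (min_hamiltonian t d x w - min_hamiltonian t d x w')\<bar> \<le> \<delta> * (KH * ?D)"
    unfolding abs_mult using E3 \<delta>(1) by (intro mult_mono) auto
  have "w' $ d - W j ?p' $ d - (h + \<delta>) * min_hamiltonian t d x w' =
      (w $ d - W j ?p $ d - h * min_hamiltonian s d y w) + (W j ?p $ d - W j ?p' $ d)
      + h * (min_hamiltonian s d y w - min_hamiltonian t d x w')
      + \<delta> * (min_hamiltonian t d x w - min_hamiltonian t d x w')"
    unfolding step by (simp add: algebra_simps)
  then have "\<bar>w' $ d - W j ?p' $ d - (h + \<delta>) * min_hamiltonian t d x w'\<bar>
      \<le> K3 * h\<^sup>2 + Kx * (h * (Lb * ((1 + B) * \<delta>))) + h * (KH * ?D) + \<delta> * (KH * ?D)"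
    using IH E1 F2 F3 by linarith
  also have "\<dots> \<le> K3 * h\<^sup>2 + K3 * (h * \<delta>) + K3 * \<delta>\<^sup>2"
  proof -
    have "K3 * (h * \<delta>) = Kx * (h * (Lb * ((1 + B) * \<delta>))) + h * (KH * ?D)"
      by (simp add: K3_def algebra_simps)
    moreover have "\<delta> * (KH * ?D) + Kx * Lb * (1 + B) * \<delta>\<^sup>2 = K3 * \<delta>\<^sup>2"
      by (simp add: K3_def algebra_simps power2_eq_square)
    moreover have "0 \<le> Kx * Lb * (1 + B) * \<delta>\<^sup>2"
      using Kx_nonneg Lb_nonneg B_nonneg by simp
    ultimately show ?thesis by linarith
  qed
  also have "\<dots> \<le> K3 * (h + \<delta>)\<^sup>2"
  proof -
    have "0 \<le> K3 * (h * \<delta>)" using K3_nonneg h0 \<delta>(1) by simp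
    then show ?thesis by (simp add: power2_sum algebra_simps)
  qed
  finally show ?case unfolding hSuc t_def[symmetric] w'_def[symmetric] .
qed simp

text \<open>The number of steps of length \<open>\<delta>\<close> that fit between \<open>t\<close> and \<open>T\<close>.  The mesh need not divide \<open>T\<close>: rounding
  only costs a multiple of \<open>\<delta>\<close>, which disappears in the limit.\<close>

definition index :: "real \<Rightarrow> nat" where
  "index t = nat \<lfloor>(T - t) / \<delta>\<rfloor>"

lemma index_bounds:
  assumes "t \<in> {0..T}"
  shows "real (index t) * \<delta> \<le> T - t" "T - t < real (index t) * \<delta> + \<delta>" "real (index t) * \<delta> \<le> T"
proof -
  have "0 \<le> (T - t) / \<delta>" using assms \<delta>(1) by simp
  then have "real (index t) = real_of_int \<lfloor>(T - t) / \<delta>\<rfloor>" by (simp add: index_def)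
  then have "real (index t) \<le> (T - t) / \<delta>" "(T - t) / \<delta> < real (index t) + 1" by linarith+
  then show "real (index t) * \<delta> \<le> T - t" "T - t < real (index t) * \<delta> + \<delta>"
    using \<delta>(1) by (auto simp: pos_le_divide_eq pos_divide_less_eq algebra_simps)
  then show "real (index t) * \<delta> \<le> T" using assms by simp
qed

definition v :: "real \<Rightarrow> real^'m \<Rightarrow> real^'d" where
  "v t x = W (index t) x"

lemma v_bound: "t \<in> {0..T} \<Longrightarrow> x \<in> \<S> \<Longrightarrow> \<bar>v t x $ d\<bar> \<le> c + c * T"
  unfolding v_def by (intro W_bound_T(1) index_bounds(3))

lemma v_terminal: "v T x $ d = g d x"
  by (simp add: v_def index_def)

lemma v_lipschitz:
  assumes t: "t \<in> {0..T}" and t': "t' \<in> {0..T}" and x: "x \<in> \<S>" and x': "x' \<in> \<S>"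
  shows "\<bar>v t x $ d - v t' x' $ d\<bar> \<le> Kx * norm (x - x') + Kt * (\<bar>t - t'\<bar> + \<delta>)"
proof -
  have time: "\<bar>v t x $ d - v t' x $ d\<bar> \<le> Kt * (\<bar>t - t'\<bar> + \<delta>)"
    if t: "t \<in> {0..T}" and t': "t' \<in> {0..T}" and le: "index t' \<le> index t" for t t'
  proof -
    obtain k where k: "index t = index t' + k" using le le_Suc_ex by blast
    have "\<bar>v t x $ d - v t' x $ d\<bar> \<le> Kt * (real k * \<delta>)"
      unfolding v_def k using W_lipschitz_t[OF _ x] index_bounds(3)[OF t] by (simp add: k)
    also have "\<dots> \<le> Kt * (\<bar>t - t'\<bar> + \<delta>)"
    proof (rule mult_left_mono[OF _ Kt_nonneg])
      have "real (index t) * \<delta> = real (index t') * \<delta> + real k * \<delta>" by (simp add: k algebra_simps)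
      then show "real k * \<delta> \<le> \<bar>t - t'\<bar> + \<delta>"
        using index_bounds(1)[OF t] index_bounds(2)[OF t'] by linarith
    qed
    finally show ?thesis .
  qed
  have "\<bar>v t x $ d - v t' x $ d\<bar> \<le> Kt * (\<bar>t - t'\<bar> + \<delta>)"
    using time[OF t t'] time[OF t' t] by (cases "index t' \<le> index t") (auto simp: abs_minus_commute)
  moreover have "\<bar>v t' x $ d - v t' x' $ d\<bar> \<le> Kx * norm (x - x')"
    unfolding v_def by (rule W_lipschitz_x[OF index_bounds(3)[OF t'] x x'])
  ultimately show ?thesis by linarith
qed

lemma v_consistent:
  assumes h: "0 < h" "h + \<delta> \<le> hS" and th: "t \<in> {0..T - h}" and x: "x \<in> \<S>"
  shows "\<bar>v t x $ d - v (t + h) (x + h *\<^sub>R b t d x) $ d - h * min_hamiltonian t d x (v t x)\<bar>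
    \<le> K3 * (h + \<delta>)\<^sup>2 + (Kx * (B + T * Lb) + MH + T * KH) * \<delta>"
proof -
  have t: "t \<in> {0..T}" and t': "t + h \<in> {0..T}" using th h by auto
  let ?j = "index (t + h)" and ?J = "index t"
  have "?j \<le> ?J" unfolding index_def using h \<delta>(1) by (intro nat_mono floor_mono divide_right_mono) auto
  then obtain m where m: "?J = ?j + m" using le_Suc_ex by blast
  define s where "s = T - real (?j + m) * \<delta>"
  define k where "k = real m * \<delta>"
  have Jeq: "real (?j + m) * \<delta> = real ?j * \<delta> + k" by (simp add: k_def algebra_simps)
  have J: "real (?j + m) * \<delta> \<le> T - t" "T - t < real (?j + m) * \<delta> + \<delta>" "real (?j + m) * \<delta> \<le> T"
    using index_bounds[OF t] unfolding m by auto
  note j = index_bounds[OF t']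
  have k: "0 \<le> k" "\<bar>k - h\<bar> \<le> \<delta>" "k \<le> h + \<delta>" "k \<le> hS"
    using J j Jeq h(2) \<delta>(1) by (auto simp: k_def[symmetric]) (auto simp: k_def)
  have s: "s \<in> {0..T}" unfolding s_def by (rule time_mem[OF J(3)])
  have st: "\<bar>s - t\<bar> \<le> \<delta>" using J unfolding s_def by auto
  have vt: "v t x = W (?j + m) x" by (simp add: v_def m)
  have vR: "norm (v t x) \<le> real CARD('d) * (c + c * T)" unfolding vt by (rule W_bound_T(2)[OF J(3) x])
  let ?H = "\<lambda>r. min_hamiltonian r d x (v t x)"
  let ?p = "x + k *\<^sub>R b s d x" and ?p' = "x + h *\<^sub>R b t d x"
  have p: "?p \<in> \<S>" by (rule flow_in_simplex[OF s x k(1,4)])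
  have p': "?p' \<in> \<S>" using h \<delta>(1) by (intro flow_in_simplex[OF t x]) auto
  have E0: "\<bar>v t x $ d - W ?j ?p $ d - k * ?H s\<bar> \<le> K3 * (h + \<delta>)\<^sup>2"
  proof -
    have "\<bar>v t x $ d - W ?j ?p $ d - k * ?H s\<bar> \<le> K3 * k\<^sup>2"
      using W_consistent[OF J(3) _ x, of d] k(4) unfolding vt k_def s_def by simp
    also have "\<dots> \<le> K3 * (h + \<delta>)\<^sup>2" using k by (intro mult_left_mono K3_nonneg power_mono) auto
    finally show ?thesis .
  qed
  have hT: "h \<le> T" using th by auto
  have E1: "\<bar>W ?j ?p $ d - v (t + h) ?p' $ d\<bar> \<le> Kx * ((B + T * Lb) * \<delta>)"
  proof -
    have "?p - ?p' = (k - h) *\<^sub>R b s d x + h *\<^sub>R (b s d x - b t d x)" by (simp add: algebra_simps)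
    then have "norm (?p - ?p') \<le> \<bar>k - h\<bar> * norm (b s d x) + h * norm (b s d x - b t d x)"
      using norm_triangle_ineq[of "(k - h) *\<^sub>R b s d x" "h *\<^sub>R (b s d x - b t d x)"] h by simp
    also have "\<dots> \<le> \<delta> * B + T * (Lb * \<delta>)"
    proof (intro add_mono mult_mono)
      have "Lb * (\<bar>s - t\<bar> + norm (x - x)) \<le> Lb * \<delta>" using st Lb_nonneg by (simp add: mult_left_mono)
      then show "norm (b s d x - b t d x) \<le> Lb * \<delta>" using b_diff[OF s x t x, of d] by linarith
    qed (use k b_bound[OF s x] \<delta>(1) hT h in auto)
    also have "\<dots> = (B + T * Lb) * \<delta>" by (simp add: algebra_simps)
    finally have "Kx * norm (?p - ?p') \<le> Kx * ((B + T * Lb) * \<delta>)" by (rule mult_left_mono[OF _ Kx_nonneg])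
    then show ?thesis using W_lipschitz_x[OF j(3) p p', of d] unfolding v_def by linarith
  qed
  have E2: "\<bar>k * ?H s - h * ?H t\<bar> \<le> (MH + T * KH) * \<delta>"
  proof -
    have "\<bar>(k - h) * ?H s\<bar> \<le> \<delta> * MH"
      unfolding abs_mult using k MH[OF s x vR, of d] \<delta>(1) by (intro mult_mono) auto
    moreover have "\<bar>h * (?H s - ?H t)\<bar> \<le> T * (KH * \<delta>)"
      unfolding abs_mult
    proof (rule mult_mono)
      have "KH * (\<bar>s - t\<bar> + norm (x - x) + norm (v t x - v t x)) \<le> KH * \<delta>"
        using st KH_nonneg by (simp add: mult_left_mono)
      then show "\<bar>?H s - ?H t\<bar> \<le> KH * \<delta>" using min_hamiltonian_diff[OF s x vR t x vR, of d] by linarith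
    qed (use h hT T_pos in auto)
    moreover have "k * ?H s - h * ?H t = (k - h) * ?H s + h * (?H s - ?H t)" by (simp add: algebra_simps)
    moreover have "(MH + T * KH) * \<delta> = \<delta> * MH + T * (KH * \<delta>)" by (simp add: algebra_simps)
    ultimately show ?thesis by linarith
  qed
  have "(Kx * (B + T * Lb) + MH + T * KH) * \<delta> = Kx * ((B + T * Lb) * \<delta>) + (MH + T * KH) * \<delta>"
    by (simp add: algebra_simps)
  then show ?thesis using E0 E1 E2 by linarith
qed


end

context control_problem
begin

lemma bounded_uniformly:
  fixes f :: "'i::finite \<Rightarrow> 'p::metric_space \<Rightarrow> real"
  assumes "\<And>i. is_lipschitz D (f i)" "bounded D"
  obtains M where "M \<ge> 0" "\<And>i p. p \<in> D \<Longrightarrow> \<bar>f i p\<bar> \<le> M"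
proof -
  obtain M where M: "\<And>i. M i \<ge> 0" "\<And>i p. p \<in> D \<Longrightarrow> \<bar>f i p\<bar> \<le> M i"
    using is_lipschitz_bounded[OF assms] by metis
  show ?thesis
  proof (rule that)
    show "0 \<le> (\<Sum>i\<in>UNIV. M i)" by (simp add: sum_nonneg M)
    fix i p assume "p \<in> D"
    then have "\<bar>f i p\<bar> \<le> M i" by (rule M)
    also have "\<dots> \<le> (\<Sum>i\<in>UNIV. M i)" by (intro member_le_sum) (auto simp: M)
    finally show "\<bar>f i p\<bar> \<le> (\<Sum>i\<in>UNIV. M i)" .
  qed
qed

lemma constant_control_lipschitz:
  fixes \<psi> :: "real \<Rightarrow> 'a \<Rightarrow> real^'m \<Rightarrow> real"
  assumes "L-lipschitz_on ({0..T} \<times> A \<times> \<S>) (\<lambda>(t, a, x). \<psi> t a x)" "a \<in> A"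
  shows "is_lipschitz ({0..T} \<times> \<S>) (\<lambda>p. \<psi> (fst p) a (snd p))"
  by (rule control_substitution_lipschitz[OF assms(1) is_lipschitz_fst is_lipschitz_const is_lipschitz_snd])
    (use assms(2) in auto)

text \<open>The bounds for the scheme, its Lipschitz estimates and its consistency each involve only finitely many
  points, so they survive a pointwise limit.\<close>

theorem dynamic_programming_solution:
  obtains u K where "\<And>d. K-lipschitz_on ({0..T} \<times> \<S>) (\<lambda>(t, x). u t d x)"
    "\<And>d x. x \<in> \<S> \<Longrightarrow> u T d x = g d x"
    "derivative_along_flow T b u (\<lambda>t d x. - min_hamiltonian t d x (\<chi> d'. u t d' x))"
proof -
  have bdS: "bounded (\<S> :: (real^'m) set)" by (rule compact_imp_bounded[OF compact_simplex_coords])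
  then have bdTS: "bounded ({0..T} \<times> (\<S> :: (real^'m) set))" by (intro bounded_Times) auto
  define a0 where "a0 = ahat 0 undefined 0 0"
  have a0: "a0 \<in> A" unfolding a0_def using T_pos by (intro ahat_in zero_in_simplex_coords) auto
  have g_lip: "is_lipschitz \<S> (g d)" for d using g_lipschitz by (auto simp: is_lipschitz_def)
  obtain c1 where c1: "c1 \<ge> 0" "\<And>d x. x \<in> \<S> \<Longrightarrow> \<bar>g d x\<bar> \<le> c1"
    by (rule bounded_uniformly[where f = g, OF g_lip bdS]) blast
  obtain c2 where c2: "c2 \<ge> 0" "\<And>d p. p \<in> slab 0 \<Longrightarrow> \<bar>min_hamiltonian (fst p) d (fst (snd p)) (snd (snd p))\<bar> \<le> c2"
    by (rule bounded_uniformly[of "slab 0" "\<lambda>d p. min_hamiltonian (fst p) d (fst (snd p)) (snd (snd p))",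
        OF min_hamiltonian_lipschitz bounded_slab]) blast
  obtain c3 where c3: "c3 \<ge> 0" "\<And>d p. p \<in> {0..T} \<times> \<S> \<Longrightarrow> \<bar>ell (fst p) d a0 (snd p)\<bar> \<le> c3"
    using bounded_uniformly[of "{0..T} \<times> \<S>" "\<lambda>d p. ell (fst p) d a0 (snd p)",
        OF constant_control_lipschitz[OF ell_lipschitz a0] bdTS] by metis
  define c where "c = c1 + c2 + c3"
  let ?R = "real CARD('d) * (c + c * T)"
  have lam1: "is_lipschitz ({0..T} \<times> \<S>) (\<lambda>p. \<Sum>d'\<in>UNIV - {d}. lam (fst p) d d' a0 (snd p))" for d
    by (intro is_lipschitz_sum constant_control_lipschitz[OF lam_lipschitz a0])
  obtain \<Lambda>1 where \<Lambda>1: "\<Lambda>1 \<ge> 0" "\<And>d p. p \<in> {0..T} \<times> \<S> \<Longrightarrow> \<bar>\<Sum>d'\<in>UNIV - {d}. lam (fst p) d d' a0 (snd p)\<bar> \<le> \<Lambda>1"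
    by (rule bounded_uniformly[where f = "\<lambda>d p. \<Sum>d'\<in>UNIV - {d}. lam (fst p) d d' a0 (snd p)", OF lam1 bdTS]) blast
  have lam2: "is_lipschitz (slab ?R) (\<lambda>p. \<Sum>d'\<in>UNIV - {d}. lam (fst p) d d' (ahat (fst p) d (fst (snd p)) (snd (snd p))) (fst (snd p)))" for d
    by (intro is_lipschitz_sum optimal_lipschitz[OF lam_lipschitz])
  obtain \<Lambda>2 where \<Lambda>2: "\<Lambda>2 \<ge> 0" "\<And>d p. p \<in> slab ?R \<Longrightarrow>
      \<bar>\<Sum>d'\<in>UNIV - {d}. lam (fst p) d d' (ahat (fst p) d (fst (snd p)) (snd (snd p))) (fst (snd p))\<bar> \<le> \<Lambda>2"
    by (rule bounded_uniformly[where f = "\<lambda>d p. \<Sum>d'\<in>UNIV - {d}. lam (fst p) d d' (ahat (fst p) d (fst (snd p)) (snd (snd p))) (fst (snd p))",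
        OF lam2 bounded_slab]) blast
  define \<Lambda> where "\<Lambda> = \<Lambda>1 + \<Lambda>2"
  have \<Lambda>0: "\<Lambda> \<ge> 0" using \<Lambda>1(1) \<Lambda>2(1) by (simp add: \<Lambda>_def)
  obtain KH where KH: "\<And>d. KH-lipschitz_on (slab ?R) (\<lambda>p. min_hamiltonian (fst p) d (fst (snd p)) (snd (snd p)))"
    by (rule is_lipschitz_uniform[of "slab ?R" "\<lambda>d p. min_hamiltonian (fst p) d (fst (snd p)) (snd (snd p))",
        OF min_hamiltonian_lipschitz]) blast
  obtain MH where MH: "\<And>d p. p \<in> slab ?R \<Longrightarrow> \<bar>min_hamiltonian (fst p) d (fst (snd p)) (snd (snd p))\<bar> \<le> MH"
    by (rule bounded_uniformly[of "slab ?R" "\<lambda>d p. min_hamiltonian (fst p) d (fst (snd p)) (snd (snd p))",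
        OF min_hamiltonian_lipschitz bounded_slab]) blast
  (* Below this mesh an Euler step stays in the simplex and the jump probabilities do not exceed one. *)
  define \<delta>0 where "\<delta>0 = min (min hS 1) (1 / (\<Lambda> + 1))"
  define \<delta> where "\<delta> n = \<delta>0 * inverse (real (Suc n))" for n
  have \<delta>0: "\<delta>0 > 0" "\<delta>0 \<le> hS" "\<delta>0 \<le> 1" "\<delta>0 \<le> 1 / (\<Lambda> + 1)" using hS \<Lambda>0 by (auto simp: \<delta>0_def)
  have \<delta>n: "\<delta> n > 0" "\<delta> n \<le> \<delta>0" for n
    using \<delta>0(1) mult_left_mono[of "inverse (real (Suc n))" 1 \<delta>0] by (auto simp: \<delta>_def inverse_le_1_iff)
  have \<delta>\<Lambda>: "\<delta> n * \<Lambda> \<le> 1" for n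
  proof -
    have "\<delta> n * \<Lambda> \<le> 1 / (\<Lambda> + 1) * \<Lambda>" using \<delta>n(2)[of n] \<delta>0(4) \<Lambda>0 by (intro mult_right_mono) auto
    also have "\<dots> \<le> 1" using \<Lambda>0 by simp
    finally show ?thesis .
  qed
  have disc: "time_discretization T A lam b ell g ahat L La Lb B hS c \<Lambda> KH MH (\<delta> n) a0" for n
  proof unfold_locales
    show "0 \<le> c" using c1(1) c2(1) c3(1) by (simp add: c_def)
    show "\<bar>g d x\<bar> \<le> c" if "x \<in> \<S>" for d x
      using c1(2)[OF that, of d] c2(1) c3(1) by (simp add: c_def)
    show "- c \<le> ell t d a x" if "t \<in> {0..T}" "a \<in> A" "x \<in> \<S>" for t d a x
    proof -
      have "- c2 \<le> min_hamiltonian t d x 0" using c2(2)[of "(t, x, 0)" d] that by (simp add: abs_le_iff)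
      also have "\<dots> \<le> hamiltonian t d x 0 a" by (rule min_hamiltonian_le[OF that(1,3,2)])
      finally show ?thesis using c1(1) c3(1) by (simp add: jump_hamiltonian_def c_def)
    qed
    show "ell t d a0 x \<le> c" if "t \<in> {0..T}" "x \<in> \<S>" for t d x
      using c3(2)[of "(t, x)" d] that c1(1) c2(1) by (simp add: c_def)
    show "(\<Sum>d'\<in>UNIV - {d}. lam t d d' a0 x) \<le> \<Lambda>" if "t \<in> {0..T}" "x \<in> \<S>" for t d x
      using \<Lambda>1(2)[of "(t, x)" d] that \<Lambda>2(1) by (simp add: \<Lambda>_def)
    show "(\<Sum>d'\<in>UNIV - {d}. lam t d d' (ahat t d x v) x) \<le> \<Lambda>"
      if "t \<in> {0..T}" "x \<in> \<S>" "norm v \<le> ?R" for t d x v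
      using \<Lambda>2(2)[of "(t, x, v)" d] that \<Lambda>1(1) by (simp add: \<Lambda>_def)
    show "\<bar>min_hamiltonian t d x v\<bar> \<le> MH" if "t \<in> {0..T}" "x \<in> \<S>" "norm v \<le> ?R" for t d x v
      using MH[of "(t, x, v)" d] that by simp
    show "0 < \<delta> n" "\<delta> n \<le> hS" "\<delta> n \<le> 1" "\<delta> n * \<Lambda> \<le> 1"
      using \<delta>n[of n] \<delta>0 \<delta>\<Lambda>[of n] by auto
  qed (use a0 KH in auto)
  interpret D: time_discretization T A lam b ell g ahat L La Lb B hS c \<Lambda> KH MH "\<delta> n" a0 for n
    by (rule disc)
  let ?dom = "{0..T} \<times> (\<S> :: (real^'m) set)"
  define f where "f n i = (if fst i \<in> ?dom then D.v n (fst (fst i)) (snd (fst i)) $ snd i else 0)"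
    for n and i :: "(real \<times> (real^'m)) \<times> 'd"
  have c0: "0 \<le> c + c * T" using c1(1) c2(1) c3(1) T_pos by (simp add: c_def)
  have fb: "\<bar>f n i\<bar> \<le> c + c * T" for n i
    unfolding f_def using c0 D.v_bound by (auto simp: mem_Times_iff)
  obtain G u where G: "G \<noteq> bot" "G \<le> sequentially" and fu: "\<And>i. ((\<lambda>n. f n i) \<longlongrightarrow> u i) G"
    and ub: "\<And>i. \<bar>u i\<bar> \<le> c + c * T"
    by (rule pointwise_limit_along_filter[where f = f and C = "c + c * T", OF fb]) blast
  define U where "U t d x = u ((t, x), d)" for t d x
  have wU: "((\<lambda>n. D.v n t x $ d) \<longlongrightarrow> U t d x) G" if "t \<in> {0..T}" "x \<in> \<S>" for t x d
    using fu[of "((t, x), d)"] that by (simp add: f_def U_def)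
  have "\<delta> \<longlonglongrightarrow> \<delta>0 * 0"
    unfolding \<delta>_def by (intro tendsto_mult tendsto_const LIMSEQ_inverse_real_of_nat)
  then have \<delta>lim: "(\<delta> \<longlongrightarrow> 0) G" using G(2) by (auto intro: tendsto_mono)
  have lip: "\<bar>U t d x - U t' d x'\<bar> \<le> D.Kx * norm (x - x') + D.Kt * (\<bar>t - t'\<bar> + 0)"
    if "t \<in> {0..T}" "t' \<in> {0..T}" "x \<in> \<S>" "x' \<in> \<S>" for t x t' x' d
  proof (rule tendsto_le[OF G(1)])
    show "((\<lambda>n. \<bar>D.v n t x $ d - D.v n t' x' $ d\<bar>) \<longlongrightarrow> \<bar>U t d x - U t' d x'\<bar>) G"
      using that by (intro tendsto_rabs tendsto_diff wU)
    show "((\<lambda>n. D.Kx * norm (x - x') + D.Kt * (\<bar>t - t'\<bar> + \<delta> n)) \<longlongrightarrow> D.Kx * norm (x - x') + D.Kt * (\<bar>t - t'\<bar> + 0)) G"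
      by (intro tendsto_add tendsto_mult tendsto_const \<delta>lim)
    show "\<forall>\<^sub>F n in G. \<bar>D.v n t x $ d - D.v n t' x' $ d\<bar> \<le> D.Kx * norm (x - x') + D.Kt * (\<bar>t - t'\<bar> + \<delta> n)"
      using D.v_lipschitz[OF that] by (intro always_eventually allI)
  qed
  have ham: "((\<lambda>n. min_hamiltonian t d x (D.v n t x)) \<longlongrightarrow> min_hamiltonian t d x (\<chi> d'. U t d' x)) G"
    if t: "t \<in> {0..T}" and x: "x \<in> \<S>" for t d x
  proof -
    let ?f = "\<lambda>p. min_hamiltonian (fst p) d (fst (snd p)) (snd (snd p))"
    have "((\<lambda>n. D.v n t x) \<longlongrightarrow> (\<chi> d'. U t d' x)) G"
      by (rule vec_tendstoI) (simp add: wU[OF t x])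
    then have "((\<lambda>n. (t, x, D.v n t x)) \<longlongrightarrow> (t, x, (\<chi> d'. U t d' x))) G"
      by (intro tendsto_Pair tendsto_const)
    moreover have "(t, x, D.v n t x) \<in> slab ?R" for n
      using t x norm_vec_le[of "D.v n t x" "c + c * T", OF D.v_bound[OF t x]] by simp
    moreover have "(t, x, (\<chi> d'. U t d' x)) \<in> slab ?R"
      using t x norm_vec_le[of "\<chi> d'. U t d' x" "c + c * T"] ub by (simp add: U_def)
    ultimately have "((\<lambda>n. ?f (t, x, D.v n t x)) \<longlongrightarrow> ?f (t, x, (\<chi> d'. U t d' x))) G"
      by (intro continuous_on_tendsto_compose[OF lipschitz_on_continuous_on[OF KH]] always_eventually allI) auto
    then show ?thesis by simp
  qed
  have cons: "\<bar>U t d x - U (t + h) d (x + h *\<^sub>R b t d x) - h * min_hamiltonian t d x (\<chi> d'. U t d' x)\<bar> \<le> D.K3 * h\<^sup>2"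
    if h: "0 < h" "h < hS" and th: "t \<in> {0..T - h}" and x: "x \<in> \<S>" for t h d x
  proof -
    have t: "t \<in> {0..T}" and t': "t + h \<in> {0..T}" using th h by auto
    have y: "x + h *\<^sub>R b t d x \<in> \<S>" using h by (intro flow_in_simplex[OF t x]) auto
    have "\<bar>U t d x - U (t + h) d (x + h *\<^sub>R b t d x) - h * min_hamiltonian t d x (\<chi> d'. U t d' x)\<bar>
        \<le> D.K3 * (h + 0)\<^sup>2 + (D.Kx * (B + T * Lb) + MH + T * KH) * 0"
    proof (rule tendsto_le[OF G(1)])
      show "((\<lambda>n. \<bar>D.v n t x $ d - D.v n (t + h) (x + h *\<^sub>R b t d x) $ d - h * min_hamiltonian t d x (D.v n t x)\<bar>)
          \<longlongrightarrow> \<bar>U t d x - U (t + h) d (x + h *\<^sub>R b t d x) - h * min_hamiltonian t d x (\<chi> d'. U t d' x)\<bar>) G"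
        by (intro tendsto_rabs tendsto_diff tendsto_mult tendsto_const wU ham t t' x y)
      show "((\<lambda>n. D.K3 * (h + \<delta> n)\<^sup>2 + (D.Kx * (B + T * Lb) + MH + T * KH) * \<delta> n) \<longlongrightarrow> D.K3 * (h + 0)\<^sup>2 + (D.Kx * (B + T * Lb) + MH + T * KH) * 0) G"
        by (intro tendsto_add tendsto_mult tendsto_power tendsto_const \<delta>lim)
      have "\<forall>\<^sub>F n in G. \<delta> n < hS - h" using \<delta>lim h by (intro order_tendstoD) auto
      then show "\<forall>\<^sub>F n in G. \<bar>D.v n t x $ d - D.v n (t + h) (x + h *\<^sub>R b t d x) $ d - h * min_hamiltonian t d x (D.v n t x)\<bar>
          \<le> D.K3 * (h + \<delta> n)\<^sup>2 + (D.Kx * (B + T * Lb) + MH + T * KH) * \<delta> n"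
        by eventually_elim (use h in \<open>intro D.v_consistent th x, auto\<close>)
    qed
    then show ?thesis by simp
  qed
  show ?thesis
  proof (rule that)
    fix d
    show "(D.Kx + D.Kt)-lipschitz_on ({0..T} \<times> \<S>) (\<lambda>(t, x). U t d x)"
    proof (rule lipschitz_onI)
      fix p p' :: "real \<times> (real^'m)" assume p: "p \<in> ?dom" and p': "p' \<in> ?dom"
      have "\<bar>U (fst p) d (snd p) - U (fst p') d (snd p')\<bar> \<le> D.Kx * dist (snd p) (snd p') + D.Kt * dist (fst p) (fst p')"
        using lip[of "fst p" "fst p'" "snd p" "snd p'" d] p p' by (auto simp: mem_Times_iff dist_norm)
      also have "\<dots> \<le> D.Kx * dist p p' + D.Kt * dist p p'"
        by (intro add_mono mult_left_mono dist_fst_le dist_snd_le D.Kx_nonneg D.Kt_nonneg)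
      finally show "dist (case p of (t, x) \<Rightarrow> U t d x) (case p' of (t, x) \<Rightarrow> U t d x) \<le> (D.Kx + D.Kt) * dist p p'"
        by (simp add: case_prod_unfold dist_real_def distrib_right)
    qed (use D.Kx_nonneg D.Kt_nonneg in simp)
  next
    fix d x assume x: "x \<in> (\<S> :: (real^'m) set)"
    have "((\<lambda>n. g d x) \<longlongrightarrow> U T d x) G" using wU[of T x d] x T_pos by (simp add: D.v_terminal)
    then show "U T d x = g d x" using tendsto_unique[OF G(1) _ tendsto_const] by blast
  next
    show "derivative_along_flow T b U (\<lambda>t d x. - min_hamiltonian t d x (\<chi> d'. U t d' x))"
      unfolding derivative_along_flow_def
    proof (intro allI impI)
      fix e :: real assume e: "e > 0"
      let ?h0 = "min hS (e / (\<bar>D.K3\<bar> + 1))"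
      have "\<bar>U (t + h) d (x + h *\<^sub>R b t d x) - U t d x - h * (- min_hamiltonian t d x (\<chi> d'. U t d' x))\<bar> \<le> e * h"
        if h: "0 < h" "h < ?h0" and "t \<in> {0..T - h}" "x \<in> \<S>" for h t d x
      proof -
        have "\<bar>U t d x - U (t + h) d (x + h *\<^sub>R b t d x) - h * min_hamiltonian t d x (\<chi> d'. U t d' x)\<bar> \<le> D.K3 * h\<^sup>2"
          using that by (intro cons) auto
        also have "\<dots> \<le> ((\<bar>D.K3\<bar> + 1) * h) * h"
          unfolding power2_eq_square mult.assoc using h by (intro mult_right_mono) auto
        also have "\<dots> \<le> e * h"
        proof (rule mult_right_mono)
          have "h \<le> e / (\<bar>D.K3\<bar> + 1)" using h by simp
          then show "(\<bar>D.K3\<bar> + 1) * h \<le> e" by (simp add: pos_le_divide_eq mult.commute)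
        qed (use h in simp)
        finally show ?thesis by (simp add: abs_le_iff)
      qed
      moreover have "?h0 > 0" using hS e by simp
      ultimately show "\<exists>h0>0. \<forall>h. 0 < h \<and> h < h0 \<longrightarrow> (\<forall>t\<in>{0..T - h}. \<forall>d. \<forall>x\<in>\<S>.
          \<bar>U (t + h) d (x + h *\<^sub>R b t d x) - U t d x - h * (- min_hamiltonian t d x (\<chi> d'. U t d' x))\<bar> \<le> e * h)"
        by blast
    qed
  qed
qed

end

section \<open>Verification: the minimizing feedback is the unique best response\<close>

context markov
begin

lemma mean_right_continuous:
  assumes v: "continuous_on_states T v" and s: "s \<in> {0..<T}" and x: "x \<in> \<S>"
  shows "(mean s (d, x) v \<longlongrightarrow> v s d x) (at_right s)"
proof -
  let ?z = "(d, x)"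
  have s0: "s \<in> {0..T}" using s by auto
  have z: "?z \<in> state_set" using x by (simp add: state_set_def)
  interpret prob_space "law Y s ?z" by (rule law_prob_space[OF s0 z])
  obtain M where M: "M \<ge> 0" "\<And>t d x. t \<in> {0..T} \<Longrightarrow> x \<in> \<S> \<Longrightarrow> \<bar>v t d x\<bar> \<le> M"
    by (rule continuous_on_states_bounded[OF v]) blast
  show ?thesis
    unfolding tendsto_at_iff_sequentially
  proof (intro allI impI)
    fix X :: "nat \<Rightarrow> real" assume X: "\<forall>i. X i \<in> {s<..} - {s}" and lim: "X \<longlonglongrightarrow> s"
    (* There is no path after time T, so the sequence of times is cut off there. *)
    define X' where "X' i = min (X i) T" for i
    have X': "X' i \<in> {s<..T}" for i using X s by (auto simp: X'_def)
    have X'0: "X' i \<in> {0..T}" for i using X'[of i] s by auto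
    have ev: "\<forall>\<^sub>F i in sequentially. X' i = X i"
    proof -
      have "\<forall>\<^sub>F i in sequentially. X i < T" using lim s by (intro order_tendstoD) auto
      then show ?thesis by eventually_elim (simp add: X'_def)
    qed
    have "X' \<longlonglongrightarrow> s"
      by (rule Lim_transform_eventually[OF lim]) (use ev in eventually_elim, simp)
    then have filt: "filterlim X' (at_right s) sequentially"
      unfolding filterlim_at using X' by (auto intro!: always_eventually simp: less_imp_neq[symmetric])
    have "(\<lambda>i. mean s ?z v (X' i)) \<longlonglongrightarrow> mean s ?z v s"
      unfolding mean_def
    proof (rule integral_dominated_convergence)
      show "integrable (law Y s ?z) (\<lambda>_. M)" by simp
      show "AE \<omega> in law Y s ?z. (\<lambda>i. on_path v (X' i) \<omega>)
          \<longlonglongrightarrow> on_path v s \<omega>"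
      proof (rule AE_I2)
        fix \<omega> assume "\<omega> \<in> space (law Y s ?z)"
        then have "\<omega> \<in> space (outcomes Y)" by (simp add: space_law[OF s0 z])
        from filterlim_compose[OF path_function_right_continuous[OF v s this] filt]
        show "(\<lambda>i. on_path v (X' i) \<omega>)
          \<longlonglongrightarrow> on_path v s \<omega>" .
      qed
      show "AE \<omega> in law Y s ?z. norm (on_path v (X' i) \<omega>) \<le> M" for i
      proof (rule AE_I2)
        fix \<omega> assume "\<omega> \<in> space (law Y s ?z)"
        then have "\<omega> \<in> space (outcomes Y)" by (simp add: space_law[OF s0 z])
        from M(2)[OF X'0 traj_snd_simplex[OF X'0 this]]
        show "norm (on_path v (X' i) \<omega>) \<le> M" by simp
      qed
    qed (rule path_function_measurable[OF v s0 z s0] path_function_measurable[OF v s0 z X'0])+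
    then have "(\<lambda>i. mean s ?z v (X' i)) \<longlonglongrightarrow> v s d x" by (simp only: mean_start[OF s0 x v])
    then show "(mean s ?z v \<circ> X) \<longlonglongrightarrow> v s d x"
      by (rule Lim_transform_eventually) (use ev in eventually_elim, simp)
  qed
qed

lemma mean_nonneg:
  assumes "continuous_on_states T v" "s \<in> {0..T}" "z \<in> state_set" "r \<in> {0..T}"
    and "\<And>d x. x \<in> \<S> \<Longrightarrow> 0 \<le> v r d x"
  shows "0 \<le> mean s z v r"
  using mean_mono[OF continuous_on_states_const[where c = "\<lambda>_. 0"] assms] by (simp only: mean_const[OF assms(2,3)])

text \<open>Since the paths are right-continuous, a nonnegative running reward with vanishing expected total
  vanishes at the starting point.\<close>

lemma zero_integral_imp_zero:
  assumes v: "continuous_on_states T v" and s: "s \<in> {0..<T}" and x: "x \<in> \<S>"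
    and nonneg: "\<And>t d x. t \<in> {0..T} \<Longrightarrow> x \<in> \<S> \<Longrightarrow> 0 \<le> v t d x"
    and zero: "(LINT q:{s..T}|lborel. mean s (d, x) v q) = 0"
  shows "v s d x = 0"
proof (rule ccontr)
  assume "v s d x \<noteq> 0"
  have s0: "s \<in> {0..T}" and sT: "T \<in> {s..T}" using s by auto
  have z: "(d, x) \<in> state_set" using x by (simp add: state_set_def)
  define \<eta> where "\<eta> = v s d x / 2"
  have \<eta>: "\<eta> > 0" using nonneg[OF s0 x, of d] \<open>v s d x \<noteq> 0\<close> by (simp add: \<eta>_def)
  then have "\<eta> < v s d x" by (simp add: \<eta>_def)
  then have "\<forall>\<^sub>F q in at_right s. \<eta> < mean s (d, x) v q"
    by (rule order_tendstoD(1)[OF mean_right_continuous[OF v s x]])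
  then obtain r where r: "r > s" "\<And>q. s < q \<Longrightarrow> q < r \<Longrightarrow> \<eta> < mean s (d, x) v q"
    unfolding eventually_at_right_field by blast
  define p where "p = min r T"
  have p: "s < p" "p \<le> T" "p \<le> r" using r s by (auto simp: p_def)
  have "\<eta> * (p - s) = (LINT q:{s..T}|lborel. \<eta> * indicator {s<..<p} q)"
  proof -
    have "(LINT q:{s..T}|lborel. \<eta> * indicator {s<..<p} q) = (LINT q|lborel. \<eta> * indicator {s<..<p} q)"
      unfolding set_lebesgue_integral_def using p
      by (intro Bochner_Integration.integral_cong) (auto simp: indicator_def)
    also have "\<dots> = \<eta> * (p - s)" using p by simp
    finally show ?thesis ..
  qed
  also have "\<dots> \<le> (LINT q:{s..T}|lborel. mean s (d, x) v q)"
  proof (rule set_integral_mono[OF _ mean_time_integral(1)[OF v s0 z sT]])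
    have "integrable lborel (\<lambda>q. \<eta> * indicator {s<..<p} q :: real)"
      using p by (intro integrable_mult_right integrable_real_indicator) auto
    moreover have "(\<lambda>q. \<eta> * indicator {s<..<p} q :: real) = (\<lambda>q. indicator {s..T} q *\<^sub>R (\<eta> * indicator {s<..<p} q))"
      using p by (auto simp: indicator_def fun_eq_iff)
    ultimately show "set_integrable lborel {s..T} (\<lambda>q. \<eta> * indicator {s<..<p} q)"
      unfolding set_integrable_def by simp
    fix q assume q: "q \<in> {s..T}"
    have "0 \<le> mean s (d, x) v q"
      using q s by (intro mean_nonneg[OF v s0 z] nonneg) auto
    then show "\<eta> * indicator {s<..<p} q \<le> mean s (d, x) v q"
      using r(2)[of q] p \<eta> by (cases "q \<in> {s<..<p}") (auto simp: less_imp_le)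
  qed
  finally have "\<eta> * (p - s) \<le> 0" by (simp add: zero)
  then show False using \<eta> p by (simp add: mult_le_0_iff)
qed

end

lemma is_lipschitz_vec_lambda:
  fixes f :: "'d::finite \<Rightarrow> 'p::metric_space \<Rightarrow> real"
  assumes "\<And>d. is_lipschitz D (f d)"
  shows "is_lipschitz D (\<lambda>p. \<chi> d. f d p)"
proof -
  obtain K where K: "K \<ge> 0" "\<And>d. K-lipschitz_on D (f d)"
    by (rule is_lipschitz_uniform[where f = f, OF assms]) blast
  have "(real CARD('d) * K)-lipschitz_on D (\<lambda>p. \<chi> d. f d p)"
  proof (rule lipschitz_onI)
    fix p q assume "p \<in> D" "q \<in> D"
    then have "\<bar>f d p - f d q\<bar> \<le> K * dist p q" for d
      using lipschitz_onD[OF K(2)] by (simp add: dist_real_def)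
    then show "dist (\<chi> d. f d p) (\<chi> d. f d q) \<le> real CARD('d) * K * dist p q"
      unfolding dist_norm mult.assoc by (intro norm_vec_le) simp
  qed (use K in simp)
  then show ?thesis by (auto simp: is_lipschitz_def)
qed

lemma continuous_on_states_is_lipschitz:
  assumes "\<And>d. is_lipschitz ({0..T} \<times> \<S>) (\<lambda>p. v (fst p) d (snd p))"
  shows "continuous_on_states T v"
proof -
  have "continuous_on ({0..T} \<times> \<S>) (\<lambda>(t, x). v t d x)" for d
  proof -
    obtain K where "K-lipschitz_on ({0..T} \<times> \<S>) (\<lambda>p. v (fst p) d (snd p))"
      using assms[of d] unfolding is_lipschitz_def by blast
    then show ?thesis by (simp add: case_prod_unfold lipschitz_on_continuous_on)
  qed
  then show ?thesis by (simp add: continuous_on_states_def)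
qed

definition admissible_feedback ::
  "real \<Rightarrow> 'a::real_normed_vector set \<Rightarrow> (real \<Rightarrow> 'd \<Rightarrow> real^'m::finite \<Rightarrow> 'a) \<Rightarrow> bool" where
  "admissible_feedback T A \<psi> \<longleftrightarrow> (\<forall>t\<in>{0..T}. \<forall>d. \<forall>x\<in>\<S>. \<psi> t d x \<in> A) \<and>
     (\<exists>K. \<forall>d. K-lipschitz_on ({0..T} \<times> \<S>) (\<lambda>(t, x). \<psi> t d x))"

locale optimal_control = control_problem T A lam b ell g ahat L La Lb B hS
  for T :: real and A :: "'a::real_normed_vector set"
    and lam :: "real \<Rightarrow> 'd::finite \<Rightarrow> 'd \<Rightarrow> 'a \<Rightarrow> real^'m::finite \<Rightarrow> real"
    and b ell g ahat L La Lb B hS +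
  fixes Y :: "(real \<Rightarrow> 'd \<Rightarrow> real^'m \<Rightarrow> 'a) \<Rightarrow> ('w, 'd \<times> (real^'m)) process"
  assumes Y_markov: "\<And>\<psi>. admissible_feedback T A \<psi> \<Longrightarrow> markov_process T (Y \<psi>)"
    and Y_generator: "\<And>\<psi>. admissible_feedback T A \<psi> \<Longrightarrow>
          has_generator T (Y \<psi>) (jump_flow_generator (\<lambda>t d d' x. lam t d d' (\<psi> t d x) x) b)"
    and ahat_unique: "\<And>t d x v a. t \<in> {0..T} \<Longrightarrow> x \<in> \<S> \<Longrightarrow> a \<in> A \<Longrightarrow>
          jump_hamiltonian lam ell t d x v a \<le> jump_hamiltonian lam ell t d x v (ahat t d x v) \<Longrightarrow>
          a = ahat t d x v"
begin

abbreviation admissible :: "(real \<Rightarrow> 'd \<Rightarrow> real^'m \<Rightarrow> 'a) \<Rightarrow> bool" where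
  "admissible \<equiv> admissible_feedback T A"

definition cost :: "(real \<Rightarrow> 'd \<Rightarrow> real^'m \<Rightarrow> 'a) \<Rightarrow> real \<Rightarrow> 'd \<Rightarrow> real^'m \<Rightarrow> real" where
  "cost \<psi> t d x = (\<integral>\<omega>. (LINT s:{t..T}|lborel. ell s (fst (traj (Y \<psi>) s \<omega>))
        (\<psi> s (fst (traj (Y \<psi>) s \<omega>)) (snd (traj (Y \<psi>) s \<omega>))) (snd (traj (Y \<psi>) s \<omega>)))
      + g (fst (traj (Y \<psi>) T \<omega>)) (snd (traj (Y \<psi>) T \<omega>)) \<partial>law (Y \<psi>) t (d, x))"

definition optimal_value :: "real \<Rightarrow> 'd \<Rightarrow> real^'m \<Rightarrow> real" where
  "optimal_value t d x = (INF \<psi>\<in>{\<psi>. admissible \<psi>}. cost \<psi> t d x)"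

lemma feedback_lipschitz:
  fixes \<phi> :: "real \<Rightarrow> 'a \<Rightarrow> real^'m \<Rightarrow> real"
  assumes \<psi>: "admissible \<psi>"
    and \<phi>: "L-lipschitz_on ({0..T} \<times> A \<times> \<S>) (\<lambda>(t, a, x). \<phi> t a x)"
  shows "is_lipschitz ({0..T} \<times> \<S>) (\<lambda>p. \<phi> (fst p) (\<psi> (fst p) d (snd p)) (snd p))"
proof (rule control_substitution_lipschitz[OF \<phi> is_lipschitz_fst _ is_lipschitz_snd])
  show "is_lipschitz ({0..T} \<times> \<S>) (\<lambda>p. \<psi> (fst p) d (snd p))"
    using \<psi> by (auto simp: is_lipschitz_def admissible_feedback_def case_prod_unfold)
qed (use \<psi> in \<open>auto simp: admissible_feedback_def\<close>)

lemma controlled_rates_continuous: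
  assumes "admissible \<psi>"
  shows "continuous_on_states T (\<lambda>t d x. lam t d d' (\<psi> t d x) x)"
  by (intro continuous_on_states_is_lipschitz feedback_lipschitz[OF assms lam_lipschitz])

lemma controlled_jump_flow:
  assumes \<psi>: "admissible \<psi>"
  obtains \<Lambda> where "jump_flow T (Y \<psi>) (\<lambda>t d d' x. lam t d d' (\<psi> t d x) x) b Lb B \<Lambda> hS"
proof -
  have bd: "bounded ({0..T} \<times> (\<S> :: (real^'m) set))"
    using compact_imp_bounded[OF compact_simplex_coords] by (intro bounded_Times) auto
  obtain \<Lambda> where \<Lambda>: "\<And>dd p. p \<in> {0..T} \<times> \<S> \<Longrightarrow>
      \<bar>lam (fst p) (fst dd) (snd dd) (\<psi> (fst p) (fst dd) (snd p)) (snd p)\<bar> \<le> \<Lambda>"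
    by (rule bounded_uniformly[where f = "\<lambda>dd p. lam (fst p) (fst dd) (snd dd) (\<psi> (fst p) (fst dd) (snd p)) (snd p)",
          OF feedback_lipschitz[OF \<psi> lam_lipschitz] bd]) blast
  have "jump_flow T (Y \<psi>) (\<lambda>t d d' x. lam t d d' (\<psi> t d x) x) b Lb B \<Lambda> hS"
  proof
    show "\<bar>lam t d d' (\<psi> t d x) x\<bar> \<le> \<Lambda>" if "t \<in> {0..T}" "x \<in> \<S>" for t d d' x
      using \<Lambda>[of "(t, x)" "(d, d')"] that by simp
  qed (use Y_markov[OF \<psi>] Y_generator[OF \<psi>] T_pos b_lipschitz b_bound hS flow_in_simplex
      controlled_rates_continuous[OF \<psi>] in auto)
  then show ?thesis by (rule that)
qed

end

locale verification = optimal_control T A lam b ell g ahat L La Lb B hS Y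
  for T :: real and A :: "'a::real_normed_vector set"
    and lam :: "real \<Rightarrow> 'd::finite \<Rightarrow> 'd \<Rightarrow> 'a \<Rightarrow> real^'m::finite \<Rightarrow> real"
    and b ell g ahat L La Lb B hS and Y :: "(real \<Rightarrow> 'd \<Rightarrow> real^'m \<Rightarrow> 'a) \<Rightarrow> ('w, 'd \<times> (real^'m)) process" +
  fixes u :: "real \<Rightarrow> 'd \<Rightarrow> real^'m \<Rightarrow> real" and K :: real
  assumes u_lipschitz: "\<And>d. K-lipschitz_on ({0..T} \<times> \<S>) (\<lambda>(t, x). u t d x)"
    and u_terminal: "\<And>d x. x \<in> \<S> \<Longrightarrow> u T d x = g d x"
    and u_flow: "derivative_along_flow T b u (\<lambda>t d x. - min_hamiltonian t d x (\<chi> d'. u t d' x))"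
begin

definition gap :: "(real \<Rightarrow> 'd \<Rightarrow> real^'m \<Rightarrow> 'a) \<Rightarrow> real \<Rightarrow> 'd \<Rightarrow> real^'m \<Rightarrow> real" where
  "gap \<psi> t d x = hamiltonian t d x (\<chi> d'. u t d' x) (\<psi> t d x) - min_hamiltonian t d x (\<chi> d'. u t d' x)"

definition drift :: "(real \<Rightarrow> 'd \<Rightarrow> real^'m \<Rightarrow> 'a) \<Rightarrow> real \<Rightarrow> 'd \<Rightarrow> real^'m \<Rightarrow> real" where
  "drift \<psi> t d x = - min_hamiltonian t d x (\<chi> d'. u t d' x)
     + (\<Sum>d'\<in>UNIV - {d}. (u t d' x - u t d x) * lam t d d' (\<psi> t d x) x)"

definition running :: "(real \<Rightarrow> 'd \<Rightarrow> real^'m \<Rightarrow> 'a) \<Rightarrow> real \<Rightarrow> 'd \<Rightarrow> real^'m \<Rightarrow> real" where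
  "running \<psi> t d x = ell t d (\<psi> t d x) x"

lemma gap_eq: "gap \<psi> t d x = drift \<psi> t d x + running \<psi> t d x"
  by (simp add: gap_def drift_def running_def jump_hamiltonian_def)

lemma u_is_lipschitz: "is_lipschitz ({0..T} \<times> \<S>) (\<lambda>p. u (fst p) d (snd p))"
  using u_lipschitz[of d] by (auto simp: is_lipschitz_def case_prod_unfold)

lemma u_continuous: "continuous_on_states T u"
  by (rule continuous_on_states_is_lipschitz[OF u_is_lipschitz])

lemma u_slab:
  obtains R where "\<And>t x. t \<in> {0..T} \<Longrightarrow> x \<in> \<S> \<Longrightarrow> (t, x, \<chi> d'. u t d' x) \<in> slab R"
proof -
  obtain M where M: "\<And>t d x. t \<in> {0..T} \<Longrightarrow> x \<in> \<S> \<Longrightarrow> \<bar>u t d x\<bar> \<le> M"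
    by (rule continuous_on_states_bounded[OF u_continuous]) blast
  show ?thesis
    by (rule that[of "real CARD('d) * M"]) (use M in \<open>auto intro!: norm_vec_le\<close>)
qed

lemma u_graph_lipschitz:
  "is_lipschitz ({0..T} \<times> \<S>) (\<lambda>p. (fst p, snd p, \<chi> d'. u (fst p) d' (snd p)))"
  by (intro is_lipschitz_Pair is_lipschitz_fst is_lipschitz_snd is_lipschitz_vec_lambda u_is_lipschitz)

lemma min_hamiltonian_u_continuous:
  "continuous_on_states T (\<lambda>t d x. min_hamiltonian t d x (\<chi> d'. u t d' x))"
proof (rule continuous_on_states_is_lipschitz)
  fix d
  obtain R where R: "\<And>t x. t \<in> {0..T} \<Longrightarrow> x \<in> \<S> \<Longrightarrow> (t, x, \<chi> d'. u t d' x) \<in> slab R"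
    by (rule u_slab) blast
  have "is_lipschitz ({0..T} \<times> \<S>)
      (\<lambda>p. (\<lambda>p. min_hamiltonian (fst p) d (fst (snd p)) (snd (snd p))) (fst p, snd p, \<chi> d'. u (fst p) d' (snd p)))"
    by (rule is_lipschitz_compose[OF min_hamiltonian_lipschitz[where R = R] u_graph_lipschitz])
      (use R in \<open>auto simp: image_subset_iff\<close>)
  then show "is_lipschitz ({0..T} \<times> \<S>) (\<lambda>p. min_hamiltonian (fst p) d (snd p) (\<chi> d'. u (fst p) d' (snd p)))"
    by simp
qed

lemma running_continuous: "admissible \<psi> \<Longrightarrow> continuous_on_states T (running \<psi>)"
  unfolding running_def
  by (intro continuous_on_states_is_lipschitz feedback_lipschitz[OF _ ell_lipschitz])

lemma drift_continuous:
  assumes "admissible \<psi>" shows "continuous_on_states T (drift \<psi>)"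
proof -
  have "continuous_on_states T (\<lambda>t d x. (0 - min_hamiltonian t d x (\<chi> d'. u t d' x))
     + (\<Sum>d'\<in>UNIV - {d}. (u t d' x - u t d x) * lam t d d' (\<psi> t d x) x))"
  proof (rule continuous_on_states_add[OF continuous_on_states_diff[OF continuous_on_states_const min_hamiltonian_u_continuous]])
    show "continuous_on_states T (\<lambda>t d x. \<Sum>d'\<in>UNIV - {d}. (u t d' x - u t d x) * lam t d d' (\<psi> t d x) x)"
      by (rule continuous_on_states_jumps[OF u_continuous controlled_rates_continuous[OF assms]])
  qed
  then show ?thesis unfolding drift_def[abs_def] by simp
qed

lemma gap_continuous: "admissible \<psi> \<Longrightarrow> continuous_on_states T (gap \<psi>)"
  unfolding gap_eq[abs_def] by (intro continuous_on_states_add drift_continuous running_continuous)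

lemma gap_nonneg: "admissible \<psi> \<Longrightarrow> t \<in> {0..T} \<Longrightarrow> x \<in> \<S> \<Longrightarrow> 0 \<le> gap \<psi> t d x"
  unfolding gap_def using min_hamiltonian_le by (simp add: admissible_feedback_def)

lemma gap_zero_iff:
  assumes "admissible \<psi>" "t \<in> {0..T}" "x \<in> \<S>"
  shows "gap \<psi> t d x = 0 \<longleftrightarrow> \<psi> t d x = ahat t d x (\<chi> d'. u t d' x)"
proof
  assume "gap \<psi> t d x = 0"
  then have "hamiltonian t d x (\<chi> d'. u t d' x) (\<psi> t d x) \<le> min_hamiltonian t d x (\<chi> d'. u t d' x)"
    by (simp add: gap_def)
  then show "\<psi> t d x = ahat t d x (\<chi> d'. u t d' x)"
    unfolding min_hamiltonian_def using assms
    by (intro ahat_unique) (auto simp: admissible_feedback_def)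
qed (simp add: gap_def min_hamiltonian_def)

text \<open>Dynkin's formula for \<open>u\<close> turns the terminal cost into a running one; what remains of the cost
  above \<open>u\<close> is the expected excess of the Hamiltonian over its minimum.\<close>

theorem cost_eq:
  assumes \<psi>: "admissible \<psi>" and t: "t \<in> {0..T}" and x: "x \<in> \<S>"
  shows "cost \<psi> t d x = u t d x + (LINT s:{t..T}|lborel. markov.mean (Y \<psi>) t (d, x) (gap \<psi>) s)"
proof -
  obtain \<Lambda> where "jump_flow T (Y \<psi>) (\<lambda>t d d' x. lam t d d' (\<psi> t d x) x) b Lb B \<Lambda> hS"
    by (rule controlled_jump_flow[OF \<psi>])
  then interpret J: jump_flow T "Y \<psi>" "\<lambda>t d d' x. lam t d d' (\<psi> t d x) x" b Lb B \<Lambda> hS .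
  have z: "(d, x) \<in> state_set" using x by (simp add: state_set_def)
  have tT: "T \<in> {t..T}" and T0: "T \<in> {0..T}" using t by auto
  note cr = running_continuous[OF \<psi>] and cd = drift_continuous[OF \<psi>]
  have gen: "J.generates u (drift \<psi>)"
    unfolding drift_def[abs_def] by (rule J.generates_lipschitz[OF u_lipschitz u_flow])
  have terminal: "g (fst (traj (Y \<psi>) T \<omega>)) (snd (traj (Y \<psi>) T \<omega>)) = u T (fst (traj (Y \<psi>) T \<omega>)) (snd (traj (Y \<psi>) T \<omega>))"
    if "\<omega> \<in> space (law (Y \<psi>) t (d, x))" for \<omega>
    using that u_terminal[OF J.traj_snd_simplex[OF T0]] by (simp add: J.space_law[OF t z])
  have "cost \<psi> t d x = (\<integral>\<omega>. (LINT s:{t..T}|lborel. running \<psi> s (fst (traj (Y \<psi>) s \<omega>)) (snd (traj (Y \<psi>) s \<omega>)))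
      + u T (fst (traj (Y \<psi>) T \<omega>)) (snd (traj (Y \<psi>) T \<omega>)) \<partial>law (Y \<psi>) t (d, x))"
    unfolding cost_def running_def
    by (rule Bochner_Integration.integral_cong) (simp_all add: terminal)
  also have "\<dots> = (LINT s:{t..T}|lborel. J.mean t (d, x) (running \<psi>) s) + J.mean t (d, x) u T"
    unfolding J.mean_time_integral(3)[OF cr t z tT, symmetric] J.mean_def[of t "(d, x)" u T]
    by (rule Bochner_Integration.integral_add[OF J.mean_time_integral(2)[OF cr t z tT]
          J.path_function_integrable[OF u_continuous t z T0]])
  also have "J.mean t (d, x) u T = u t d x + (LINT s:{t..T}|lborel. J.mean t (d, x) (drift \<psi>) s)"
    by (rule J.Dynkin[OF u_continuous cd gen t tT x])
  finally have "cost \<psi> t d x = u t d x + ((LINT s:{t..T}|lborel. J.mean t (d, x) (drift \<psi>) s)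
      + (LINT s:{t..T}|lborel. J.mean t (d, x) (running \<psi>) s))"
    by simp
  also have "(LINT s:{t..T}|lborel. J.mean t (d, x) (drift \<psi>) s) + (LINT s:{t..T}|lborel. J.mean t (d, x) (running \<psi>) s)
      = (LINT s:{t..T}|lborel. J.mean t (d, x) (drift \<psi>) s + J.mean t (d, x) (running \<psi>) s)"
    by (rule set_integral_add(2)[symmetric, OF J.mean_time_integral(1)[OF cd t z tT] J.mean_time_integral(1)[OF cr t z tT]])
  also have "\<dots> = (LINT s:{t..T}|lborel. J.mean t (d, x) (gap \<psi>) s)"
  proof (rule set_lebesgue_integral_cong)
    show "\<forall>s. s \<in> {t..T} \<longrightarrow> J.mean t (d, x) (drift \<psi>) s + J.mean t (d, x) (running \<psi>) s = J.mean t (d, x) (gap \<psi>) s"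
      unfolding gap_eq[abs_def] using t by (auto intro!: J.mean_add[symmetric] cd cr z)
  qed simp
  finally show ?thesis .
qed

lemma gap_integral_nonneg:
  assumes \<psi>: "admissible \<psi>" and t: "t \<in> {0..T}" and x: "x \<in> \<S>"
  shows "0 \<le> (LINT s:{t..T}|lborel. markov.mean (Y \<psi>) t (d, x) (gap \<psi>) s)"
proof -
  interpret J: markov T "Y \<psi>" by unfold_locales (rule Y_markov[OF \<psi>])
  have z: "(d, x) \<in> state_set" using x by (simp add: state_set_def)
  have "0 \<le> J.mean t (d, x) (gap \<psi>) s" if "s \<in> {t..T}" for s
    using that t by (intro J.mean_nonneg[OF gap_continuous[OF \<psi>] t z] gap_nonneg[OF \<psi>]) auto
  then show ?thesis
    unfolding set_lebesgue_integral_def by (intro Bochner_Integration.integral_nonneg) (auto simp: indicator_def)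
qed

lemma minimizer_admissible:
  assumes \<psi>: "\<And>t d x. t \<in> {0..T} \<Longrightarrow> x \<in> \<S> \<Longrightarrow> \<psi> t d x = ahat t d x (\<chi> d'. u t d' x)"
  shows "admissible \<psi>"
proof -
  have "is_lipschitz ({0..T} \<times> \<S>) (\<lambda>p. ahat (fst p) d (snd p) (\<chi> d'. u (fst p) d' (snd p)))" for d
  proof -
    have "is_lipschitz ({0..T} \<times> \<S> \<times> UNIV) (\<lambda>(t, x, v). ahat t d x v)"
      using ahat_lipschitz by (auto simp: is_lipschitz_def)
    then have "is_lipschitz ({0..T} \<times> \<S>) (\<lambda>p. (\<lambda>(t, x, v). ahat t d x v) (fst p, snd p, \<chi> d'. u (fst p) d' (snd p)))"
      by (rule is_lipschitz_compose[OF _ u_graph_lipschitz]) auto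
    then show ?thesis by simp
  qed
  then obtain K' where K': "\<And>d. K'-lipschitz_on ({0..T} \<times> \<S>) (\<lambda>p. ahat (fst p) d (snd p) (\<chi> d'. u (fst p) d' (snd p)))"
    using is_lipschitz_uniform[where f = "\<lambda>d p. ahat (fst p) d (snd p) (\<chi> d'. u (fst p) d' (snd p))" and D = "{0..T} \<times> \<S>"]
    by blast
  have "K'-lipschitz_on ({0..T} \<times> \<S>) (\<lambda>(t, x). \<psi> t d x)" for d
    by (rule lipschitz_on_transform[OF K'[of d]]) (auto simp: \<psi>)
  then show ?thesis using \<psi> ahat_in by (auto simp: admissible_feedback_def)
qed

lemma minimizer_cost:
  assumes \<psi>: "\<And>t d x. t \<in> {0..T} \<Longrightarrow> x \<in> \<S> \<Longrightarrow> \<psi> t d x = ahat t d x (\<chi> d'. u t d' x)"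
    and t: "t \<in> {0..T}" and x: "x \<in> \<S>"
  shows "cost \<psi> t d x = u t d x"
proof -
  have ad: "admissible \<psi>" by (rule minimizer_admissible[OF \<psi>])
  interpret J: markov T "Y \<psi>" by unfold_locales (rule Y_markov[OF ad])
  have z: "(d, x) \<in> state_set" using x by (simp add: state_set_def)
  have "J.mean t (d, x) (gap \<psi>) s = 0" if "s \<in> {t..T}" for s
  proof -
    have s: "s \<in> {0..T}" using that t by auto
    have "\<bar>J.mean t (d, x) (gap \<psi>) s\<bar> \<le> 0"
      by (rule J.mean_abs_le[OF t z s gap_continuous[OF ad]])
        (use gap_zero_iff[OF ad s] \<psi>[OF s] in simp)
    then show ?thesis by simp
  qed
  then have "(LINT s:{t..T}|lborel. J.mean t (d, x) (gap \<psi>) s) = (LINT s:{t..T}|lborel. 0)"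
    by (intro set_lebesgue_integral_cong) auto
  then show ?thesis using cost_eq[OF ad t x, of d] by simp
qed

lemma optimal_value_eq:
  assumes t: "t \<in> {0..T}" and x: "x \<in> \<S>"
  shows "optimal_value t d x = u t d x"
  unfolding optimal_value_def
proof (rule cInf_eq_minimum)
  let ?\<psi> = "\<lambda>t d x. ahat t d x (\<chi> d'. u t d' x)"
  have "cost ?\<psi> t d x = u t d x" by (rule minimizer_cost[OF _ t x]) simp
  moreover have "admissible ?\<psi>" by (rule minimizer_admissible) simp
  ultimately show "u t d x \<in> (\<lambda>\<psi>. cost \<psi> t d x) ` {\<psi>. admissible \<psi>}"
    by (intro image_eqI[of _ _ ?\<psi>]) auto
  fix r assume "r \<in> (\<lambda>\<psi>. cost \<psi> t d x) ` {\<psi>. admissible \<psi>}"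
  then obtain \<psi> where "admissible \<psi>" "r = cost \<psi> t d x" by auto
  then show "u t d x \<le> r" using cost_eq[OF _ t x, of \<psi> d] gap_integral_nonneg[OF _ t x, of \<psi> d] by simp
qed

text \<open>Before \<open>T\<close> the expected integral of the gap vanishes; no time is left to integrate over at \<open>T\<close> itself,
  where the gap vanishes by continuity.\<close>

lemma optimal_imp_minimizer:
  assumes \<psi>: "admissible \<psi>" and opt: "\<And>t d x. t \<in> {0..T} \<Longrightarrow> x \<in> \<S> \<Longrightarrow> cost \<psi> t d x = u t d x"
    and t: "t \<in> {0..T}" and x: "x \<in> \<S>"
  shows "\<psi> t d x = ahat t d x (\<chi> d'. u t d' x)"
proof -
  interpret J: markov T "Y \<psi>" by unfold_locales (rule Y_markov[OF \<psi>])
  note cg = gap_continuous[OF \<psi>]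
  have before: "gap \<psi> s d x = 0" if s: "s \<in> {0..<T}" for s
  proof (rule J.zero_integral_imp_zero[OF cg s x])
    show "(LINT q:{s..T}|lborel. J.mean s (d, x) (gap \<psi>) q) = 0"
      using cost_eq[OF \<psi> _ x, of s d] opt[OF _ x, of s d] s by simp
  qed (rule gap_nonneg[OF \<psi>])
  have "gap \<psi> t d x = 0"
  proof (cases "t = T")
    case True
    let ?s = "\<lambda>n. T - T * inverse (real (Suc n))"
    have s: "?s n \<in> {0..<T}" for n
      using T_pos mult_left_mono[of "inverse (real (Suc n))" 1 T] by (auto simp: inverse_le_1_iff)
    have "?s \<longlonglongrightarrow> T - T * 0"
      by (intro tendsto_diff tendsto_mult tendsto_const LIMSEQ_inverse_real_of_nat)
    then have "(\<lambda>n. (?s n, x)) \<longlonglongrightarrow> (T, x)" by (intro tendsto_Pair tendsto_const) simp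
    moreover have "continuous_on ({0..T} \<times> \<S>) (\<lambda>(t, x). gap \<psi> t d x)"
      using cg by (simp add: continuous_on_states_def)
    ultimately have "(\<lambda>n. (\<lambda>(t, x). gap \<psi> t d x) (?s n, x)) \<longlonglongrightarrow> (\<lambda>(t, x). gap \<psi> t d x) (T, x)"
      using s x T_pos by (intro continuous_on_tendsto_compose[where s = "{0..T} \<times> \<S>"
          and f = "\<lambda>(t, x). gap \<psi> t d x"] always_eventually) (auto simp: less_imp_le)
    then have "(\<lambda>n. 0) \<longlonglongrightarrow> gap \<psi> T d x" using before[OF s] by simp
    then have "gap \<psi> T d x = 0" using LIMSEQ_unique tendsto_const by blast
    then show ?thesis using True by simp
  next
    case False
    then show ?thesis using t by (intro before) auto
  qed
  then show ?thesis by (simp add: gap_zero_iff[OF \<psi> t x])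
qed

end

context optimal_control
begin

theorem unique_best_response:
  defines "\<psi>star \<equiv> \<lambda>t d x. ahat t d x (\<chi> d'. optimal_value t d' x)"
  shows "admissible \<psi>star"
    and "\<And>t d x. t \<in> {0..T} \<Longrightarrow> x \<in> \<S> \<Longrightarrow> cost \<psi>star t d x = optimal_value t d x"
    and "\<And>\<psi> t d x. admissible \<psi> \<Longrightarrow>
           (\<And>t d x. t \<in> {0..T} \<Longrightarrow> x \<in> \<S> \<Longrightarrow> cost \<psi> t d x = optimal_value t d x) \<Longrightarrow>
           t \<in> {0..T} \<Longrightarrow> x \<in> \<S> \<Longrightarrow> \<psi> t d x = \<psi>star t d x"
proof -
  obtain u K where u: "\<And>d. K-lipschitz_on ({0..T} \<times> \<S>) (\<lambda>(t, x). u t d x)"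
    "\<And>d x. x \<in> \<S> \<Longrightarrow> u T d x = g d x"
    "derivative_along_flow T b u (\<lambda>t d x. - min_hamiltonian t d x (\<chi> d'. u t d' x))"
    by (rule dynamic_programming_solution) blast
  interpret V: verification T A lam b ell g ahat L La Lb B hS Y u K
  proof unfold_locales
    show "derivative_along_flow T b u (\<lambda>t d x. - min_hamiltonian t d x (\<chi> d'. u t d' x))" by (rule u(3))
  qed (rule u(1,2), assumption?)+
  have star: "\<psi>star t d x = ahat t d x (\<chi> d'. u t d' x)" if "t \<in> {0..T}" "x \<in> \<S>" for t d x
    unfolding \<psi>star_def using V.optimal_value_eq[OF that] by simp
  show "admissible \<psi>star" by (rule V.minimizer_admissible[OF star])
  show "cost \<psi>star t d x = optimal_value t d x" if "t \<in> {0..T}" "x \<in> \<S>" for t d x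
    using V.minimizer_cost[OF star that, of d] V.optimal_value_eq[OF that, of d] by simp
  show "\<psi> t d x = \<psi>star t d x" if "admissible \<psi>"
    "\<And>t d x. t \<in> {0..T} \<Longrightarrow> x \<in> \<S> \<Longrightarrow> cost \<psi> t d x = optimal_value t d x"
    "t \<in> {0..T}" "x \<in> \<S>" for \<psi> t d x
    using V.optimal_imp_minimizer[OF that(1) _ that(3,4)] that(2) V.optimal_value_eq star[OF that(3,4)] by simp
qed

end

section \<open>The major player and the representative minor player\<close>

definition mean_field_drift ::
  "('a, 'k::finite, 'm::finite) minor_rate \<Rightarrow> ('a, 'k, 'm) minor_feedback \<Rightarrow> real \<Rightarrow> 'k \<Rightarrow> real^'m \<Rightarrow> real^'m" where
  "mean_field_drift q \<phi> t i0 x =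
     (\<chi> l. (\<Sum>k\<in>UNIV. x $ k * q t (Some k) (Some l) (\<phi> t (Some k) i0 x) i0 x)
        + (1 - (\<Sum>k\<in>UNIV. x $ k)) * q t None (Some l) (\<phi> t None i0 x) i0 x)"

lemma transport_eq_drift:
  "transport q \<phi> F t d i0 x = (\<Sum>l\<in>UNIV. dx l F t d x * mean_field_drift q \<phi> t i0 x $ l)"
proof -
  have "(\<Sum>k\<in>UNIV. \<Sum>l\<in>UNIV. dx l F t d x * x $ k * q t (Some k) (Some l) (\<phi> t (Some k) i0 x) i0 x)
      = (\<Sum>l\<in>UNIV. \<Sum>k\<in>UNIV. dx l F t d x * x $ k * q t (Some k) (Some l) (\<phi> t (Some k) i0 x) i0 x)"
    by (rule sum.swap)
  then show ?thesis
    unfolding transport_def mean_field_drift_def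
    by (simp add: distrib_left sum.distrib sum_distrib_left mult_ac)
qed

locale population =
  fixes T :: real and A :: "'a::real_normed_vector set" and q :: "('a, 'k::finite, 'm::finite) minor_rate"
    and L C :: real and \<phi> :: "('a, 'k, 'm) minor_feedback"
  assumes T_pos: "T > 0"
    and q_Q_matrix: "\<And>t \<alpha> i0 x. t \<in> {0..T} \<Longrightarrow> \<alpha> \<in> A \<Longrightarrow> x \<in> \<S> \<Longrightarrow> Q_matrix (\<lambda>i j. q t i j \<alpha> i0 x)"
    and q_lipschitz: "\<And>i j i0. L-lipschitz_on ({0..T} \<times> A \<times> \<S>) (\<lambda>(t, \<alpha>, x). q t i j \<alpha> i0 x)"
    and q_bound: "\<And>t i j \<alpha> i0 x. t \<in> {0..T} \<Longrightarrow> \<alpha> \<in> A \<Longrightarrow> x \<in> \<S> \<Longrightarrow> \<bar>q t i j \<alpha> i0 x\<bar> \<le> C"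
    and \<phi>: "admissible_minor T A \<phi>"
begin

lemma \<phi>_in: "t \<in> {0..T} \<Longrightarrow> x \<in> \<S> \<Longrightarrow> \<phi> t i i0 x \<in> A"
  using \<phi> by (simp add: admissible_minor_def)

lemma rate_lipschitz:
  "is_lipschitz ({0..T} \<times> \<S>) (\<lambda>p. q (fst p) i j (\<phi> (fst p) i i0 (snd p)) i0 (snd p))"
proof (rule control_substitution_lipschitz[OF q_lipschitz is_lipschitz_fst _ is_lipschitz_snd])
  show "is_lipschitz ({0..T} \<times> \<S>) (\<lambda>p. \<phi> (fst p) i i0 (snd p))"
    using \<phi> unfolding is_lipschitz_def admissible_minor_def case_prod_unfold by blast
qed (use \<phi>_in in auto)

lemma drift_lipschitz:
  "is_lipschitz ({0..T} \<times> \<S>) (\<lambda>p. mean_field_drift q \<phi> (fst p) i0 (snd p))"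
proof -
  have bd: "bounded ({0..T} \<times> (\<S> :: (real^'m) set))"
    using compact_imp_bounded[OF compact_simplex_coords] by (intro bounded_Times) auto
  have x: "is_lipschitz ({0..T} \<times> \<S>) (\<lambda>p. snd p $ k)" for k :: 'm
    by (rule is_lipschitz_compose[OF is_lipschitz_vec_nth is_lipschitz_snd subset_UNIV])
  show ?thesis
    unfolding mean_field_drift_def
    by (intro is_lipschitz_vec_lambda is_lipschitz_add is_lipschitz_sum is_lipschitz_mult is_lipschitz_diff
        is_lipschitz_const x rate_lipschitz bd)
qed

lemma drift_constants:
  obtains Lb B where "\<And>i0. Lb-lipschitz_on ({0..T} \<times> \<S>) (\<lambda>(t, x). mean_field_drift q \<phi> t i0 x)"
    "\<And>t i0 x. t \<in> {0..T} \<Longrightarrow> x \<in> \<S> \<Longrightarrow> norm (mean_field_drift q \<phi> t i0 x) \<le> B"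
proof -
  obtain Lb where Lb: "\<And>i0. Lb-lipschitz_on ({0..T} \<times> \<S>) (\<lambda>p. mean_field_drift q \<phi> (fst p) i0 (snd p))"
    by (rule is_lipschitz_uniform[where f = "\<lambda>i0 p. mean_field_drift q \<phi> (fst p) i0 (snd p)", OF drift_lipschitz]) blast
  have "continuous_on_states T (\<lambda>t i0 x. norm (mean_field_drift q \<phi> t i0 x))"
    unfolding continuous_on_states_def
    using continuous_on_norm[OF lipschitz_on_continuous_on[OF Lb]] by (simp add: case_prod_unfold)
  then obtain B where "\<And>t i0 x. t \<in> {0..T} \<Longrightarrow> x \<in> \<S> \<Longrightarrow> \<bar>norm (mean_field_drift q \<phi> t i0 x)\<bar> \<le> B"
    by (rule continuous_on_states_bounded) blast
  then show ?thesis using Lb by (intro that[of Lb B]) (auto simp: case_prod_unfold)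
qed

text \<open>Mass leaves each state at most at rate \<open>C\<close> times the mass present, so an Euler step of length below
  \<open>1 / C\<close> leaves the mass of every state, the last one included, nonnegative.\<close>

lemma drift_in_simplex:
  assumes t: "t \<in> {0..T}" and x: "x \<in> \<S>" and h: "0 \<le> h" "h \<le> 1 / (\<bar>C\<bar> + 1)"
  shows "x + h *\<^sub>R mean_field_drift q \<phi> t i0 x \<in> \<S>"
proof -
  let ?q = "\<lambda>i j. q t i j (\<phi> t i i0 x) i0 x"
  let ?s = "\<Sum>k\<in>UNIV. x $ k"
  have x0: "0 \<le> x $ k" for k using x by (simp add: simplex_coords_def)
  have s1: "?s \<le> 1" using x by (simp add: simplex_coords_def)
  have q0: "0 \<le> ?q i j" if "i \<noteq> j" for i j
    using q_Q_matrix[OF t \<phi>_in[OF t x] x] that by (simp add: Q_matrix_def)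
  have row: "(\<Sum>l\<in>UNIV. ?q i (Some l)) = - ?q i None" for i
  proof -
    have "(\<Sum>j\<in>UNIV. ?q i j) = 0"
      using q_Q_matrix[OF t \<phi>_in[OF t x] x] by (simp add: Q_matrix_def)
    then show ?thesis by (simp add: UNIV_option_conv sum.reindex)
  qed
  have qC: "- \<bar>C\<bar> \<le> ?q i j" for i j
    using q_bound[OF t \<phi>_in[OF t x] x, of i j i i0 i0] by linarith
  have hC: "h * \<bar>C\<bar> \<le> 1"
  proof -
    have "h * (\<bar>C\<bar> + 1) \<le> 1" using h by (simp add: pos_le_divide_eq add_nonneg_pos)
    then show ?thesis using h by (simp add: algebra_simps)
  qed
  have "0 \<le> (x + h *\<^sub>R mean_field_drift q \<phi> t i0 x) $ l" for l
  proof -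
    have "- \<bar>C\<bar> * x $ l \<le> ?q (Some l) (Some l) * x $ l"
      using qC x0 by (intro mult_right_mono) auto
    also have "\<dots> \<le> x $ l * ?q (Some l) (Some l) + (\<Sum>k\<in>UNIV - {l}. x $ k * ?q (Some k) (Some l))"
    proof -
      have "0 \<le> (\<Sum>k\<in>UNIV - {l}. x $ k * ?q (Some k) (Some l))"
        by (intro sum_nonneg mult_nonneg_nonneg x0 q0) auto
      then show ?thesis by (simp add: mult.commute)
    qed
    also have "\<dots> = (\<Sum>k\<in>UNIV. x $ k * ?q (Some k) (Some l))"
      by (simp add: sum.remove[of UNIV l])
    also have "\<dots> \<le> mean_field_drift q \<phi> t i0 x $ l"
      using s1 q0 by (simp add: mean_field_drift_def)
    finally have "h * (- \<bar>C\<bar> * x $ l) \<le> h * mean_field_drift q \<phi> t i0 x $ l"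
      using h(1) by (rule mult_left_mono)
    moreover have "h * \<bar>C\<bar> * x $ l \<le> 1 * x $ l" using hC x0 by (rule mult_right_mono)
    ultimately show ?thesis by (simp add: algebra_simps)
  qed
  moreover have "(\<Sum>l\<in>UNIV. (x + h *\<^sub>R mean_field_drift q \<phi> t i0 x) $ l) \<le> 1"
  proof -
    have "(\<Sum>l\<in>UNIV. mean_field_drift q \<phi> t i0 x $ l)
        = (\<Sum>k\<in>UNIV. x $ k * (\<Sum>l\<in>UNIV. ?q (Some k) (Some l))) + (1 - ?s) * (\<Sum>l\<in>UNIV. ?q None (Some l))"
      unfolding mean_field_drift_def
      by (simp add: sum.distrib sum_distrib_left) (rule sum.swap)
    also have "\<dots> \<le> 0 + (1 - ?s) * \<bar>C\<bar>"
      unfolding row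
    proof (intro add_mono mult_left_mono)
      show "(\<Sum>k\<in>UNIV. x $ k * - ?q (Some k) None) \<le> 0"
        using x0 q0 by (intro sum_nonpos) (simp add: mult_nonneg_nonneg)
      show "- ?q None None \<le> \<bar>C\<bar>" using qC[of None None] by linarith
    qed (use s1 in simp)
    finally have "h * (\<Sum>l\<in>UNIV. mean_field_drift q \<phi> t i0 x $ l) \<le> h * ((1 - ?s) * \<bar>C\<bar>)"
      using h(1) by (simp add: mult_left_mono)
    moreover have "h * \<bar>C\<bar> * (1 - ?s) \<le> 1 * (1 - ?s)" using hC s1 by (intro mult_right_mono) auto
    ultimately show ?thesis by (simp add: sum.distrib sum_distrib_left[symmetric] mult_ac)
  qed
  ultimately show ?thesis by (simp add: simplex_coords_def)
qed

lemma step_bound_pos: "0 < 1 / (\<bar>C\<bar> + 1)"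
  by (simp add: add_nonneg_pos)

end

lemma arg_min_on_unique:
  assumes "\<exists>!a. is_arg_min H (\<lambda>a. a \<in> A) a"
  shows "is_arg_min H (\<lambda>a. a \<in> A) (arg_min_on H A)"
  unfolding arg_min_on_def arg_min_def by (rule someI_ex[OF ex1_implies_ex[OF assms]])

lemma arg_min_on_properties:
  fixes H :: "'a \<Rightarrow> real"
  assumes ex: "\<exists>!a. is_arg_min H (\<lambda>a. a \<in> A) a"
  shows "arg_min_on H A \<in> A" and "a \<in> A \<Longrightarrow> H (arg_min_on H A) \<le> H a"
    and "a \<in> A \<Longrightarrow> H a \<le> H (arg_min_on H A) \<Longrightarrow> a = arg_min_on H A"
proof -
  note am = arg_min_on_unique[OF ex]
  then show "arg_min_on H A \<in> A" by (simp add: is_arg_min_linorder)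
  show le: "H (arg_min_on H A) \<le> H a" if "a \<in> A" for a using am that by (simp add: is_arg_min_linorder)
  assume a: "a \<in> A" and "H a \<le> H (arg_min_on H A)"
  then have "is_arg_min H (\<lambda>a. a \<in> A) a" using le by (auto simp: is_arg_min_linorder intro: order_trans)
  then show "a = arg_min_on H A" using ex am by blast
qed

text \<open>The two components of a pair never jump together, so a sum over its jumps splits.\<close>

lemma sum_over_pair_jumps:
  fixes w :: "'i::finite \<times> 'k::finite \<Rightarrow> real"
  shows "(\<Sum>p\<in>UNIV - {(i, k)}. w p * (if snd p = k \<and> fst p \<noteq> i then P (fst p)
            else if fst p = i \<and> snd p \<noteq> k then R (snd p) else 0))
    = (\<Sum>k'\<in>UNIV - {k}. w (i, k') * R k') + (\<Sum>j\<in>UNIV - {i}. w (j, k) * P j)"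
proof -
  let ?f = "\<lambda>p. w p * (if snd p = k \<and> fst p \<noteq> i then P (fst p)
            else if fst p = i \<and> snd p \<noteq> k then R (snd p) else 0)"
  let ?A = "Pair i ` (UNIV - {k})" and ?B = "(\<lambda>j. (j, k)) ` (UNIV - {i})"
  have "sum ?f (UNIV - {(i, k)}) = sum ?f (?A \<union> ?B)"
    by (rule sum.mono_neutral_right) auto
  also have "\<dots> = sum ?f ?A + sum ?f ?B"
    by (rule sum.union_disjoint) auto
  also have "sum ?f ?A = (\<Sum>k'\<in>UNIV - {k}. w (i, k') * R k')"
    by (subst sum.reindex) (auto simp: inj_on_def intro!: sum.cong)
  also have "sum ?f ?B = (\<Sum>j\<in>UNIV - {i}. w (j, k) * P j)"
    by (subst sum.reindex) (auto simp: inj_on_def intro!: sum.cong)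
  finally show ?thesis .
qed

locale mean_field_game = population T A q L C \<phi>
  for T :: real and A :: "'a::real_normed_vector set" and q :: "('a, 'k::finite, 'm::finite) minor_rate"
    and L C :: real and \<phi> :: "('a, 'k, 'm) minor_feedback" +
  fixes A0 :: "'a0::real_normed_vector set" and q0 :: "('a0, 'k, 'm) major_rate"
    and f0 :: "('a0, 'k, 'm) major_cost_rate" and g0 :: "'k \<Rightarrow> real^'m \<Rightarrow> real"
    and f :: "('a, 'k, 'm) minor_cost_rate" and g :: "'m option \<Rightarrow> 'k \<Rightarrow> real^'m \<Rightarrow> real"
    and L\<alpha>0 L\<alpha> :: real
    and Y0 :: "('a0, 'k, 'm) major_feedback \<Rightarrow> ('a, 'k, 'm) minor_feedback \<Rightarrow> ('w0, 'k \<times> (real^'m)) process"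
    and Y :: "('a0, 'k, 'm) major_feedback \<Rightarrow> ('a, 'k, 'm) minor_feedback \<Rightarrow> ('a, 'k, 'm) minor_feedback
       \<Rightarrow> ('w, ('m option \<times> 'k) \<times> (real^'m)) process"
  assumes Q0: "\<And>t \<alpha>0 x. t \<in> {0..T} \<Longrightarrow> \<alpha>0 \<in> A0 \<Longrightarrow> x \<in> \<S> \<Longrightarrow> Q_matrix (\<lambda>i0 j0. q0 t i0 j0 \<alpha>0 x)"
    and q0_lip: "\<And>i0 j0. L-lipschitz_on ({0..T} \<times> A0 \<times> \<S>) (\<lambda>(t, \<alpha>0, x). q0 t i0 j0 \<alpha>0 x)"
    and f0_lip: "\<And>i0. L-lipschitz_on ({0..T} \<times> A0 \<times> \<S>) (\<lambda>(t, \<alpha>0, x). f0 t i0 \<alpha>0 x)"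
    and g0_lip: "\<And>i0. L-lipschitz_on \<S> (\<lambda>x. g0 i0 x)"
    and f_lip: "\<And>i i0. L-lipschitz_on ({0..T} \<times> A \<times> \<S>) (\<lambda>(t, \<alpha>, x). f t i \<alpha> i0 x)"
    and g_lip: "\<And>i i0. L-lipschitz_on \<S> (\<lambda>x. g i i0 x)"
    and Y0: "\<And>\<phi>0. admissible_major T A0 \<phi>0 \<Longrightarrow>
           markov_process T (Y0 \<phi>0 \<phi>) \<and> has_generator T (Y0 \<phi>0 \<phi>) (major_generator q0 q \<phi>0 \<phi>)"
    and Y: "\<And>\<phi>0 \<psi>. admissible_major T A0 \<phi>0 \<Longrightarrow> admissible_minor T A \<psi> \<Longrightarrow>
           markov_process T (Y \<phi>0 \<phi> \<psi>) \<and> has_generator T (Y \<phi>0 \<phi> \<psi>) (minor_generator q0 q \<phi>0 \<phi> \<psi>)"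
    and ex0: "\<And>t i0 x v. t \<in> {0..T} \<Longrightarrow> x \<in> \<S> \<Longrightarrow>
           \<exists>!\<alpha>0. is_arg_min (major_hamiltonian q0 f0 t i0 x v) (\<lambda>\<alpha>0. \<alpha>0 \<in> A0) \<alpha>0"
    and min0_lip: "\<And>i0. L\<alpha>0-lipschitz_on ({0..T} \<times> \<S> \<times> UNIV)
           (\<lambda>(t, x, v). major_minimizer A0 q0 f0 t i0 x v)"
    and ex: "\<And>t i i0 x v. t \<in> {0..T} \<Longrightarrow> x \<in> \<S> \<Longrightarrow>
           \<exists>!\<alpha>. is_arg_min (minor_hamiltonian q f t i i0 x v) (\<lambda>\<alpha>. \<alpha> \<in> A) \<alpha>"
    and min_lip: "\<And>i i0. L\<alpha>-lipschitz_on ({0..T} \<times> \<S> \<times> UNIV)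
           (\<lambda>(t, x, v). minor_minimizer A q f t i i0 x v)"
begin

theorem major_unique_best_response:
  defines "\<phi>star \<equiv> \<lambda>t i0 x. major_minimizer A0 q0 f0 t i0 x (\<chi> j0. major_value T A0 f0 g0 Y0 \<phi> t j0 x)"
  shows "major_best_response T A0 f0 g0 Y0 \<phi> \<phi>star"
    and "\<And>\<phi>0 t i0 x. major_best_response T A0 f0 g0 Y0 \<phi> \<phi>0 \<Longrightarrow> t \<in> {0..T} \<Longrightarrow> x \<in> \<S> \<Longrightarrow>
           \<phi>0 t i0 x = \<phi>star t i0 x"
proof -
  obtain Lb B where Lb: "\<And>i0. Lb-lipschitz_on ({0..T} \<times> \<S>) (\<lambda>(t, x). mean_field_drift q \<phi> t i0 x)"
    and B: "\<And>t i0 x. t \<in> {0..T} \<Longrightarrow> x \<in> \<S> \<Longrightarrow> norm (mean_field_drift q \<phi> t i0 x) \<le> B"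
    by (rule drift_constants) blast
  have L0: "0 \<le> L" by (rule lipschitz_on_nonneg[OF q0_lip])
  let ?lam = "\<lambda>t d d' \<alpha>0 x. if d = d' then 0 else q0 t d d' \<alpha>0 x"
  have ham: "jump_hamiltonian ?lam f0 t d x v a = major_hamiltonian q0 f0 t d x v a" for t d a x v
    unfolding jump_hamiltonian_def major_hamiltonian_def by (intro arg_cong2[of _ _ _ _ "(+)"] sum.cong) auto
  have adm: "admissible_feedback T A0 = admissible_major T A0"
    by (simp add: fun_eq_iff admissible_feedback_def admissible_major_def)
  have gen: "jump_flow_generator (\<lambda>t d d' x. ?lam t d d' (\<phi>0 t d x) x) (mean_field_drift q \<phi>) = major_generator q0 q \<phi>0 \<phi>" for \<phi>0
    unfolding jump_flow_generator_def major_generator_def transport_eq_drift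
    by (intro ext arg_cong2[of _ _ _ _ "(+)"] sum.cong) auto
  interpret O: optimal_control T A0 ?lam "mean_field_drift q \<phi>" f0 g0 "major_minimizer A0 q0 f0"
    L L\<alpha>0 Lb B "1 / (\<bar>C\<bar> + 1)" "\<lambda>\<phi>0. Y0 \<phi>0 \<phi>"
  proof unfold_locales
    fix t a and d d' :: 'k and x :: "real^'m" assume "t \<in> {0..T}" "a \<in> A0" "x \<in> \<S>" "d \<noteq> d'"
    then show "0 \<le> ?lam t d d' a x" using Q0[of t a x] by (simp add: Q_matrix_def)
  next
    fix d d' :: 'k
    show "L-lipschitz_on ({0..T} \<times> A0 \<times> \<S>) (\<lambda>(t, a, x). ?lam t d d' a x)"
      using q0_lip[of d d'] lipschitz_on_mono[OF lipschitz_on_constant order_refl L0]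
      by (cases "d = d'") (simp_all add: case_prod_unfold)
  next
    fix t v a and d :: 'k and x :: "real^'m" assume *: "t \<in> {0..T}" "x \<in> \<S>"
    show "major_minimizer A0 q0 f0 t d x v \<in> A0"
      unfolding major_minimizer_def by (rule arg_min_on_properties[OF ex0[OF *]])
    assume "a \<in> A0"
    then show "jump_hamiltonian ?lam f0 t d x v (major_minimizer A0 q0 f0 t d x v) \<le> jump_hamiltonian ?lam f0 t d x v a"
      unfolding ham major_minimizer_def by (rule arg_min_on_properties[OF ex0[OF *]])
    assume "jump_hamiltonian ?lam f0 t d x v a \<le> jump_hamiltonian ?lam f0 t d x v (major_minimizer A0 q0 f0 t d x v)"
    then show "a = major_minimizer A0 q0 f0 t d x v"
      unfolding ham major_minimizer_def by (rule arg_min_on_properties(3)[OF ex0[OF *] \<open>a \<in> A0\<close>])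
  next
    fix \<phi>0 :: "('a0, 'k, 'm) major_feedback" assume "admissible_feedback T A0 \<phi>0"
    then show "markov_process T (Y0 \<phi>0 \<phi>)"
      "has_generator T (Y0 \<phi>0 \<phi>) (jump_flow_generator (\<lambda>t d d' x. ?lam t d d' (\<phi>0 t d x) x) (mean_field_drift q \<phi>))"
      using Y0 unfolding adm gen by auto
  qed (use T_pos f0_lip g0_lip Lb B step_bound_pos drift_in_simplex min0_lip in auto)
  have cost: "O.cost \<phi>0 t d x = major_cost T f0 g0 (Y0 \<phi>0 \<phi>) \<phi>0 t d x" for \<phi>0 t d x
    by (simp add: O.cost_def major_cost_def case_prod_unfold)
  have val: "O.optimal_value t d x = major_value T A0 f0 g0 Y0 \<phi> t d x" for t d x
    by (simp add: O.optimal_value_def major_value_def cost adm)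
  have star: "\<phi>star = (\<lambda>t d x. major_minimizer A0 q0 f0 t d x (\<chi> d'. O.optimal_value t d' x))"
    by (simp add: \<phi>star_def val)
  show "major_best_response T A0 f0 g0 Y0 \<phi> \<phi>star"
    unfolding major_best_response_def
    using O.unique_best_response(1,2)[folded star, unfolded adm cost val] by blast
  show "\<phi>0 t i0 x = \<phi>star t i0 x"
    if "major_best_response T A0 f0 g0 Y0 \<phi> \<phi>0" "t \<in> {0..T}" "x \<in> \<S>" for \<phi>0 t i0 x
    unfolding star
    by (rule O.unique_best_response(3)) (use that in \<open>simp_all add: adm cost val major_best_response_def\<close>)
qed


theorem minor_unique_best_response:
  assumes \<phi>0: "admissible_major T A0 \<phi>0"
  defines "\<psi>star \<equiv> \<lambda>t i i0 x. minor_minimizer A q f t i i0 x (\<chi> j j0. minor_value T A f g Y \<phi>0 \<phi> t j j0 x)"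
  shows "minor_best_response T A f g Y \<phi>0 \<phi> \<psi>star"
    and "\<And>\<psi> t i i0 x. minor_best_response T A f g Y \<phi>0 \<phi> \<psi> \<Longrightarrow> t \<in> {0..T} \<Longrightarrow> x \<in> \<S> \<Longrightarrow>
           \<psi> t i i0 x = \<psi>star t i i0 x"
proof -
  obtain Lb B where Lb: "\<And>i0. Lb-lipschitz_on ({0..T} \<times> \<S>) (\<lambda>(t, x). mean_field_drift q \<phi> t i0 x)"
    and B: "\<And>t i0 x. t \<in> {0..T} \<Longrightarrow> x \<in> \<S> \<Longrightarrow> norm (mean_field_drift q \<phi> t i0 x) \<le> B"
    by (rule drift_constants) blast
  have \<phi>0_in: "\<phi>0 t i0 x \<in> A0" if "t \<in> {0..T}" "x \<in> \<S>" for t i0 x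
    using \<phi>0 that by (simp add: admissible_major_def)
  define lam where "lam t d d' a x =
      (if snd d' = snd d \<and> fst d' \<noteq> fst d then q t (fst d) (fst d') a (snd d) x
       else if fst d' = fst d \<and> snd d' \<noteq> snd d then q0 t (snd d) (snd d') (\<phi>0 t (snd d) x) x else 0)"
    for t a x and d d' :: "'m option \<times> 'k"
  let ?b = "\<lambda>t d. mean_field_drift q \<phi> t (snd d)"
  let ?ell = "\<lambda>t d a x. f t (fst d) a (snd d) x"
  let ?g = "\<lambda>d x. g (fst d) (snd d) x"
  let ?split = "\<lambda>v :: real^('m option \<times> 'k). \<chi> j j0. v $ (j, j0)"
  define ahat where "ahat t d x v = minor_minimizer A q f t (fst d) (snd d) x (?split v)"
    for t x v and d :: "'m option \<times> 'k"
  let ?Y = "\<lambda>\<psi>. Y \<phi>0 \<phi> (\<lambda>t i i0 x. \<psi> t (i, i0) x)"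
  have adm: "admissible_feedback T A \<psi> \<longleftrightarrow> admissible_minor T A (\<lambda>t i i0 x. \<psi> t (i, i0) x)" for \<psi>
    by (simp add: admissible_feedback_def admissible_minor_def split_paired_all)
  have lam_lip: "is_lipschitz ({0..T} \<times> A \<times> \<S>) (\<lambda>p. lam (fst p) d d' (fst (snd p)) (snd (snd p)))" for d d'
  proof -
    have "is_lipschitz ({0..T} \<times> A \<times> \<S>) (\<lambda>p. q (fst p) (fst d) (fst d') (fst (snd p)) (snd d) (snd (snd p)))"
      using q_lipschitz[of "fst d" "fst d'" "snd d"] by (auto simp: is_lipschitz_def case_prod_unfold)
    moreover have "is_lipschitz ({0..T} \<times> A \<times> \<S>)
        (\<lambda>p. q0 (fst p) (snd d) (snd d') (\<phi>0 (fst p) (snd d) (snd (snd p))) (snd (snd p)))"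
    proof (rule control_substitution_lipschitz[OF q0_lip is_lipschitz_fst])
      show x: "is_lipschitz ({0..T} \<times> A \<times> \<S>) (\<lambda>p. snd (snd p))"
        by (rule is_lipschitz_compose[OF is_lipschitz_snd is_lipschitz_snd subset_UNIV])
      have "is_lipschitz ({0..T} \<times> \<S>) (\<lambda>(t, x). \<phi>0 t (snd d) x)"
        using \<phi>0 unfolding is_lipschitz_def admissible_major_def by blast
      then have "is_lipschitz ({0..T} \<times> A \<times> \<S>) (\<lambda>p. (\<lambda>(t, x). \<phi>0 t (snd d) x) (fst p, snd (snd p)))"
        by (rule is_lipschitz_compose[OF _ is_lipschitz_Pair[OF is_lipschitz_fst x]]) auto
      then show "is_lipschitz ({0..T} \<times> A \<times> \<S>) (\<lambda>p. \<phi>0 (fst p) (snd d) (snd (snd p)))" by simp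
    qed (use \<phi>0_in in auto)
    ultimately show ?thesis
      unfolding lam_def by (cases "snd d' = snd d"; cases "fst d' = fst d") (simp_all add: is_lipschitz_const)
  qed
  obtain K where K: "K \<ge> 0" "\<And>dd. K-lipschitz_on ({0..T} \<times> A \<times> \<S>)
      (\<lambda>p. lam (fst p) (fst dd) (snd dd) (fst (snd p)) (snd (snd p)))"
    by (rule is_lipschitz_uniform[where f = "\<lambda>dd p. lam (fst p) (fst dd) (snd dd) (fst (snd p)) (snd (snd p))", OF lam_lip]) blast
  have L0: "0 \<le> L" by (rule lipschitz_on_nonneg[OF g_lip])
  have ahat_lip: "is_lipschitz ({0..T} \<times> \<S> \<times> UNIV) (\<lambda>p. ahat (fst p) d (fst (snd p)) (snd (snd p)))" for d
  proof -
    have "linear ?split" by (rule linearI) (simp_all add: vec_eq_iff)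
    then have "bounded_linear ?split" by (rule linear_conv_bounded_linear[THEN iffD1])
    then obtain KS where "KS-lipschitz_on UNIV ?split" by (rule bounded_linear.lipschitz_boundE) blast
    then have "is_lipschitz UNIV ?split" by (auto simp: is_lipschitz_def)
    then have s: "is_lipschitz ({0..T} \<times> \<S> \<times> UNIV) (\<lambda>p. ?split (snd (snd p)))"
      by (rule is_lipschitz_compose[OF _ is_lipschitz_compose[OF is_lipschitz_snd is_lipschitz_snd subset_UNIV] subset_UNIV])
    have x: "is_lipschitz ({0..T} \<times> \<S> \<times> UNIV) (\<lambda>p. fst (snd p))"
      by (rule is_lipschitz_compose[OF is_lipschitz_fst is_lipschitz_snd subset_UNIV])
    have "is_lipschitz ({0..T} \<times> \<S> \<times> UNIV) (\<lambda>(t, x, v). minor_minimizer A q f t (fst d) (snd d) x v)"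
      using min_lip by (auto simp: is_lipschitz_def)
    then have "is_lipschitz ({0..T} \<times> \<S> \<times> UNIV)
        (\<lambda>p. (\<lambda>(t, x, v). minor_minimizer A q f t (fst d) (snd d) x v) (fst p, fst (snd p), ?split (snd (snd p))))"
      by (rule is_lipschitz_compose[OF _ is_lipschitz_Pair[OF is_lipschitz_fst is_lipschitz_Pair[OF x s]]]) auto
    then show ?thesis by (simp add: ahat_def)
  qed
  obtain La where La: "\<And>d. La-lipschitz_on ({0..T} \<times> \<S> \<times> UNIV) (\<lambda>p. ahat (fst p) d (fst (snd p)) (snd (snd p)))"
    by (rule is_lipschitz_uniform[where f = "\<lambda>d p. ahat (fst p) d (fst (snd p)) (snd (snd p))", OF ahat_lip]) blast
  \<comment> \<open>The jumps of the major player add to the Hamiltonian a term that the control does not influence.\<close>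
  define rest where "rest t d x v = (\<Sum>j0\<in>UNIV - {snd d}. (v $ (fst d, j0) - v $ d) * q0 t (snd d) j0 (\<phi>0 t (snd d) x) x)"
    for t x and d :: "'m option \<times> 'k" and v :: "real^('m option \<times> 'k)"
  have ham: "jump_hamiltonian lam ?ell t d x v a
      = minor_hamiltonian q f t (fst d) (snd d) x (?split v) a + rest t d x v" for t d a x v
    using sum_over_pair_jumps[where i = "fst d" and k = "snd d" and w = "\<lambda>p. v $ p - v $ d"
        and P = "\<lambda>j. q t (fst d) j a (snd d) x" and R = "\<lambda>j0. q0 t (snd d) j0 (\<phi>0 t (snd d) x) x"]
    by (simp add: jump_hamiltonian_def minor_hamiltonian_def rest_def lam_def)
  have gen: "jump_flow_generator (\<lambda>t d d' x. lam t d d' (\<psi> t d x) x) ?b = minor_generator q0 q \<phi>0 \<phi> (\<lambda>t i i0 x. \<psi> t (i, i0) x)" for \<psi>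
  proof (intro ext)
    fix F t d x
    show "jump_flow_generator (\<lambda>t d d' x. lam t d d' (\<psi> t d x) x) ?b F t d x
        = minor_generator q0 q \<phi>0 \<phi> (\<lambda>t i i0 x. \<psi> t (i, i0) x) F t d x"
      using sum_over_pair_jumps[where i = "fst d" and k = "snd d" and w = "\<lambda>p. F t p x - F t d x"
          and P = "\<lambda>j. q t (fst d) j (\<psi> t d x) (snd d) x" and R = "\<lambda>j0. q0 t (snd d) j0 (\<phi>0 t (snd d) x) x"]
      by (simp add: jump_flow_generator_def minor_generator_def transport_eq_drift lam_def case_prod_unfold)
  qed
  interpret O: optimal_control T A lam ?b ?ell ?g ahat "L + K" La Lb B "1 / (\<bar>C\<bar> + 1)" ?Y
  proof unfold_locales
    fix t a and d d' :: "'m option \<times> 'k" and x :: "real^'m" assume *: "t \<in> {0..T}" "a \<in> A" "x \<in> \<S>" "d \<noteq> d'"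
    show "0 \<le> lam t d d' a x"
      using q_Q_matrix[OF *(1-3)] Q0[OF *(1) \<phi>0_in[OF *(1,3)] *(3)] by (auto simp: lam_def Q_matrix_def)
  next
    fix d d' :: "'m option \<times> 'k"
    show "(L + K)-lipschitz_on ({0..T} \<times> A \<times> \<S>) (\<lambda>(t, a, x). lam t d d' a x)"
      using lipschitz_on_mono[OF K(2)[of "(d, d')"] order_refl, of "L + K"] L0 by (simp add: case_prod_unfold)
    show "(L + K)-lipschitz_on ({0..T} \<times> A \<times> \<S>) (\<lambda>(t, a, x). ?ell t d a x)"
      by (rule lipschitz_on_mono[OF f_lip order_refl]) (simp add: K)
    show "(L + K)-lipschitz_on \<S> (?g d)"
      by (rule lipschitz_on_mono[OF g_lip order_refl]) (simp add: K)
    show "La-lipschitz_on ({0..T} \<times> \<S> \<times> UNIV) (\<lambda>(t, x, v). ahat t d x v)"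
      using La[of d] by (simp add: case_prod_unfold)
  next
    fix t v a and d :: "'m option \<times> 'k" and x :: "real^'m" assume *: "t \<in> {0..T}" "x \<in> \<S>"
    show "ahat t d x v \<in> A"
      unfolding ahat_def minor_minimizer_def by (rule arg_min_on_properties(1)[OF ex[OF *]])
    assume "a \<in> A"
    then show "jump_hamiltonian lam ?ell t d x v (ahat t d x v) \<le> jump_hamiltonian lam ?ell t d x v a"
      unfolding ham ahat_def minor_minimizer_def
      by (intro add_right_mono arg_min_on_properties(2)[OF ex[OF *]])
    assume "jump_hamiltonian lam ?ell t d x v a \<le> jump_hamiltonian lam ?ell t d x v (ahat t d x v)"
    then show "a = ahat t d x v"
      unfolding ham ahat_def minor_minimizer_def add_le_cancel_right
      by (rule arg_min_on_properties(3)[OF ex[OF *] \<open>a \<in> A\<close>])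
  next
    fix \<psi> :: "real \<Rightarrow> 'm option \<times> 'k \<Rightarrow> real^'m \<Rightarrow> 'a" assume "admissible_feedback T A \<psi>"
    then show "markov_process T (?Y \<psi>)"
      "has_generator T (?Y \<psi>) (jump_flow_generator (\<lambda>t d d' x. lam t d d' (\<psi> t d x) x) ?b)"
      using Y[OF \<phi>0] unfolding adm gen by auto
  qed (use T_pos Lb B step_bound_pos drift_in_simplex in auto)
  have cost: "O.cost \<psi> t d x = minor_cost T f g (?Y \<psi>) (\<lambda>t i i0 x. \<psi> t (i, i0) x) t (fst d) (snd d) x" for \<psi> t d x
    by (simp add: O.cost_def minor_cost_def case_prod_unfold)
  have val: "O.optimal_value t (i, i0) x = minor_value T A f g Y \<phi>0 \<phi> t i i0 x" for t i i0 x
  proof -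
    have "(\<lambda>\<psi>. O.cost \<psi> t (i, i0) x) ` {\<psi>. O.admissible \<psi>}
        = (\<lambda>\<psi>. minor_cost T f g (Y \<phi>0 \<phi> \<psi>) \<psi> t i i0 x) ` {\<psi>. admissible_minor T A \<psi>}"
    proof (intro equalityI subsetI)
      fix r assume "r \<in> (\<lambda>\<psi>. O.cost \<psi> t (i, i0) x) ` {\<psi>. O.admissible \<psi>}"
      then obtain \<psi> where "O.admissible \<psi>" "r = O.cost \<psi> t (i, i0) x" by auto
      then show "r \<in> (\<lambda>\<psi>. minor_cost T f g (Y \<phi>0 \<phi> \<psi>) \<psi> t i i0 x) ` {\<psi>. admissible_minor T A \<psi>}"
        unfolding adm cost by (intro image_eqI[of _ _ "\<lambda>t i i0 x. \<psi> t (i, i0) x"]) auto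
    next
      fix r assume "r \<in> (\<lambda>\<psi>. minor_cost T f g (Y \<phi>0 \<phi> \<psi>) \<psi> t i i0 x) ` {\<psi>. admissible_minor T A \<psi>}"
      then obtain \<psi> where "admissible_minor T A \<psi>" "r = minor_cost T f g (Y \<phi>0 \<phi> \<psi>) \<psi> t i i0 x" by auto
      then show "r \<in> (\<lambda>\<psi>. O.cost \<psi> t (i, i0) x) ` {\<psi>. O.admissible \<psi>}"
        by (intro image_eqI[of _ _ "\<lambda>t d x. \<psi> t (fst d) (snd d) x"]) (simp_all add: adm cost)
    qed
    then show ?thesis by (simp add: O.optimal_value_def minor_value_def)
  qed
  have star: "\<psi>star t i i0 x = ahat t (i, i0) x (\<chi> d'. O.optimal_value t d' x)" for t i i0 x
    by (simp add: \<psi>star_def ahat_def val)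
  note best = O.unique_best_response
  show "minor_best_response T A f g Y \<phi>0 \<phi> \<psi>star"
  proof -
    have eq: "\<psi>star = (\<lambda>t i i0 x. ahat t (i, i0) x (\<chi> d'. O.optimal_value t d' x))"
      by (intro ext star)
    have "admissible_minor T A \<psi>star" using best(1) unfolding adm eq .
    moreover have "minor_cost T f g (Y \<phi>0 \<phi> \<psi>star) \<psi>star t i i0 x = minor_value T A f g Y \<phi>0 \<phi> t i i0 x"
      if "t \<in> {0..T}" "x \<in> \<S>" for t i i0 x
      using best(2)[OF that, of "(i, i0)"] unfolding cost eq[symmetric] val by simp
    ultimately show ?thesis by (simp add: minor_best_response_def)
  qed
  show "\<psi> t i i0 x = \<psi>star t i i0 x"
    if br: "minor_best_response T A f g Y \<phi>0 \<phi> \<psi>" and t: "t \<in> {0..T}" and x: "x \<in> \<S>" for \<psi> t i i0 x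
  proof -
    let ?\<psi> = "\<lambda>t d x. \<psi> t (fst d) (snd d) x"
    have "O.admissible ?\<psi>" using br by (simp add: adm minor_best_response_def)
    moreover have "O.cost ?\<psi> t d x = O.optimal_value t d x" if "t \<in> {0..T}" "x \<in> \<S>" for t d x
      using br that by (cases d) (simp add: cost val minor_best_response_def)
    ultimately have "?\<psi> t (i, i0) x = ahat t (i, i0) x (\<chi> d'. O.optimal_value t d' x)"
      using t x by (rule best(3))
    then show ?thesis by (simp add: star)
  qed
qed

end

theorem proposition3:
  fixes T L C \<epsilon> L\<alpha>0 L\<alpha> :: real
    and A0 :: "'a0::real_normed_vector set" and A :: "'a::real_normed_vector set"
    and q0 :: "('a0, 'k::finite, 'm::finite) major_rate"
    and q :: "('a, 'k, 'm) minor_rate"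
    and f0 :: "('a0, 'k, 'm) major_cost_rate" and g0 :: "'k \<Rightarrow> real^'m \<Rightarrow> real"
    and f :: "('a, 'k, 'm) minor_cost_rate" and g :: "'m option \<Rightarrow> 'k \<Rightarrow> real^'m \<Rightarrow> real"
    and Y0 :: "('a0, 'k, 'm) major_feedback \<Rightarrow> ('a, 'k, 'm) minor_feedback
               \<Rightarrow> ('w0, 'k \<times> (real^'m)) process"
    and Y :: "('a0, 'k, 'm) major_feedback \<Rightarrow> ('a, 'k, 'm) minor_feedback
              \<Rightarrow> ('a, 'k, 'm) minor_feedback \<Rightarrow> ('w, ('m option \<times> 'k) \<times> (real^'m)) process"
  assumes "T > 0" and "convex A0" and "convex A"
    \<comment> \<open>(a) rates\<close>
    and "\<And>t \<alpha> i0 x. t \<in> {0..T} \<Longrightarrow> \<alpha> \<in> A \<Longrightarrow> x \<in> simplex_coords \<Longrightarrow> Q_matrix (\<lambda>i j. q t i j \<alpha> i0 x)"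
    and "\<And>t \<alpha>0 x. t \<in> {0..T} \<Longrightarrow> \<alpha>0 \<in> A0 \<Longrightarrow> x \<in> simplex_coords
           \<Longrightarrow> Q_matrix (\<lambda>i0 j0. q0 t i0 j0 \<alpha>0 x)"
    \<comment> \<open>(b) Lipschitz continuity\<close>
    and "L > 0"
    and "\<And>i j i0. L-lipschitz_on ({0..T} \<times> A \<times> simplex_coords) (\<lambda>(t, \<alpha>, x). q t i j \<alpha> i0 x)"
    and "\<And>i0 j0. L-lipschitz_on ({0..T} \<times> A0 \<times> simplex_coords) (\<lambda>(t, \<alpha>0, x). q0 t i0 j0 \<alpha>0 x)"
    and "\<And>i i0. L-lipschitz_on ({0..T} \<times> A \<times> simplex_coords) (\<lambda>(t, \<alpha>, x). f t i \<alpha> i0 x)"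
    and "\<And>i0. L-lipschitz_on ({0..T} \<times> A0 \<times> simplex_coords) (\<lambda>(t, \<alpha>0, x). f0 t i0 \<alpha>0 x)"
    and "\<And>i i0. L-lipschitz_on simplex_coords (\<lambda>x. g i i0 x)"
    and "\<And>i0. L-lipschitz_on simplex_coords (\<lambda>x. g0 i0 x)"
    \<comment> \<open>(c) boundedness\<close>
    and "\<And>t i j \<alpha> i0 x. t \<in> {0..T} \<Longrightarrow> \<alpha> \<in> A \<Longrightarrow> x \<in> simplex_coords \<Longrightarrow> \<bar>q t i j \<alpha> i0 x\<bar> \<le> C"
    \<comment> \<open>(d) boundary condition\<close>
    and "\<epsilon> > 0"
    and "\<And>t \<alpha> i0 i j x. t \<in> {0..T} \<Longrightarrow> \<alpha> \<in> A \<Longrightarrow> x \<in> simplex_coords \<Longrightarrow> i \<noteq> j \<Longrightarrow>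
           (x $ i < \<epsilon> \<longrightarrow> q t (Some i) (Some j) \<alpha> i0 x = 0) \<and>
           (1 - (\<Sum>k\<in>UNIV. x $ k) < \<epsilon> \<longrightarrow> q t None (Some i) \<alpha> i0 x = 0)"
    \<comment> \<open>the controlled Markov processes\<close>
    and "\<And>\<phi>0 \<phi>. admissible_major T A0 \<phi>0 \<Longrightarrow> admissible_minor T A \<phi> \<Longrightarrow>
           markov_process T (Y0 \<phi>0 \<phi>) \<and> has_generator T (Y0 \<phi>0 \<phi>) (major_generator q0 q \<phi>0 \<phi>)"
    and "\<And>\<phi>0 \<phi> \<psi>. admissible_major T A0 \<phi>0 \<Longrightarrow> admissible_minor T A \<phi> \<Longrightarrow>
           admissible_minor T A \<psi> \<Longrightarrow>
           markov_process T (Y \<phi>0 \<phi> \<psi>) \<and>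
           has_generator T (Y \<phi>0 \<phi> \<psi>) (minor_generator q0 q \<phi>0 \<phi> \<psi>)"
    \<comment> \<open>(1) minimizers for the major player\<close>
    and "\<And>t i0 x v. t \<in> {0..T} \<Longrightarrow> x \<in> simplex_coords \<Longrightarrow>
           \<exists>!\<alpha>0. is_arg_min (major_hamiltonian q0 f0 t i0 x v) (\<lambda>\<alpha>0. \<alpha>0 \<in> A0) \<alpha>0"
    and "\<And>i0. L\<alpha>0-lipschitz_on ({0..T} \<times> simplex_coords \<times> UNIV)
           (\<lambda>(t, x, v). major_minimizer A0 q0 f0 t i0 x v)"
    \<comment> \<open>(2) minimizers for the minor players\<close>
    and "\<And>t i i0 x v. t \<in> {0..T} \<Longrightarrow> x \<in> simplex_coords \<Longrightarrow>
           \<exists>!\<alpha>. is_arg_min (minor_hamiltonian q f t i i0 x v) (\<lambda>\<alpha>. \<alpha> \<in> A) \<alpha>"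
    and "\<And>i i0. L\<alpha>-lipschitz_on ({0..T} \<times> simplex_coords \<times> UNIV)
           (\<lambda>(t, x, v). minor_minimizer A q f t i i0 x v)"
  shows
    "(\<forall>\<phi>. admissible_minor T A \<phi> \<longrightarrow>
        (let \<phi>star = \<lambda>t i0 x. major_minimizer A0 q0 f0 t i0 x
                               (\<chi> j0. major_value T A0 f0 g0 Y0 \<phi> t j0 x)
         in major_best_response T A0 f0 g0 Y0 \<phi> \<phi>star \<and>
            (\<forall>\<phi>0. major_best_response T A0 f0 g0 Y0 \<phi> \<phi>0 \<longrightarrow>
               (\<forall>t\<in>{0..T}. \<forall>i0. \<forall>x\<in>simplex_coords. \<phi>0 t i0 x = \<phi>star t i0 x)))) \<and>
     (\<forall>\<phi>0 \<phi>. admissible_major T A0 \<phi>0 \<longrightarrow> admissible_minor T A \<phi> \<longrightarrow>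
        (let \<phi>star = \<lambda>t i i0 x. minor_minimizer A q f t i i0 x
                               (\<chi> j j0. minor_value T A f g Y \<phi>0 \<phi> t j j0 x)
         in minor_best_response T A f g Y \<phi>0 \<phi> \<phi>star \<and>
            (\<forall>\<psi>. minor_best_response T A f g Y \<phi>0 \<phi> \<psi> \<longrightarrow>
               (\<forall>t\<in>{0..T}. \<forall>i i0. \<forall>x\<in>simplex_coords. \<psi> t i i0 x = \<phi>star t i i0 x))))"
proof -
  note T = assms(1) and Q = assms(4) and Q0 = assms(5) and q_lip = assms(7) and q0_lip = assms(8)
    and f_lip = assms(9) and f0_lip = assms(10) and g_lip = assms(11) and g0_lip = assms(12) and q_bound = assms(13)
    and Y0 = assms(16) and Y = assms(17)
    and ex0 = assms(18) and min0_lip = assms(19) and ex = assms(20) and min_lip = assms(21)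
  have game: "mean_field_game T A q L C \<phi> A0 q0 f0 g0 f g L\<alpha>0 L\<alpha> Y0 Y" if "admissible_minor T A \<phi>"
    for \<phi> :: "('a, 'k, 'm) minor_feedback"
    by unfold_locales (fact T Q q_lip q_bound that Q0 q0_lip f0_lip g0_lip f_lip g_lip ex0 min0_lip ex min_lip
        | rule Y0[OF _ that] Y[OF _ that], assumption+)+
  show ?thesis
    unfolding Let_def
    using mean_field_game.major_unique_best_response[OF game] mean_field_game.minor_unique_best_response[OF game]
    by blast
qed

end
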